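(* Let $X$ be a compact subset of a Banach space, with Borel $\sigma$-algebra $\mathcal{B}$, and let $\varphi:X\to\mathcal{K}(X)$ be a lower semicontinuous multivalued map with convex (nonempty compact) values such that, for every $\mu\in\mathcal{M}_1(\varphi)$ and all $A,B\in\mathcal{B}$, \[ \mu(\varphi_{+}^{-1}(A))=\mu(A)\quad\text{and}\quad \mu(\varphi_{+}^{-1}(A)\cap\varphi_{+}^{-1}(B)) = \mu(\varphi_{+}^{-1}(A\cap B)). \] Suppose moreover that $h_\mu(\varphi)\geq h_\mu(f)$ for every single-valued continuous selection $f\subset\varphi$ of $\varphi$ and every $f$-invariant Borel probability measure $\mu$. Then \[ \sup_{\mu\in\mathcal{M}_1(\varphi)} h_\mu(\varphi) = h_+(\varphi), \] where $h_\mu(\varphi)$ is the metric entropy and $h_+(\varphi)$ is the topological entropy of $\varphi$.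
   Context: Multivalued maps. A multivalued map $\varphi:X\multimap Y$ assigns to each $x\in X$ a nonempty subset $\varphi(x)\subset Y$; the notation $\varphi:X\to\mathcal{K}(Y)$ means that all values are nonempty and compact. For $B\subset Y$ the large preimage is $\varphi^{-1}_+(B):=\{x\in X:\varphi(x)\cap B\neq\emptyset\}$. The map $\varphi$ is lower semicontinuous (l.s.c.) if $\varphi^{-1}_+(B)$ is open for every open $B\subset Y$. For $\varphi:X\multimap X$, iterates are $\varphi^0(x)=\{x\}$, $\varphi^{k+1}(x)=\bigcup_{y\in\varphi^k(x)}\varphi(y)$, and $\varphi_+^{-k}(B)=\{x\in X:\varphi^k(x)\cap B\ne\emptyset\}$. A continuous selection $f\subset\varphi$ is a continuous $f:X\to X$ with $f(x)\in\varphi(x)$ for every $x\in X$. Invariant measures. A Borel probability measure $\mu$ on $X$ is $\varphi$-invariant if $\mu(\varphi^{-1}_+(A))\ge\mu(A)$ for every $A\in\mathcal{B}$. $\mathcal{M}_1(\varphi)$ is the set of all $\varphi$-invariant measures. Metric entropy $h_\mu(\varphi)$. A measurable partition of $X$ is a countable family of pairwise disjoint measurable sets whose union has full measure; its entropy is $H_\mu(\mathcal{P})=-\sum_{P\in\mathcal{P}}\mu(P)\log\mu(P)$ with $0\log 0=0$. For a totally ordered finite partition $\mathcal{P}=\{P_1,\dots,P_m\}$ put $\tilde{\mathcal{P}}_0=\mathcal{P}$ and, for $k\ge1$, let $\tilde{\mathcal{P}}_k$ be the family with elements $\tilde P_{1,k}=\varphi^{-k}_+(P_1)$ and $\tilde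 P_{j,k}=\varphi^{-k}_+(P_j)\setminus\bigcup_{i<j}\varphi^{-k}_+(P_i)$, $j=2,\dots,m$. Let $\mathcal{P}'_n=\bigvee_{k=0}^{n-1}\tilde{\mathcal{P}}_k$ be the family of all nonempty sets $Q_0\cap\dots\cap Q_{n-1}$ with $Q_k\in\tilde{\mathcal{P}}_k$. Set $h_\mu(\varphi,\mathcal{P})=\limsup_{n\to\infty}\frac1n H_\mu(\mathcal{P}'_n)$ and $h_\mu(\varphi)=\sup_{\mathcal{P}}h_\mu(\varphi,\mathcal{P})$, the supremum being over all finite totally ordered partitions of $X$. For a single-valued map $f$ (viewed as $x\mapsto\{f(x)\}$) this is the usual Kolmogorov–Sinai entropy $h_\mu(f)$. Topological entropy $h_+(\varphi)$ (for l.s.c. $\varphi:X\multimap X$, $X$ compact metric). For an open cover $\mathcal{A}$ of $X$ let $\mathcal{A}^n_{\varphi_+}=\bigvee_{j=0}^{n-1}\varphi_+^{-j}(\mathcal{A})$ be the open cover consisting of all nonempty sets $\bigcap_{j=0}^{n-1}\varphi_+^{-j}(A_j)$ with $A_j\in\mathcal{A}$, and let $\mathrm{N}(\mathcal{A}^n_{\varphi_+})$ be the minimal cardinality of a subcover of it. Set $h_+(\varphi,\mathcal{A})=\lim_{n\to\infty}\frac1n\log\mathrm{N}(\mathcal{A}^n_{\varphi_+})$ (the limit exists) and $h_+(\varphi)=\sup\{h_+(\varphi,\mathcal{A}):\mathcal{A}\text{ an open cover of }X\}$. *)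

theory Defs
  imports "HOL-Probability.Probability"
begin

definition multimap_on :: "'a set \<Rightarrow> ('a \<Rightarrow> 'a set) \<Rightarrow> bool" where
  "multimap_on X \<phi> \<longleftrightarrow> (\<forall>x\<in>X. \<phi> x \<noteq> {} \<and> \<phi> x \<subseteq> X)"

definition large_preimage :: "'a set \<Rightarrow> ('a \<Rightarrow> 'a set) \<Rightarrow> 'a set \<Rightarrow> 'a set" where
  "large_preimage X \<phi> B = {x\<in>X. \<phi> x \<inter> B \<noteq> {}}"

definition lsc_on :: "'a::topological_space set \<Rightarrow> ('a \<Rightarrow> 'a set) \<Rightarrow> bool" where
  "lsc_on X \<phi> \<longleftrightarrow>
     (\<forall>B. openin (top_of_set X) B \<longrightarrow> openin (top_of_set X) (large_preimage X \<phi> B))"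

primrec multi_iter :: "('a \<Rightarrow> 'a set) \<Rightarrow> nat \<Rightarrow> 'a \<Rightarrow> 'a set" where
  "multi_iter \<phi> 0 x = {x}"
| "multi_iter \<phi> (Suc k) x = (\<Union>y\<in>multi_iter \<phi> k x. \<phi> y)"

definition iter_preimage :: "'a set \<Rightarrow> ('a \<Rightarrow> 'a set) \<Rightarrow> nat \<Rightarrow> 'a set \<Rightarrow> 'a set" where
  "iter_preimage X \<phi> k B = large_preimage X (multi_iter \<phi> k) B"

definition continuous_selection ::
    "'a::topological_space set \<Rightarrow> ('a \<Rightarrow> 'a set) \<Rightarrow> ('a \<Rightarrow> 'a) \<Rightarrow> bool" where
  "continuous_selection X \<phi> f \<longleftrightarrow> continuous_on X f \<and> (\<forall>x\<in>X. f x \<in> \<phi> x)"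

definition borel_prob_on :: "'a::topological_space set \<Rightarrow> 'a measure \<Rightarrow> bool" where
  "borel_prob_on X \<mu> \<longleftrightarrow> prob_space \<mu> \<and> sets \<mu> = sets (restrict_space borel X)"

text \<open>
  For a lower semicontinuous map with compact values on a compact metric space, the large
  preimage of a Borel set is an analytic set, which need not be Borel; the same holds for the
  preimages under the iterates. Analytic sets, and the Boolean combinations of them occurring
  below, are universally measurable, so \<open>\<mu>\<close> is evaluated on them through its
  unique extension to the completed sigma-algebra. On every set measurable for the completion of
  \<open>\<mu>\<close> that extension is given by \<^const>\<open>outer_measure_of\<close>. (A plain
  \<^const>\<open>emeasure\<close> would return the value 0 on preimages that are not Borel.)
\<close>

definition invariant_measures ::
    "'a::topological_space set \<Rightarrow> ('a \<Rightarrow> 'a set) \<Rightarrow> 'a measure set" where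
  "invariant_measures X \<phi> =
     {\<mu>. borel_prob_on X \<mu> \<and>
          (\<forall>A\<in>sets \<mu>. outer_measure_of \<mu> (large_preimage X \<phi> A) \<ge> emeasure \<mu> A)}"

definition map_invariant_measures ::
    "'a::topological_space set \<Rightarrow> ('a \<Rightarrow> 'a) \<Rightarrow> 'a measure set" where
  "map_invariant_measures X f =
     {\<mu>. borel_prob_on X \<mu> \<and> (\<forall>A\<in>sets \<mu>. emeasure \<mu> (f -` A \<inter> X) = emeasure \<mu> A)}"

definition partition_entropy :: "'a measure \<Rightarrow> 'a set set \<Rightarrow> real" where
  "partition_entropy \<mu> \<P> =
     - (\<Sum>P\<in>\<P>. enn2real (outer_measure_of \<mu> P) * ln (enn2real (outer_measure_of \<mu> P)))"

text \<open>
  A totally ordered finite partition is the list of its members in increasing order. The members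
  need only cover \<open>X\<close> up to a null set.
\<close>

definition ordered_partition :: "'a measure \<Rightarrow> 'a set list \<Rightarrow> bool" where
  "ordered_partition \<mu> Ps \<longleftrightarrow>
     distinct Ps \<and> disjoint (set Ps) \<and> set Ps \<subseteq> sets \<mu> \<and>
     emeasure \<mu> (\<Union>(set Ps)) = emeasure \<mu> (space \<mu>)"

definition tilde_partition ::
    "'a set \<Rightarrow> ('a \<Rightarrow> 'a set) \<Rightarrow> 'a set list \<Rightarrow> nat \<Rightarrow> 'a set set" where
  "tilde_partition X \<phi> Ps k =
     (if k = 0 then set Ps
      else {iter_preimage X \<phi> k (Ps ! j) - (\<Union>i<j. iter_preimage X \<phi> k (Ps ! i)) | j.
              j < length Ps})"

text \<open>
  The join of the first \<open>n\<close> families of a sequence of families of subsets of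
  \<open>X\<close>; only nonempty intersections are kept.
\<close>

definition join_upto :: "'a set \<Rightarrow> (nat \<Rightarrow> 'a set set) \<Rightarrow> nat \<Rightarrow> 'a set set" where
  "join_upto X \<F> n =
     {X \<inter> (\<Inter>k<n. Q k) | Q. (\<forall>k<n. Q k \<in> \<F> k) \<and> X \<inter> (\<Inter>k<n. Q k) \<noteq> {}}"

text \<open>
  Entropies take values in \<open>[0, \<infinity>]\<close>, hence the type \<^typ>\<open>ennreal\<close>;
  no truncation takes place, since all real quantities embedded by \<^const>\<open>ennreal\<close>
  below are nonnegative.
\<close>

definition metric_entropy_part ::
    "'a set \<Rightarrow> 'a measure \<Rightarrow> ('a \<Rightarrow> 'a set) \<Rightarrow> 'a set list \<Rightarrow> ennreal" where
  "metric_entropy_part X \<mu> \<phi> Ps =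
     limsup (\<lambda>n. ennreal (partition_entropy \<mu> (join_upto X (tilde_partition X \<phi> Ps) n) / real n))"

definition metric_entropy ::
    "'a set \<Rightarrow> 'a measure \<Rightarrow> ('a \<Rightarrow> 'a set) \<Rightarrow> ennreal" where
  "metric_entropy X \<mu> \<phi> = (SUP Ps\<in>{Ps. ordered_partition \<mu> Ps}. metric_entropy_part X \<mu> \<phi> Ps)"

definition map_entropy :: "'a set \<Rightarrow> 'a measure \<Rightarrow> ('a \<Rightarrow> 'a) \<Rightarrow> ennreal" where
  "map_entropy X \<mu> f = metric_entropy X \<mu> (\<lambda>x. {f x})"

definition open_cover :: "'a::topological_space set \<Rightarrow> 'a set set \<Rightarrow> bool" where
  "open_cover X \<A> \<longleftrightarrow> (\<forall>A\<in>\<A>. openin (top_of_set X) A) \<and> \<Union>\<A> = X"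

text \<open>
  Finiteness is required explicitly because \<^const>\<open>card\<close> is 0 on infinite sets; for
  open covers of a compact set a finite subcover exists.
\<close>

definition min_subcover_card :: "'a set \<Rightarrow> 'a set set \<Rightarrow> nat" where
  "min_subcover_card X \<C> = (LEAST m. \<exists>\<D>\<subseteq>\<C>. finite \<D> \<and> \<Union>\<D> = X \<and> card \<D> = m)"

definition cover_iter ::
    "'a set \<Rightarrow> ('a \<Rightarrow> 'a set) \<Rightarrow> 'a set set \<Rightarrow> nat \<Rightarrow> 'a set set" where
  "cover_iter X \<phi> \<A> n = join_upto X (\<lambda>j. iter_preimage X \<phi> j ` \<A>) n"

definition top_entropy_cover ::
    "'a set \<Rightarrow> ('a \<Rightarrow> 'a set) \<Rightarrow> 'a set set \<Rightarrow> real" where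
  "top_entropy_cover X \<phi> \<A> =
     lim (\<lambda>n. ln (real (min_subcover_card X (cover_iter X \<phi> \<A> n))) / real n)"

definition top_entropy ::
    "'a::topological_space set \<Rightarrow> ('a \<Rightarrow> 'a set) \<Rightarrow> ennreal" where
  "top_entropy X \<phi> = (SUP \<A>\<in>{\<A>. open_cover X \<A>}. ennreal (top_entropy_cover X \<phi> \<A>))"

end

theory Submission
  imports Defs
begin

text \<open>
  By Michael's theorem \<open>\<phi>\<close> has a continuous selection \<open>f\<close>. Let \<open>\<mu>\<close> be
  \<open>\<phi>\<close>-invariant. As \<open>f -` A \<subseteq> large_preimage X \<phi> A\<close> and the latter has
  measure \<open>\<mu> A\<close>, passing to complements shows that \<open>\<mu>\<close> is \<open>f\<close>-invariant; then
  the two preimages agree up to a null set, also for all iterates. So the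
  \<open>\<phi>\<close>-invariant and the \<open>f\<close>-invariant measures coincide, and the entropy of
  \<open>\<phi>\<close> is computed from \<open>f\<close>-itineraries. It remains to run the proof of the variational
  principle: Goodwyn's half for covers iterated under \<open>\<phi>\<close> (which agree almost everywhere
  with those iterated under \<open>f\<close>), and Misiurewicz's half for \<open>f\<close>, whose iterated covers
  are finer than those of \<open>\<phi>\<close>.
\<close>

text \<open>Large preimages of Borel sets need not be Borel, so \<open>\<phi>\<close> and
  \<open>f\<close> are compared up to null sets: equality of outer measures forces a null
  difference, and \<open>\<phi>\<close> pulls null sets back to null sets. In Goodwyn's half,
  replacing a partition by compact cores costs a bounded amount of entropy per step. Instead of
  removing this cost by passing to powers of the map, which would need the hypotheses for powers of
  \<open>\<phi>\<close>, whole blocks of length \<open>q\<close> of an \<open>f\<close>-itinerary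
  are labelled at once: the cost 3 is paid once per block and becomes negligible as \<open>q\<close>
  grows. In Misiurewicz's half no weak topology on measures is used. All subsets of \<open>X\<close>
  are measured at once, a cluster point of the empirical measures is a finitely additive
  \<open>m\<close>, and a Borel measure is rebuilt from the values of \<open>m\<close> on compact
  sets. It lies below \<open>m\<close> on open sets. This suffices: on the cells of a partition with
  locally constant labels off a null set it still lies below \<open>m\<close>, and both have total
  mass 1, hence they agree there.\<close>

section \<open>Shannon entropy of finite-valued functions\<close>

definition eta :: "real \<Rightarrow> real" where
  "eta t = - (t * ln t)"

lemma eta_0 [simp]: "eta 0 = 0"
  by (simp add: eta_def)

lemma eta_nonneg: "0 \<le> t \<Longrightarrow> t \<le> 1 \<Longrightarrow> 0 \<le> eta t"
  by (cases "t = 0") (auto simp: eta_def mult_le_0_iff)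

text \<open>The right side is the tangent at \<open>c\<close> of the concave function
  \<open>eta\<close>. It comes from ln x \<le> x - 1 at x = c / p.\<close>

lemma eta_le_tangent:
  assumes "0 \<le> p" "0 < c"
  shows "eta p \<le> p * - ln c - p + c"
proof (cases "p = 0")
  case False
  then have "ln (c / p) \<le> c / p - 1"
    using assms by (intro ln_le_minus_one) auto
  then have "p * ln (c / p) \<le> p * (c / p - 1)"
    using assms by (intro mult_left_mono) auto
  with False assms show ?thesis
    by (simp add: eta_def ln_div algebra_simps)
qed (use assms in simp)

lemma eta_le_1: "0 \<le> t \<Longrightarrow> t \<le> 1 \<Longrightarrow> eta t \<le> 1"
  using eta_le_tangent[of t 1] by simp

text \<open>The inequality ln x \<le> x - 1 at x = 1 / sqrt t. It gives continuity at 0 and an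
  explicit measure bound that makes \<open>eta\<close> small.\<close>

lemma eta_le_sqrt:
  assumes "0 \<le> t"
  shows "eta t \<le> 2 * sqrt t"
proof (cases "t = 0")
  case False
  then have "ln (1 / sqrt t) \<le> 1 / sqrt t"
    using assms ln_le_minus_one[of "1 / sqrt t"] by simp
  then have "- ln t \<le> 2 / sqrt t"
    using False assms by (simp add: ln_div ln_sqrt)
  then have "t * - ln t \<le> t * (2 / sqrt t)"
    using assms by (intro mult_left_mono) auto
  also have "t * (2 / sqrt t) = 2 * (t / sqrt t)"
    by simp
  also have "\<dots> = 2 * sqrt t"
    by (simp only: real_div_sqrt[OF assms])
  finally show ?thesis
    by (simp add: eta_def)
qed simp

lemma isCont_eta:
  assumes "0 \<le> t"
  shows "continuous (at t within {0..}) eta"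
proof (cases "t = 0")
  case True
  have "((\<lambda>s. 2 * sqrt s) \<longlongrightarrow> 2 * sqrt 0) (at 0 within {0..})"
    by (intro tendsto_intros)
  moreover have "\<forall>\<^sub>F s in at 0 within {0..}. 0 \<le> eta s"
  proof -
    have "\<forall>\<^sub>F s in at 0 within {0..}. (s::real) < 1"
      by (intro order_tendstoD(2)[OF tendsto_ident_at]) simp
    moreover have "\<forall>\<^sub>F s in at 0 within {0..}. s \<in> {0::real..}"
      by (auto simp: eventually_at_filter)
    ultimately show ?thesis
      by eventually_elim (simp add: eta_nonneg)
  qed
  moreover have "\<forall>\<^sub>F s in at 0 within {0..}. eta s \<le> 2 * sqrt s"
    by (auto simp: eventually_at_filter eta_le_sqrt)
  ultimately have "(eta \<longlongrightarrow> 0) (at 0 within {0..})"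
    using tendsto_sandwich[of "\<lambda>_. 0" eta "at 0 within {0..}" "\<lambda>s. 2 * sqrt s" 0] by simp
  with True show ?thesis
    by (simp add: continuous_within)
next
  case False
  with assms have "isCont eta t"
    unfolding eta_def[abs_def] by (intro continuous_intros) auto
  then show ?thesis
    by (rule continuous_at_imp_continuous_at_within)
qed

lemma tendsto_eta:
  assumes "(p \<longlongrightarrow> a) F" "\<forall>\<^sub>F x in F. 0 \<le> p x" "0 \<le> a"
  shows "((\<lambda>x. eta (p x)) \<longlongrightarrow> eta a) F"
  using continuous_within_tendsto_compose[OF isCont_eta[OF assms(3)], of p F] assms by simp

text \<open>Jensen's inequality: average the tangent bounds at the mean \<open>c\<close>. A mean of
  0 is treated apart, since \<open>eta\<close> has no finite slope there; then every weight or every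
  argument in a term is 0.\<close>

lemma eta_concave_sum:
  assumes "finite I" "\<And>i. i \<in> I \<Longrightarrow> 0 \<le> w i" "\<And>i. i \<in> I \<Longrightarrow> 0 \<le> p i" "sum w I = 1"
  shows "(\<Sum>i\<in>I. w i * eta (p i)) \<le> eta (\<Sum>i\<in>I. w i * p i)"
proof -
  define c where "c = (\<Sum>i\<in>I. w i * p i)"
  have c0: "0 \<le> c"
    unfolding c_def using assms by (intro sum_nonneg) auto
  show ?thesis
  proof (cases "c = 0")
    case True
    then have "\<forall>i\<in>I. w i * p i = 0"
      unfolding c_def using assms by (subst (asm) sum_nonneg_eq_0_iff) auto
    then have "(\<Sum>i\<in>I. w i * eta (p i)) = 0"
      by (intro sum.neutral) (auto simp: eta_def)
    with True show ?thesis
      by (simp add: c_def[symmetric])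
  next
    case False
    have "(\<Sum>i\<in>I. w i * eta (p i)) \<le> (\<Sum>i\<in>I. w i * (p i * - ln c - p i + c))"
      using assms c0 False by (intro sum_mono mult_left_mono eta_le_tangent) auto
    also have "\<dots> = - ln c * (\<Sum>i\<in>I. w i * p i) - (\<Sum>i\<in>I. w i * p i) + (\<Sum>i\<in>I. w i) * c"
      by (simp add: algebra_simps sum.distrib sum_subtractf sum_distrib_left sum_negf)
    also have "\<dots> = eta c"
      using assms(4) by (simp add: c_def[symmetric] eta_def)
    finally show ?thesis
      by (simp add: c_def)
  qed
qed

text \<open>Shannon entropy of a partition given by a label function whose fibres are the cells.
  Joins become pairs or lists of labels, and refinement means that one label determines
  another.\<close>

definition ent :: "'a measure \<Rightarrow> ('a \<Rightarrow> 'b) \<Rightarrow> real" where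
  "ent M g = (\<Sum>y\<in>g ` space M. eta (measure M (g -` {y} \<inter> space M)))"

lemma ent_eq_sum:
  assumes "finite S" "g ` space M \<subseteq> S"
  shows "ent M g = (\<Sum>y\<in>S. eta (measure M (g -` {y} \<inter> space M)))"
  unfolding ent_def
proof (rule sum.mono_neutral_left[OF assms], intro ballI)
  fix y assume "y \<in> S - g ` space M"
  then have "g -` {y} \<inter> space M = {}" by auto
  then show "eta (measure M (g -` {y} \<inter> space M)) = 0" by simp
qed

context prob_space
begin

lemma information_space_exp: "information_space M (exp 1)"
  by unfold_locales simp

text \<open>The base \<open>exp 1\<close> turns the logarithm of the library into \<open>ln\<close>,
  so its chain rule and data processing inequality become available.\<close>

lemma ent_eq_entropy:
  assumes "simple_function M g"
  shows "ent M g = entropy (exp 1) (count_space (g ` space M)) g"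
  unfolding ent_def eta_def sum_negf
  using information_space.entropy_simple_distributed[OF information_space_exp
      simple_distributedI[OF assms measure_nonneg refl]]
  by (simp add: log_def sum_negf)

lemma ent_Pair_le:
  assumes "simple_function M X" "simple_function M Y"
  shows "ent M (\<lambda>x. (X x, Y x)) \<le> ent M X + ent M Y"
  using information_space.entropy_chain_rule[OF information_space_exp assms]
    information_space.conditional_entropy_less_eq_entropy[OF information_space_exp assms(2,1)]
  by (simp add: ent_eq_entropy assms simple_function_Pair)

lemma ent_compose_le:
  assumes "simple_function M X"
  shows "ent M (\<lambda>x. f (X x)) \<le> ent M X"
  using information_space.entropy_data_processing[OF information_space_exp assms, of f]
  by (simp add: ent_eq_entropy assms simple_function_compose[of _ _ f, unfolded comp_def] comp_def)

text \<open>Monotonicity under refinement, in a form checked pointwise: \<open>f\<close> reads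
  \<open>Y\<close> off a chosen representative of each fibre of \<open>X\<close>.\<close>

lemma ent_le_of_determined:
  assumes "simple_function M X" "simple_function M Y"
    and "\<And>x y. x \<in> space M \<Longrightarrow> y \<in> space M \<Longrightarrow> X x = X y \<Longrightarrow> Y x = Y y"
  shows "ent M Y \<le> ent M X"
proof -
  define f where "f = (\<lambda>v. Y (SOME x. x \<in> space M \<and> X x = v))"
  have "f (X x) = Y x" if "x \<in> space M" for x
    unfolding f_def using that by (intro assms(3)) (metis (mono_tags, lifting) someI_ex)+
  then have "ent M Y = ent M (\<lambda>x. f (X x))"
    unfolding ent_def by (intro sum.cong arg_cong[where f = eta] arg_cong[where f = "measure M"]) auto
  with ent_compose_le[OF assms(1), of f] show ?thesis by simp
qed

text \<open>Labels outside \<open>S\<close> have probability 0 and do not count. The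
  almost-everywhere form is needed because iterated \<open>\<phi>\<close>-covers constrain
  \<open>f\<close>-orbits only off a null set.\<close>

lemma ent_le_ln_card:
  assumes "simple_function M X" "finite S" "AE x in M. X x \<in> S"
  shows "ent M X \<le> ln (card S)"
proof -
  let ?f = "\<lambda>v. prob (X -` {v} \<inter> space M)"
  let ?T = "X ` space M \<inter> {v. ?f v \<noteq> 0}"
  have "?T \<subseteq> S"
  proof
    fix v assume v: "v \<in> ?T"
    show "v \<in> S"
    proof (rule ccontr)
      assume "v \<notin> S"
      then have "AE x in M. x \<notin> X -` {v} \<inter> space M"
        by (intro AE_mp[OF assms(3) AE_I2]) auto
      with prob_eq_0[OF simple_functionD(2)[OF assms(1), of "{v}"]]
      have "prob (X -` {v} \<inter> space M) = 0"
        by blast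
      with v show False by simp
    qed
  qed
  then have card: "card ?T \<le> card S"
    by (intro card_mono assms)
  have "ent M X \<le> ln (card ?T)"
    using information_space.entropy_le_card_not_0[OF information_space_exp
        simple_distributedI[OF assms(1) measure_nonneg refl]]
    by (simp add: ent_eq_entropy assms log_def)
  also have "\<dots> \<le> ln (card S)"
  \<comment> \<open>Here \<open>ln 0 = 0\<close>, and the logarithm of a natural number is never
    negative.\<close>
  proof (cases "card ?T = 0")
    case True
    then show ?thesis by (cases "card S = 0") auto
  next
    case False
    with card show ?thesis by simp
  qed
  finally show ?thesis .
qed

lemma ent_nonneg: "0 \<le> ent M g"
  unfolding ent_def by (intro sum_nonneg eta_nonneg) auto

end

section \<open>Itineraries, whose fibres are the cells of a join along an orbit\<close>

definition itinerary :: "('a \<Rightarrow> 'b) \<Rightarrow> ('a \<Rightarrow> 'a) \<Rightarrow> nat \<Rightarrow> 'a \<Rightarrow> 'b list" where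
  "itinerary p f n x = map (\<lambda>j. p ((f ^^ j) x)) [0..<n]"

lemma length_itinerary [simp]: "length (itinerary p f n x) = n"
  by (simp add: itinerary_def)

lemma nth_itinerary [simp]: "j < n \<Longrightarrow> itinerary p f n x ! j = p ((f ^^ j) x)"
  by (simp add: itinerary_def)

lemma itinerary_eq_iff:
  "itinerary p f n x = itinerary p' f' n y \<longleftrightarrow> (\<forall>j<n. p ((f ^^ j) x) = p' ((f' ^^ j) y))"
  by (auto simp: list_eq_iff_nth_eq)

lemma simple_function_itinerary:
  assumes "simple_function M p" "f \<in> M \<rightarrow>\<^sub>M M"
  shows "simple_function M (itinerary p f n)"
proof (induction n)
  case 0
  show ?case by (simp add: itinerary_def[abs_def])
next
  case (Suc n)
  have "f ^^ n \<in> M \<rightarrow>\<^sub>M M"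
    by (rule measurable_compose_n[OF assms(2)])
  note m = this
  have "(\<lambda>x. p ((f ^^ n) x)) ` space M \<subseteq> p ` space M"
    using measurable_space[OF m] by auto
  then have "simple_function M (\<lambda>x. p ((f ^^ n) x))"
    using assms(1) measurable_compose[OF m, of p] unfolding simple_function_eq_measurable
    by (simp add: finite_subset)
  then have "simple_function M (\<lambda>x. (\<lambda>(a, b). a @ [b]) (itinerary p f n x, p ((f ^^ n) x)))"
    by (intro simple_function_compose1[where g = "\<lambda>(a, b). a @ [b]"] simple_function_Pair Suc)
  then show ?case
    by (simp add: itinerary_def)
qed

section \<open>Continuous selections\<close>

text \<open>A partition of unity subordinate to finitely many sets on which \<open>\<phi> x\<close>
  meets a ball of radius \<open>e\<close> about \<open>y\<close> averages the centres
  \<open>y\<close>. Replacing each active centre by a nearby point of \<open>\<phi> x\<close> gives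
  a convex combination inside \<open>\<phi> x\<close>, at distance at most \<open>e\<close>.\<close>

lemma approximate_selection:
  fixes X :: "'a::metric_space set" and \<phi> :: "'a \<Rightarrow> 'b::real_normed_vector set"
  assumes X: "compact X"
    and nonempty: "\<And>x. x \<in> X \<Longrightarrow> \<phi> x \<noteq> {}"
    and convex: "\<And>x. x \<in> X \<Longrightarrow> convex (\<phi> x)"
    and lsc: "\<And>B. open B \<Longrightarrow> openin (top_of_set X) {x\<in>X. \<phi> x \<inter> B \<noteq> {}}"
    and "0 < e"
  obtains g where "continuous_on X g" "\<And>x. x \<in> X \<Longrightarrow> \<exists>y\<in>\<phi> x. dist (g x) y \<le> e"
proof -
  have "\<forall>y. \<exists>T. open T \<and> {x\<in>X. \<phi> x \<inter> ball y e \<noteq> {}} = X \<inter> T"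
    using lsc[OF open_ball] by (auto simp: openin_open)
  then obtain T where T: "\<And>y. open (T y)" "\<And>y. {x\<in>X. \<phi> x \<inter> ball y e \<noteq> {}} = X \<inter> T y"
    by metis
  have "X \<subseteq> (\<Union>y\<in>UNIV. T y)"
  proof
    fix x assume x: "x \<in> X"
    then obtain y where "y \<in> \<phi> x" using nonempty by auto
    then have "x \<in> {x\<in>X. \<phi> x \<inter> ball y e \<noteq> {}}"
      using \<open>0 < e\<close> x centre_in_ball by blast
    then show "x \<in> (\<Union>y\<in>UNIV. T y)" using T(2) by auto
  qed
  then obtain Y where Y: "finite Y" "X \<subseteq> (\<Union>y\<in>Y. T y)"
    using compactE_image[OF X, of UNIV T] T(1) by metis
  \<comment> \<open>The distance to an empty complement is 0 by convention, so the case
    \<open>T y = UNIV\<close> needs a positive value of its own.\<close>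
  define w where "w y x = (if T y = UNIV then 1 else infdist x (- T y))" for y x
  have w_nonneg: "0 \<le> w y x" for y x
    by (auto simp: w_def infdist_nonneg)
  have w_pos: "0 < w y x \<longleftrightarrow> x \<in> T y" for y x
  proof (cases "T y = UNIV")
    case False
    then have "infdist x (- T y) = 0 \<longleftrightarrow> x \<notin> T y"
      using in_closed_iff_infdist_zero[of "- T y" x] T(1)[of y] by (auto simp: closed_Compl)
    with False infdist_nonneg[of x "- T y"] show ?thesis
      by (auto simp: w_def less_le)
  qed (simp add: w_def)
  have w_cont: "continuous_on X (w y)" for y
    by (cases "T y = UNIV") (auto simp: w_def[abs_def] intro!: continuous_intros)
  define s where "s x = (\<Sum>y\<in>Y. w y x)" for x
  have s_pos: "0 < s x" if "x \<in> X" for x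
  proof -
    from that Y obtain y where "y \<in> Y" "x \<in> T y" by auto
    then show ?thesis
      unfolding s_def using Y w_pos w_nonneg by (intro sum_pos2[of _ y]) auto
  qed
  define g where "g x = (\<Sum>y\<in>Y. (w y x / s x) *\<^sub>R y)" for x
  show thesis
  proof
    have "continuous_on X s"
      unfolding s_def[abs_def] by (intro continuous_intros w_cont)
    then show "continuous_on X g"
      unfolding g_def[abs_def] using s_pos
      by (intro continuous_intros w_cont) force+
  next
    fix x assume x: "x \<in> X"
    define c where "c y = w y x / s x" for y
    have c: "(\<Sum>y\<in>Y. c y) = 1" "\<And>y. 0 \<le> c y"
      using s_pos[OF x] w_nonneg by (auto simp: c_def s_def sum_divide_distrib[symmetric])
    have "\<exists>z\<in>\<phi> x. x \<in> T y \<longrightarrow> dist y z < e" for y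
    proof (cases "x \<in> T y")
      case True
      with x have "x \<in> {x\<in>X. \<phi> x \<inter> ball y e \<noteq> {}}" using T(2)[of y] by auto
      then show ?thesis by auto
    qed (use nonempty x in auto)
    then obtain z where z: "\<And>y. z y \<in> \<phi> x" "\<And>y. x \<in> T y \<Longrightarrow> dist y (z y) < e"
      by metis
    have "(\<Sum>y\<in>Y. c y *\<^sub>R z y) \<in> \<phi> x"
      using Y c z convex[OF x] by (intro convex_sum) auto
    moreover have "dist (g x) (\<Sum>y\<in>Y. c y *\<^sub>R z y) \<le> e"
    proof -
      have "dist (g x) (\<Sum>y\<in>Y. c y *\<^sub>R z y) = norm (\<Sum>y\<in>Y. c y *\<^sub>R (y - z y))"
        by (simp add: g_def c_def dist_norm sum_subtractf scaleR_diff_right)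
      also have "\<dots> \<le> (\<Sum>y\<in>Y. c y * e)"
      proof (rule sum_norm_le)
        fix y assume "y \<in> Y"
        show "norm (c y *\<^sub>R (y - z y)) \<le> c y * e"
        proof (cases "x \<in> T y")
          case True
          with z(2)[of y] c(2)[of y] show ?thesis
            by (auto simp: dist_norm intro!: mult_left_mono)
        next
          case False
          then have "c y = 0"
            using w_pos[of y x] w_nonneg[of y x] by (simp add: c_def)
          then show ?thesis by simp
        qed
      qed
      also have "\<dots> = e"
        using c(1) by (simp add: sum_distrib_right[symmetric])
      finally show ?thesis .
    qed
    ultimately show "\<exists>y\<in>\<phi> x. dist (g x) y \<le> e" by blast
  qed
qed

text \<open>A point of the open ball has some distance to spare, so it survives a small motion of
  both the centre and the point. This keeps lower semicontinuity when each approximation is confined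
  to a ball about the previous one.\<close>

lemma lsc_Int_ball:
  fixes X :: "'a::metric_space set" and \<phi> :: "'a \<Rightarrow> 'b::metric_space set"
  assumes lsc: "\<And>B. open B \<Longrightarrow> openin (top_of_set X) {x\<in>X. \<phi> x \<inter> B \<noteq> {}}"
    and f: "continuous_on X f" and "open B"
  shows "openin (top_of_set X) {x\<in>X. (\<phi> x \<inter> ball (f x) r) \<inter> B \<noteq> {}}"
proof (subst openin_subopen, intro ballI)
  fix x assume "x \<in> {x\<in>X. (\<phi> x \<inter> ball (f x) r) \<inter> B \<noteq> {}}"
  then obtain y where x: "x \<in> X" and y: "y \<in> \<phi> x" "dist (f x) y < r" "y \<in> B"
    by auto
  obtain d0 where d0: "d0 > 0" "ball y d0 \<subseteq> B"
    using \<open>open B\<close> \<open>y \<in> B\<close> open_contains_ball by blast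
  \<comment> \<open>Half of the slack: the centre and the point may each move by less than
    \<open>d\<close>.\<close>
  define d where "d = min d0 ((r - dist (f x) y) / 2)"
  have d: "d > 0" "ball y d \<subseteq> B" "dist (f x) y + 2 * d \<le> r"
    using d0 y by (auto simp: d_def subset_eq min_def field_simps)
  let ?T = "{x'\<in>X. \<phi> x' \<inter> ball y d \<noteq> {}} \<inter> (X \<inter> f -` ball (f x) d)"
  have "openin (top_of_set X) ?T"
    by (intro openin_Int lsc continuous_openin_preimage_gen[OF f]) auto
  moreover have "x \<in> ?T"
    using x y d by (auto intro!: exI[of _ y])
  moreover have "?T \<subseteq> {x\<in>X. (\<phi> x \<inter> ball (f x) r) \<inter> B \<noteq> {}}"
  proof
    fix x' assume "x' \<in> ?T"
    then obtain y' where y': "x' \<in> X" "y' \<in> \<phi> x'" "dist y y' < d" "dist (f x) (f x') < d"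
      by auto
    have "dist (f x') y' \<le> dist (f x') (f x) + dist (f x) y + dist y y'"
      using dist_triangle[of "f x'" y' "f x"] dist_triangle[of "f x" y' y] by linarith
    then have "dist (f x') y' < r"
      using y' d by (simp add: dist_commute)
    with y' d(2) have "y' \<in> \<phi> x' \<inter> ball (f x') r \<inter> B"
      by auto
    with y'(1) show "x' \<in> {x\<in>X. (\<phi> x \<inter> ball (f x) r) \<inter> B \<noteq> {}}"
      by blast
  qed
  ultimately show "\<exists>T. openin (top_of_set X) T \<and> x \<in> T \<and>
      T \<subseteq> {x\<in>X. (\<phi> x \<inter> ball (f x) r) \<inter> B \<noteq> {}}"
    by blast
qed

text \<open>Successive approximate selections, each chosen inside a shrinking ball about the one
  before, converge uniformly because their increments are dominated by a geometric series. Closed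
  values put the limit into \<open>\<phi> x\<close>.\<close>

theorem michael_selection_compact:
  fixes X :: "'a::metric_space set" and \<phi> :: "'a \<Rightarrow> 'b::banach set"
  assumes X: "compact X"
    and nonempty: "\<And>x. x \<in> X \<Longrightarrow> \<phi> x \<noteq> {}"
    and convex: "\<And>x. x \<in> X \<Longrightarrow> convex (\<phi> x)"
    and closed: "\<And>x. x \<in> X \<Longrightarrow> closed (\<phi> x)"
    and lsc: "\<And>B. open B \<Longrightarrow> openin (top_of_set X) {x\<in>X. \<phi> x \<inter> B \<noteq> {}}"
  obtains f where "continuous_on X f" "\<And>x. x \<in> X \<Longrightarrow> f x \<in> \<phi> x"
proof -
  define Q where "Q n f \<longleftrightarrow> continuous_on X f \<and> (\<forall>x\<in>X. \<exists>y\<in>\<phi> x. dist (f x) y < (1/2)^n)"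
    for n and f :: "'a \<Rightarrow> 'b"
  have "\<exists>F. \<forall>n. Q n (F n) \<and> (\<forall>x\<in>X. dist (F n x) (F (Suc n) x) \<le> 2 * (1/2)^n)"
  proof (rule dependent_nat_choice)
    obtain g where "continuous_on X g" "\<And>x. x \<in> X \<Longrightarrow> \<exists>y\<in>\<phi> x. dist (g x) y \<le> 1/2"
      using approximate_selection[OF X nonempty convex lsc, of "1/2"] by auto
    then show "\<exists>f. Q 0 f"
      unfolding Q_def by (intro exI[of _ g]) force
  next
    fix f n assume Q: "Q n f"
    define r where "r = (1/2::real)^n"
    have r: "0 < r" by (simp add: r_def)
    have f: "continuous_on X f" using Q by (simp add: Q_def)
    \<comment> \<open>The error r / 4 lies strictly below the next tolerance r / 2, as
      \<open>Q\<close> demands a strict inequality. Together with the radius r it moves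
      \<open>f\<close> by at most 5r / 4, within the summable bound 2r.\<close>
    obtain g where g: "continuous_on X g"
      "\<And>x. x \<in> X \<Longrightarrow> \<exists>y\<in>\<phi> x \<inter> ball (f x) r. dist (g x) y \<le> r / 4"
    proof (rule approximate_selection[OF X, of "\<lambda>x. \<phi> x \<inter> ball (f x) r" "r / 4"])
      show "\<phi> x \<inter> ball (f x) r \<noteq> {}" if "x \<in> X" for x
      proof -
        from Q that obtain y where "y \<in> \<phi> x" "dist (f x) y < r"
          unfolding Q_def r_def by blast
        then have "y \<in> \<phi> x \<inter> ball (f x) r" by simp
        then show ?thesis by blast
      qed
      show "convex (\<phi> x \<inter> ball (f x) r)" if "x \<in> X" for x
        by (intro convex_Int convex that convex_ball)
      show "openin (top_of_set X) {x \<in> X. \<phi> x \<inter> ball (f x) r \<inter> B \<noteq> {}}" if "open B" for B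
        using lsc_Int_ball[OF lsc f that] .
    qed (use r in auto)
    have "Q (Suc n) g"
      unfolding Q_def
    proof (intro conjI ballI g(1))
      fix x assume "x \<in> X"
      then obtain y where y: "y \<in> \<phi> x" "dist (g x) y \<le> r / 4"
        using g(2) by blast
      have "r / 4 < (1/2)^Suc n"
        using r by (simp add: r_def)
      with y show "\<exists>y\<in>\<phi> x. dist (g x) y < (1/2)^Suc n"
        by (intro bexI[of _ y]) linarith
    qed
    moreover have "dist (f x) (g x) \<le> 2 * r" if x: "x \<in> X" for x
    proof -
      obtain y where y: "y \<in> ball (f x) r" "dist (g x) y \<le> r / 4"
        using g(2)[OF x] by blast
      from y(1) have "dist (f x) y < r"
        by (rule mem_ball[THEN iffD1])
      moreover note y(2)
      moreover note r
      ultimately show ?thesis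
        using dist_triangle2[of "f x" "g x" y] by linarith
    qed
    ultimately show "\<exists>g. Q (Suc n) g \<and> (\<forall>x\<in>X. dist (f x) (g x) \<le> 2 * (1/2)^n)"
      unfolding r_def by blast
  qed
  then obtain F where F: "\<And>n. Q n (F n)"
    "\<And>n. \<forall>x\<in>X. dist (F n x) (F (Suc n) x) \<le> 2 * (1/2)^n"
    by blast
  define d where "d n x = F (Suc n) x - F n x" for n x
  define f where "f x = F 0 x + (\<Sum>n. d n x)" for x
  have "uniform_limit X (\<lambda>n x. \<Sum>i<n. d i x) (\<lambda>x. \<Sum>i. d i x) sequentially"
  proof (rule Weierstrass_m_test)
    show "norm (d n x) \<le> 2 * (1/2)^n" if "x \<in> X" for n x
      using F(2)[of n] that by (simp add: d_def dist_norm norm_minus_commute)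
    show "summable (\<lambda>n. 2 * (1/2::real)^n)"
      by (intro summable_mult summable_geometric) simp
  qed
  then have "uniform_limit X (\<lambda>n x. F 0 x + (\<Sum>i<n. d i x)) f sequentially"
    unfolding f_def[abs_def] by (intro uniform_limit_intros)
  then have lim: "uniform_limit X F f sequentially"
    by (simp add: d_def sum_lessThan_telescope[of "\<lambda>n. F n x" for x])
  show thesis
  proof
    show "continuous_on X f"
      by (rule uniform_limit_theorem[OF _ lim]) (use F(1) in \<open>auto simp: Q_def\<close>)
    fix x assume x: "x \<in> X"
    \<comment> \<open>The chosen points of \<open>\<phi> x\<close> shadow \<open>F n x\<close> and
      hence converge to \<open>f x\<close>.\<close>
    have "\<forall>n. \<exists>y\<in>\<phi> x. dist (F n x) y < (1/2)^n"
      using F(1) x by (auto simp: Q_def)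
    then obtain y where y: "\<And>n. y n \<in> \<phi> x" "\<And>n. dist (F n x) (y n) < (1/2)^n"
      by metis
    have "(\<lambda>n. norm (y n - F n x)) \<longlonglongrightarrow> 0"
      by (rule tendsto_sandwich[of "\<lambda>_. 0" _ _ "\<lambda>n. (1/2)^n"])
        (use y(2) in \<open>auto simp: dist_norm norm_minus_commute
            intro!: always_eventually less_imp_le LIMSEQ_realpow_zero\<close>)
    then have "(\<lambda>n. y n - F n x) \<longlonglongrightarrow> 0"
      by (rule tendsto_norm_zero_cancel)
    then have "y \<longlonglongrightarrow> f x"
      using Lim_transform[OF tendsto_uniform_limitI[OF lim x]] by blast
    then show "f x \<in> \<phi> x"
      using closed_sequentially[OF closed[OF x]] y(1) by blast
  qed
qed

section \<open>Borel probability measures on compact sets\<close>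

lemma borel_prob_on_space:
  assumes "borel_prob_on X \<mu>"
  shows "space \<mu> = X"
  using assms sets_eq_imp_space_eq[of \<mu> "restrict_space borel X"]
  by (simp add: borel_prob_on_def space_restrict_space)

lemma borel_prob_on_sets:
  assumes "borel_prob_on X \<mu>"
  shows "A \<in> sets \<mu> \<longleftrightarrow> (\<exists>S\<in>sets borel. A = X \<inter> S)"
  using assms by (auto simp: borel_prob_on_def sets_restrict_space)

lemma borel_prob_on_openin:
  assumes "borel_prob_on X \<mu>" "openin (top_of_set X) U"
  shows "U \<in> sets \<mu>"
proof -
  obtain S where "open S" "U = X \<inter> S"
    using assms(2) by (auto simp: openin_open)
  then show ?thesis
    unfolding borel_prob_on_sets[OF assms(1)] by (intro bexI[of _ S]) auto
qed

lemma borel_prob_on_compact: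
  fixes X :: "'a::t2_space set"
  assumes "borel_prob_on X \<mu>" "compact C" "C \<subseteq> X"
  shows "C \<in> sets \<mu>"
  unfolding borel_prob_on_sets[OF assms(1)]
  by (rule bexI[of _ C]) (use assms in \<open>auto intro: borel_compact\<close>)

text \<open>The trace on \<open>X\<close> of the generation of Borel sets by open sets; it serves
  both regularity and the Caratheodory construction.\<close>

lemma sets_restrict_borel_induct [consumes 1, case_names openin Compl Union]:
  assumes "A \<in> sets (restrict_space borel X)"
    and "\<And>U. openin (top_of_set X) U \<Longrightarrow> P U"
    and "\<And>A. A \<subseteq> X \<Longrightarrow> P A \<Longrightarrow> P (X - A)"
    and "\<And>A. (\<And>i::nat. P (A i)) \<Longrightarrow> P (\<Union>i. A i)"
  shows "P A"
proof -
  obtain S where S: "S \<in> sets borel" "A = X \<inter> S"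
    using assms(1) by (auto simp: sets_restrict_space)
  from S(1) have "S \<in> sigma_sets UNIV {S. open S}"
    by (simp add: borel_def)
  then have "P (X \<inter> S)"
  proof induction
    case (Basic a)
    then show ?case by (auto intro!: assms(2))
  next
    case Empty
    show ?case by (auto intro!: assms(2))
  next
    case (Compl a)
    then have "P (X - (X \<inter> a))" by (intro assms(3)) auto
    then moreover have "X - (X \<inter> a) = X \<inter> (UNIV - a)" by auto
    ultimately show ?case by simp
  next
    case (Union a)
    then have "P (\<Union>i. X \<inter> a i)" by (intro assms(4))
    then show ?case by simp
  qed
  with S show ?thesis by simp
qed

text \<open>The sets admitting such two-sided approximations form a sigma-algebra that contains the
  open sets; complements exchange the roles of compact and open sets.\<close>

lemma borel_prob_on_regular:
  fixes X :: "'a::metric_space set"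
  assumes \<mu>: "borel_prob_on X \<mu>" and X: "compact X" and "A \<in> sets \<mu>" and "0 < e"
  shows "\<exists>C U. compact C \<and> openin (top_of_set X) U \<and> C \<subseteq> A \<and> A \<subseteq> U \<and> measure \<mu> (U - C) < e"
proof -
  interpret prob_space \<mu> using \<mu> by (simp add: borel_prob_on_def)
  have meas: "C \<in> sets \<mu>" "U \<in> sets \<mu>"
    if "compact C" "openin (top_of_set X) U" "C \<subseteq> A" "A \<subseteq> U" for C A U
    using that borel_prob_on_openin[OF \<mu>, of U] openin_imp_subset[OF that(2)]
    by (auto intro!: borel_prob_on_compact[OF \<mu>])
  from assms(3) have "A \<in> sets (restrict_space borel X)"
    using \<mu> by (simp add: borel_prob_on_def)
  then show ?thesis
    using \<open>0 < e\<close>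
  proof (induction arbitrary: e rule: sets_restrict_borel_induct)
    case (openin U)
    then obtain S where S: "open S" "U = X \<inter> S" by (auto simp: openin_open)
    show ?case
    proof (cases "X - S = {}")
      case True
      then have "U = X" using S by auto
      with X openin show ?thesis by (intro exI[of _ X]) auto
    next
      case False
      \<comment> \<open>Points at distance at least 1 / (n + 1) from the complement; these compact
        sets increase to \<open>U\<close>.\<close>
      define C where "C n = {x\<in>X. 1 / real (Suc n) \<le> infdist x (X - S)}" for n
      have cl: "closed (X - S)"
        using X S compact_imp_closed by (intro closed_Diff) auto
      have C_compact: "compact (C n)" for n
      proof -
        have "C n = X \<inter> {x. 1 / real (Suc n) \<le> infdist x (X - S)}"
          by (auto simp: C_def)
        also have "compact \<dots>"
          by (intro compact_Int_closed X closed_Collect_le continuous_intros)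
        finally show ?thesis .
      qed
      have C_sub: "C n \<subseteq> U" for n
      proof
        fix x assume x: "x \<in> C n"
        have "infdist x (X - S) > 0"
          using x by (auto simp: C_def intro: less_le_trans[rotated])
        then have "x \<notin> X - S" by (metis infdist_zero less_irrefl)
        with x S show "x \<in> U" by (auto simp: C_def)
      qed
      have "(\<lambda>n. measure \<mu> (U - C n)) \<longlonglongrightarrow> measure \<mu> (\<Inter>n. U - C n)"
      proof (rule finite_Lim_measure_decseq)
        show "range (\<lambda>n. U - C n) \<subseteq> sets \<mu>"
          using meas[OF C_compact openin(1) C_sub order.refl] by auto
        show "decseq (\<lambda>n. U - C n)"
        proof (rule decseq_SucI)
          fix n
          have "1 / real (Suc (Suc n)) \<le> 1 / real (Suc n)" by (simp add: field_simps)
          then have "C n \<subseteq> C (Suc n)" unfolding C_def by fastforce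
          then show "U - C (Suc n) \<subseteq> U - C n" by auto
        qed
      qed
      moreover have "(\<Inter>n. U - C n) = {}"
      proof -
        have "\<exists>n. x \<in> C n" if "x \<in> U" for x
        proof -
          have "x \<notin> X - S" using that S by auto
          then have "0 < infdist x (X - S)"
            using in_closed_iff_infdist_zero[OF cl False, of x] infdist_nonneg[of x "X - S"]
            by linarith
          then obtain n where "inverse (real (Suc n)) < infdist x (X - S)"
            using reals_Archimedean by blast
          then show ?thesis
            using that S by (intro exI[of _ n]) (auto simp: C_def inverse_eq_divide)
        qed
        then show ?thesis by auto
      qed
      ultimately have "(\<lambda>n. measure \<mu> (U - C n)) \<longlonglongrightarrow> 0"
        by (simp only: measure_empty)
      then have "\<forall>\<^sub>F n in sequentially. measure \<mu> (U - C n) < e"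
        by (rule order_tendstoD) (use openin in auto)
      then obtain n where "measure \<mu> (U - C n) < e"
        by (auto simp: eventually_sequentially)
      with C_compact C_sub openin show ?thesis by blast
    qed
  next
    case (Compl A)
    obtain C U where CU: "compact C" "openin (top_of_set X) U" "C \<subseteq> A" "A \<subseteq> U"
      "measure \<mu> (U - C) < e"
      using Compl.IH[OF Compl.prems] by blast
    have "U \<subseteq> X" using CU openin_imp_subset by blast
    have "compact (X - U)"
    proof -
      obtain S where "open S" "U = X \<inter> S" using CU by (auto simp: openin_open)
      then show ?thesis using compact_diff[OF X, of S] by (simp add: Diff_Int)
    qed
    moreover have "openin (top_of_set X) (X - C)"
      using CU compact_imp_closed by (auto simp: Diff_eq intro!: openin_open_Int)
    moreover have "(X - C) - (X - U) = U - C"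
      using \<open>U \<subseteq> X\<close> by auto
    ultimately show ?case
      using CU by (intro exI[of _ "X - U"] exI[of _ "X - C"]) auto
  next
    case (Union A)
    \<comment> \<open>The errors add up to e / 2. The other half is kept for truncating the union of
      the compact sets, which is compact only when finite.\<close>
    have "\<forall>i. \<exists>C U. compact C \<and> openin (top_of_set X) U \<and> C \<subseteq> A i \<and> A i \<subseteq> U \<and>
        measure \<mu> (U - C) < e / 2 * (1/2)^Suc i"
      by (intro allI Union.IH) (use Union.prems in simp)
    then obtain C U where CU: "\<And>i. compact (C i)" "\<And>i. openin (top_of_set X) (U i)"
      "\<And>i. C i \<subseteq> A i" "\<And>i. A i \<subseteq> U i" "\<And>i. measure \<mu> (U i - C i) < e / 2 * (1/2)^Suc i"
      by metis
    note m = meas[OF CU(1,2,3,4)]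
    let ?D = "\<lambda>n. (\<Union>i. U i) - (\<Union>i<n. C i)"
    have "measure \<mu> ((\<Union>i. U i) - (\<Union>i. C i)) \<le> measure \<mu> (\<Union>i. U i - C i)"
      using m by (intro finite_measure_mono) auto
    also have "\<dots> \<le> (\<Sum>i. measure \<mu> (U i - C i))"
    proof (rule finite_measure_subadditive_countably)
      show "summable (\<lambda>i. measure \<mu> (U i - C i))"
      proof (rule summable_comparison_test')
        show "summable (\<lambda>i. e / 2 * (1/2)^Suc i)"
          by (intro summable_mult) (simp add: summable_geometric)
        show "norm (measure \<mu> (U i - C i)) \<le> e / 2 * (1/2)^Suc i" if "i \<ge> 0" for i
          using CU(5)[of i] by simp
      qed
    qed (use m in auto)
    also have "\<dots> \<le> (\<Sum>i. e / 2 * (1/2)^Suc i)"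
    proof (rule suminf_le)
      show s: "summable (\<lambda>i. e / 2 * (1/2)^Suc i)"
        by (intro summable_mult) (simp add: summable_geometric)
      show "summable (\<lambda>i. measure \<mu> (U i - C i))"
        by (rule summable_comparison_test'[OF s, of 0]) (use CU(5) in \<open>auto intro: less_imp_le\<close>)
      show "measure \<mu> (U i - C i) \<le> e / 2 * (1/2)^Suc i" for i
        using CU(5)[of i] by simp
    qed
    also have "\<dots> = e / 2"
      using sums_mult[OF power_half_series, of "e / 2"] by (simp only: sums_iff mult_1_right)
    finally have half: "measure \<mu> ((\<Union>i. U i) - (\<Union>i. C i)) \<le> e / 2" .
    have "(\<lambda>n. measure \<mu> (?D n)) \<longlonglongrightarrow> measure \<mu> (\<Inter>n. ?D n)"
    proof (rule finite_Lim_measure_decseq)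
      show "range ?D \<subseteq> sets \<mu>" using m by auto
      show "decseq ?D" by (auto simp: decseq_def)
    qed
    also have "(\<Inter>n. ?D n) = (\<Union>i. U i) - (\<Union>i. C i)"
      by auto
    finally have "\<forall>\<^sub>F n in sequentially. measure \<mu> (?D n) < e"
      by (rule order_tendstoD) (use half Union.prems in linarith)
    then obtain n where "measure \<mu> (?D n) < e"
      by (auto simp: eventually_sequentially)
    moreover have "compact (\<Union>i<n. C i)"
      by (intro compact_UN) (use CU in auto)
    moreover have "openin (top_of_set X) (\<Union>i. U i)"
      using CU by (intro openin_Union) auto
    ultimately show ?case
      using CU(3,4) by (intro exI[of _ "\<Union>i<n. C i"] exI[of _ "\<Union>i. U i"]) blast
  qed
qed

lemma continuous_on_measurable_borel_prob:
  assumes "borel_prob_on X \<mu>" "continuous_on X f" "f ` X \<subseteq> X"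
  shows "f \<in> \<mu> \<rightarrow>\<^sub>M \<mu>"
proof -
  have "f \<in> restrict_space borel X \<rightarrow>\<^sub>M restrict_space borel X"
    using borel_measurable_continuous_on_restrict[OF assms(2)] assms(3)
    by (intro measurable_restrict_space2) (auto simp: space_restrict_space)
  moreover have "sets \<mu> = sets (restrict_space borel X)"
    using assms(1) by (simp add: borel_prob_on_def)
  ultimately show ?thesis
    using measurable_cong_sets by blast
qed

text \<open>Applying the one-sided bound to complements reverses it, as the total mass is
  finite.\<close>

lemma map_invariant_measuresI:
  assumes \<mu>: "borel_prob_on X \<mu>" and f: "continuous_on X f" "f ` X \<subseteq> X"
    and le: "\<And>A. A \<in> sets \<mu> \<Longrightarrow> measure \<mu> A \<le> measure \<mu> (f -` A \<inter> X)"
  shows "\<mu> \<in> map_invariant_measures X f"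
proof -
  interpret prob_space \<mu> using \<mu> by (simp add: borel_prob_on_def)
  have sp: "space \<mu> = X" by (rule borel_prob_on_space[OF \<mu>])
  note meas = measurable_sets[OF continuous_on_measurable_borel_prob[OF \<mu> f], unfolded sp]
  have "measure \<mu> (f -` A \<inter> X) = measure \<mu> A" if A: "A \<in> sets \<mu>" for A
  proof (rule antisym)
    have "measure \<mu> (X - A) \<le> measure \<mu> (f -` (X - A) \<inter> X)"
      using A sp by (intro le) (metis sets.compl_sets)
    also have "f -` (X - A) \<inter> X = X - f -` A \<inter> X"
      using f by auto
    also have "measure \<mu> \<dots> = 1 - measure \<mu> (f -` A \<inter> X)"
      using prob_compl[OF meas[OF A]] by (simp add: sp)
    finally show "measure \<mu> (f -` A \<inter> X) \<le> measure \<mu> A"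
      using prob_compl[OF A] by (simp add: sp)
  qed (rule le[OF A])
  then show ?thesis
    using \<mu> by (auto simp: map_invariant_measures_def emeasure_eq_measure)
qed

text \<open>The limit measure is accessible only through open sets. Outer regularity is used for the
  image measure \<open>\<nu>\<close>: an open \<open>U\<close> around \<open>A\<close> gives \<mu> A
  \<le> \<mu> U \<le> \<nu> U \<le> \<nu> A + e.\<close>

lemma map_invariant_measuresI_openin:
  fixes X :: "'a::metric_space set"
  assumes \<mu>: "borel_prob_on X \<mu>" and X: "compact X" and f: "continuous_on X f" "f ` X \<subseteq> X"
    and le: "\<And>U. openin (top_of_set X) U \<Longrightarrow> measure \<mu> U \<le> measure \<mu> (f -` U \<inter> X)"
  shows "\<mu> \<in> map_invariant_measures X f"
proof (rule map_invariant_measuresI[OF \<mu> f])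
  interpret prob_space \<mu> using \<mu> by (simp add: borel_prob_on_def)
  have sp: "space \<mu> = X" by (rule borel_prob_on_space[OF \<mu>])
  have mf: "f \<in> \<mu> \<rightarrow>\<^sub>M \<mu>" by (rule continuous_on_measurable_borel_prob[OF \<mu> f])
  define \<nu> where "\<nu> = distr \<mu> \<mu> f"
  interpret \<nu>: prob_space \<nu> unfolding \<nu>_def by (rule prob_space_distr[OF mf])
  have \<nu>: "borel_prob_on X \<nu>"
    using \<mu> \<nu>.prob_space_axioms by (simp add: borel_prob_on_def \<nu>_def)
  have \<nu>_eq: "measure \<nu> A = measure \<mu> (f -` A \<inter> X)" if "A \<in> sets \<mu>" for A
    using measure_distr[OF mf that] by (simp add: \<nu>_def sp)
  fix A assume A: "A \<in> sets \<mu>"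
  show "measure \<mu> A \<le> measure \<mu> (f -` A \<inter> X)"
  proof (rule field_le_epsilon)
    fix e :: real assume "0 < e"
    obtain C U where CU: "compact C" "openin (top_of_set X) U" "C \<subseteq> A" "A \<subseteq> U"
      "measure \<nu> (U - C) < e"
      using borel_prob_on_regular[OF \<nu> X _ \<open>0 < e\<close>, of A] A by (auto simp: \<nu>_def)
    have U: "U \<in> sets \<mu>" using borel_prob_on_openin[OF \<mu> CU(2)] .
    have C: "C \<in> sets \<mu>"
      using CU openin_imp_subset[OF CU(2)] by (intro borel_prob_on_compact[OF \<mu>]) auto
    have "measure \<mu> A \<le> measure \<mu> U" using CU U by (intro finite_measure_mono) auto
    also have "\<dots> \<le> measure \<nu> U" using le[OF CU(2)] \<nu>_eq[OF U] by simp
    also have "\<dots> \<le> measure \<nu> (A \<union> (U - C))"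
      using U C A CU by (intro \<nu>.finite_measure_mono) (auto simp: \<nu>_def)
    also have "\<dots> \<le> measure \<nu> A + measure \<nu> (U - C)"
      using U C A by (intro measure_Un_le) (auto simp: \<nu>_def)
    finally show "measure \<mu> A \<le> measure \<mu> (f -` A \<inter> X) + e"
      using CU \<nu>_eq[OF A] by simp
  qed
qed

section \<open>Measures from finitely additive probabilities\<close>

locale finitely_additive_prob =
  fixes X :: "'a::metric_space set" and m :: "'a set \<Rightarrow> real"
  assumes compact_X: "compact X"
    and add: "\<And>A B. A \<subseteq> X \<Longrightarrow> B \<subseteq> X \<Longrightarrow> A \<inter> B = {} \<Longrightarrow> m (A \<union> B) = m A + m B"
    and nonneg: "\<And>A. A \<subseteq> X \<Longrightarrow> 0 \<le> m A"
    and total: "m X = 1"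
begin

lemma mono: "A \<subseteq> B \<Longrightarrow> B \<subseteq> X \<Longrightarrow> m A \<le> m B"
  using add[of A "B - A"] nonneg[of "B - A"] Diff_subset[of B A]
  by (simp add: Un_absorb1 order_trans)

lemma subadd:
  assumes "A \<subseteq> X" "B \<subseteq> X"
  shows "m (A \<union> B) \<le> m A + m B"
  using add[of A "B - A"] mono[of "B - A" B] Diff_subset[of B A] assms
  by (simp add: order_trans)

lemma empty: "m {} = 0"
  using add[of "{}" "{}"] by simp

text \<open>A finitely additive \<open>m\<close> may lose countable additivity. Approximating open
  sets by compact subsets restores it, because a countable open cover of a compact set has a finite
  subcover.\<close>

definition inner :: "'a set \<Rightarrow> real" where
  "inner U = (SUP C\<in>{C. compact C \<and> C \<subseteq> U}. m C)"

lemma bdd: "U \<subseteq> X \<Longrightarrow> bdd_above (m ` {C. compact C \<and> C \<subseteq> U})"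
  by (rule bdd_aboveI[of _ 1]) (use mono[of _ X] total in auto)

lemma inner_upper: "compact C \<Longrightarrow> C \<subseteq> U \<Longrightarrow> U \<subseteq> X \<Longrightarrow> m C \<le> inner U"
  unfolding inner_def by (rule cSUP_upper[OF _ bdd]) auto

lemma inner_least:
  assumes "\<And>C. compact C \<Longrightarrow> C \<subseteq> U \<Longrightarrow> m C \<le> b"
  shows "inner U \<le> b"
  unfolding inner_def by (rule cSUP_least) (use assms in auto)

lemma inner_nonneg: "U \<subseteq> X \<Longrightarrow> 0 \<le> inner U"
  using inner_upper[of "{}" U] empty by simp

lemma inner_mono: "U \<subseteq> V \<Longrightarrow> V \<subseteq> X \<Longrightarrow> inner U \<le> inner V"
  by (rule inner_least) (auto intro: inner_upper)

lemma inner_le: "U \<subseteq> X \<Longrightarrow> inner U \<le> m U"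
  by (rule inner_least) (auto intro: mono)

lemma inner_le_1: "U \<subseteq> X \<Longrightarrow> inner U \<le> 1"
  using inner_le[of U] mono[of U X] total by auto

lemma inner_approx:
  assumes "U \<subseteq> X" "0 < e"
  obtains C where "compact C" "C \<subseteq> U" "inner U \<le> m C + e"
proof -
  have "\<exists>C\<in>{C. compact C \<and> C \<subseteq> U}. inner U - e < m C"
    unfolding inner_def
    by (rule less_cSUP_iff[THEN iffD1]) (use assms bdd in auto)
  then show ?thesis using that by force
qed

text \<open>Normality separates the disjoint closed sets \<open>C - U\<close> and
  \<open>C - V\<close>; removing the separating open sets from \<open>C\<close> leaves the two
  pieces.\<close>

lemma compact_split:
  fixes C :: "'a set"
  assumes "compact C" "open U" "open V" "C \<subseteq> U \<union> V"
  obtains A B where "compact A" "compact B" "A \<subseteq> U" "B \<subseteq> V" "C = A \<union> B"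
proof -
  have "\<exists>S T. open S \<and> open T \<and> C - U \<subseteq> S \<and> C - V \<subseteq> T \<and> S \<inter> T = {}"
    using assms compact_imp_closed by (intro t4_space closed_Diff) auto
  then obtain S T where "open S" "open T" "C - U \<subseteq> S" "C - V \<subseteq> T" "S \<inter> T = {}"
    by blast
  with assms show ?thesis
    by (intro that[of "C - S" "C - T"] compact_diff) auto
qed

lemma compact_le_sum_inner:
  fixes S :: "nat \<Rightarrow> 'a set"
  assumes "\<And>i. open (S i)" "compact C" "C \<subseteq> X" "C \<subseteq> (\<Union>i<n. S i)"
  shows "m C \<le> (\<Sum>i<n. inner (X \<inter> S i))"
  using assms(2,3,4)
proof (induction n arbitrary: C)
  case 0
  then show ?case by (simp add: empty)
next
  case (Suc n)
  obtain A B where AB: "compact A" "compact B" "A \<subseteq> (\<Union>i<n. S i)" "B \<subseteq> S n" "C = A \<union> B"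
  proof (rule compact_split[of C "\<Union>i<n. S i" "S n"])
    show "C \<subseteq> (\<Union>i<n. S i) \<union> S n"
      using Suc.prems(3) by (simp add: lessThan_Suc Un_commute)
  qed (use Suc.prems assms(1) in auto)
  have "m C \<le> m A + m B"
    using AB Suc.prems by (auto intro!: subadd)
  also have "m A \<le> (\<Sum>i<n. inner (X \<inter> S i))"
    using AB Suc.prems by (intro Suc.IH) auto
  also have "m B \<le> inner (X \<inter> S n)"
    using AB Suc.prems by (intro inner_upper) auto
  finally show ?case by simp
qed

text \<open>A compact set in the union meets only finitely many terms of some subcover, so finite
  subadditivity suffices. Extended values allow a divergent series on the right.\<close>

lemma inner_UN_le:
  assumes "\<And>i::nat. openin (top_of_set X) (U i)"
  shows "ennreal (inner (\<Union>i. U i)) \<le> (\<Sum>i. ennreal (inner (U i)))"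
proof -
  have "\<forall>i. \<exists>S. open S \<and> U i = X \<inter> S"
    using assms by (auto simp: openin_open)
  then obtain S where S: "\<And>i. open (S i)" "\<And>i. U i = X \<inter> S i"
    by metis
  have UX: "U i \<subseteq> X" for i using S by auto
  show ?thesis
  proof (cases "(\<Sum>i. ennreal (inner (U i)))")
    case (real r)
    have "inner (\<Union>i. U i) \<le> r"
    proof (rule inner_least)
      fix C assume C: "compact C" "C \<subseteq> (\<Union>i. U i)"
      then have "C \<subseteq> (\<Union>i\<in>UNIV. S i)" using S by auto
      then obtain I where I: "finite I" "C \<subseteq> (\<Union>i\<in>I. S i)"
        using compactE_image[OF C(1), of UNIV S] S by metis
      obtain n where "I \<subseteq> {..<n}"
        using I(1) finite_nat_bounded by blast
      with I(2) have "C \<subseteq> (\<Union>i<n. S i)" by blast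
      moreover have "C \<subseteq> X" using C(2) UX by blast
      ultimately have "m C \<le> (\<Sum>i<n. inner (X \<inter> S i))"
        by (intro compact_le_sum_inner S C)
      then have "ennreal (m C) \<le> (\<Sum>i<n. ennreal (inner (U i)))"
        using UX by (simp add: S(2)[symmetric] sum_ennreal inner_nonneg ennreal_leI)
      also have "\<dots> \<le> ennreal r"
        unfolding real(2)[symmetric] by (rule sum_le_suminf) auto
      finally show "m C \<le> r"
        using real(1) by (simp add: ennreal_le_iff)
    qed
    then show ?thesis using real by (simp add: ennreal_leI)
  qed simp
qed

text \<open>The outer regular extension of \<open>inner\<close> to all subsets, to which
  Caratheodory's criterion is applied.\<close>

definition outer :: "'a set \<Rightarrow> ennreal" where
  "outer A = (INF U\<in>{U. openin (top_of_set X) U \<and> A \<subseteq> U}. ennreal (inner U))"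

lemma outer_le: "openin (top_of_set X) U \<Longrightarrow> A \<subseteq> U \<Longrightarrow> outer A \<le> ennreal (inner U)"
  unfolding outer_def by (rule INF_lower) auto

lemma outer_openin: "openin (top_of_set X) U \<Longrightarrow> outer U = ennreal (inner U)"
proof (rule antisym[OF outer_le])
  show "ennreal (inner U) \<le> outer U"
    unfolding outer_def by (rule INF_greatest) (auto intro!: ennreal_leI inner_mono dest: openin_imp_subset)
qed auto

lemma outer_mono: "A \<subseteq> B \<Longrightarrow> outer A \<le> outer B"
  unfolding outer_def by (rule INF_superset_mono) auto

lemma outer_finite: "A \<subseteq> X \<Longrightarrow> outer A < \<top>"
  using outer_le[of X A] by (auto simp: le_less_trans)

lemma outer_measure_space_outer: "outer_measure_space (Pow X) outer"
  unfolding outer_measure_space_def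
proof (intro conjI)
  show "positive (Pow X) outer"
    by (simp add: positive_def outer_openin inner_def empty)
  show "increasing (Pow X) outer"
    by (auto simp: increasing_def outer_mono)
  show "countably_subadditive (Pow X) outer"
    unfolding countably_subadditive_def
  proof (intro allI impI)
    fix A :: "nat \<Rightarrow> 'a set" assume A: "range A \<subseteq> Pow X"
    show "outer (\<Union>i. A i) \<le> (\<Sum>i. outer (A i))"
    proof (rule ennreal_le_epsilon)
      fix e :: real assume "0 < e"
      have "\<exists>U. openin (top_of_set X) U \<and> A i \<subseteq> U \<and>
          ennreal (inner U) \<le> outer (A i) + ennreal (e * (1/2)^Suc i)" for i
      proof -
        have "outer (A i) < outer (A i) + ennreal (e * (1/2)^Suc i)"
          using outer_finite[of "A i"] A \<open>0 < e\<close> ennreal_add_left_cancel_less[of "outer (A i)" 0]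
          by (auto simp: less_top)
        then show ?thesis
          unfolding outer_def[of "A i"] INF_less_iff by (auto intro: less_imp_le)
      qed
      then obtain U where U: "\<And>i. openin (top_of_set X) (U i)" "\<And>i. A i \<subseteq> U i"
        "\<And>i. ennreal (inner (U i)) \<le> outer (A i) + ennreal (e * (1/2)^Suc i)"
        by metis
      have "outer (\<Union>i. A i) \<le> ennreal (inner (\<Union>i. U i))"
        using U by (intro outer_le openin_Union) auto
      also have "\<dots> \<le> (\<Sum>i. ennreal (inner (U i)))"
        by (rule inner_UN_le[OF U(1)])
      also have "\<dots> \<le> (\<Sum>i. outer (A i) + ennreal (e * (1/2)^Suc i))"
        by (intro suminf_le U) auto
      also have "\<dots> = (\<Sum>i. outer (A i)) + (\<Sum>i. ennreal (e * (1/2)^Suc i))"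
        by (rule suminf_add[symmetric]) auto
      also have "(\<Sum>i. ennreal (e * (1/2)^Suc i)) = ennreal e"
      proof -
        have "(\<lambda>i. e * (1/2)^Suc i) sums (e * 1)"
          by (intro sums_mult power_half_series)
        then show ?thesis
          using \<open>0 < e\<close> by (subst suminf_ennreal2) (auto simp: sums_iff)
      qed
      finally show "outer (\<Union>i. A i) \<le> (\<Sum>i. outer (A i)) + ennreal e" .
    qed
  qed
qed

lemma outer_subadd:
  assumes "A \<subseteq> X" "B \<subseteq> X" "A \<inter> B = {}"
  shows "outer (A \<union> B) \<le> outer A + outer B"
  using ring_of_sets.countably_subadditive_subadditive[OF ring_of_sets_Pow, of X outer]
    outer_measure_space_outer assms
  by (auto simp: outer_measure_space_def subadditive_def)

text \<open>Within an open V around A, choose a nearly optimal compact C in V \<inter> U first, and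
  then a nearly optimal compact D in V - C. The two are disjoint, so \<open>m\<close> adds up on
  them, while V - C is an open set that contains the part of A outside U.\<close>

lemma openin_in_lambda_system:
  assumes U: "openin (top_of_set X) U"
  shows "U \<in> lambda_system X (Pow X) outer"
  unfolding lambda_system_def
proof (intro CollectI conjI ballI)
  have UX: "U \<subseteq> X" using openin_imp_subset[OF U] .
  then show "U \<in> Pow X" by simp
  fix A assume "A \<in> Pow X"
  then have A: "A \<subseteq> X" by simp
  show "outer (U \<inter> A) + outer ((X - U) \<inter> A) = outer A"
  proof (rule antisym)
    have "U \<inter> A \<union> (X - U) \<inter> A = A" using A by auto
    then show "outer A \<le> outer (U \<inter> A) + outer ((X - U) \<inter> A)"
      using outer_subadd[of "U \<inter> A" "(X - U) \<inter> A"] A by auto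
    show "outer (U \<inter> A) + outer ((X - U) \<inter> A) \<le> outer A"
      unfolding outer_def[of A]
    proof (rule INF_greatest, clarify)
      fix V assume V: "openin (top_of_set X) V" "A \<subseteq> V"
      have VX: "V \<subseteq> X" using openin_imp_subset[OF V(1)] .
      show "outer (U \<inter> A) + outer ((X - U) \<inter> A) \<le> ennreal (inner V)"
      proof (rule ennreal_le_epsilon)
        fix e :: real assume "0 < e"
        obtain C where C: "compact C" "C \<subseteq> V \<inter> U" "inner (V \<inter> U) \<le> m C + e / 2"
          using inner_approx[of "V \<inter> U" "e / 2"] UX \<open>0 < e\<close> by auto
        obtain D where D: "compact D" "D \<subseteq> V - C" "inner (V - C) \<le> m D + e / 2"
          using inner_approx[of "V - C" "e / 2"] VX \<open>0 < e\<close> by auto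
        have "openin (top_of_set X) (V - C)"
        proof -
          have "V - C = V \<inter> (X - C)" using VX by auto
          moreover have "openin (top_of_set X) (X - C)"
            using C compact_imp_closed by (auto simp: Diff_eq intro!: openin_open_Int)
          ultimately show ?thesis using V by auto
        qed
        then have "outer ((X - U) \<inter> A) \<le> ennreal (inner (V - C))"
          using C V by (intro outer_le) auto
        moreover have "outer (U \<inter> A) \<le> ennreal (inner (V \<inter> U))"
          using U V by (intro outer_le) auto
        ultimately have "outer (U \<inter> A) + outer ((X - U) \<inter> A)
            \<le> ennreal (inner (V \<inter> U)) + ennreal (inner (V - C))"
          by (rule add_mono[rotated])
        also have "\<dots> = ennreal (inner (V \<inter> U) + inner (V - C))"
          using UX VX by (subst ennreal_plus) (auto intro!: inner_nonneg)
        also have "\<dots> \<le> ennreal (inner V + e)"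
        proof (rule ennreal_leI)
          have "m C + m D = m (C \<union> D)"
            using C D VX by (intro add[symmetric]) auto
          also have "\<dots> \<le> inner V"
            using C D VX by (intro inner_upper) auto
          finally show "inner (V \<inter> U) + inner (V - C) \<le> inner V + e"
            using C(3) D(3) by simp
        qed
        also have "\<dots> = ennreal (inner V) + ennreal e"
          using inner_nonneg[OF VX] \<open>0 < e\<close> by (simp add: ennreal_plus)
        finally show "outer (U \<inter> A) + outer ((X - U) \<inter> A) \<le> ennreal (inner V) + ennreal e" .
      qed
    qed
  qed
qed

theorem ex_inner_measure:
  obtains \<mu> where "borel_prob_on X \<mu>"
    "\<And>U. openin (top_of_set X) U \<Longrightarrow> measure \<mu> U = inner U"
proof -
  let ?L = "lambda_system X (Pow X) outer"
  let ?B = "sets (restrict_space borel X)"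
  have L: "measure_space X ?L outer"
    using sigma_algebra.caratheodory_lemma[OF sigma_algebra_Pow outer_measure_space_outer] .
  then interpret L: sigma_algebra X ?L by (simp add: measure_space_def)
  have "A \<in> ?L" if "A \<in> ?B" for A
    using that
  proof (induction rule: sets_restrict_borel_induct)
    case (openin U)
    then show ?case by (rule openin_in_lambda_system)
  next
    case (Compl A)
    then show ?case by auto
  next
    case (Union A)
    then show ?case by auto
  qed
  moreover have B: "sigma_algebra X ?B"
    using sets.sigma_algebra_axioms[of "restrict_space borel X"] by (simp add: space_restrict_space)
  ultimately have "measure_space X ?B outer"
    by (intro measure_down[OF L]) auto
  define \<mu> where "\<mu> = measure_of X ?B outer"
  have sets_\<mu>: "sets \<mu> = ?B"
    unfolding \<mu>_def using sigma_algebra.sets_measure_of_eq[OF B] .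
  have emeasure_\<mu>: "emeasure \<mu> A = outer A" if "A \<in> ?B" for A
    unfolding \<mu>_def using \<open>measure_space X ?B outer\<close> that
    by (intro emeasure_measure_of_sigma) (auto simp: measure_space_def)
  have openin_B: "U \<in> ?B" if "openin (top_of_set X) U" for U
    using that by (auto simp: openin_open sets_restrict_space)
  have eq: "emeasure \<mu> U = ennreal (inner U)" if "openin (top_of_set X) U" for U
    using emeasure_\<mu>[OF openin_B[OF that]] outer_openin[OF that] by simp
  have space_\<mu>: "space \<mu> = X"
    using sets_eq_imp_space_eq[OF sets_\<mu>] by (simp add: space_restrict_space)
  have "inner X = 1"
    using inner_upper[OF compact_X, of X] inner_le_1[of X] total by simp
  then have "prob_space \<mu>"
    using eq[of X] by (intro prob_spaceI) (simp add: space_\<mu>)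
  then have "borel_prob_on X \<mu>"
    by (simp add: borel_prob_on_def sets_\<mu>)
  moreover have "measure \<mu> U = inner U" if "openin (top_of_set X) U" for U
    using eq[OF that] inner_nonneg[OF openin_imp_subset[OF that]] by (simp add: measure_def)
  ultimately show thesis using that by blast
qed

end

section \<open>Iterated covers\<close>

text \<open>Fekete's lemma: write n as a multiple of \<open>k\<close> plus a remainder, with k
  chosen so that a k / k is near the infimum.\<close>

lemma fekete_convergent:
  fixes a :: "nat \<Rightarrow> real"
  assumes nonneg: "\<And>n. 0 \<le> a n" and subadd: "\<And>m n. a (m + n) \<le> a m + a n"
  shows "convergent (\<lambda>n. a n / n)"
proof -
  define L where "L = (INF n\<in>{1..}. a n / n)"
  have bdd: "bdd_below ((\<lambda>n. a n / n) ` {1..})"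
    by (rule bdd_belowI[of _ 0]) (auto simp: nonneg)
  have lower: "L \<le> a n / n" if "n \<ge> 1" for n
    unfolding L_def using that by (intro cINF_lower bdd) auto
  have iter: "a (q * k + r) \<le> q * a k + a r" for q k r
  proof (induction q)
    case (Suc q)
    have "a (Suc q * k + r) \<le> a k + a (q * k + r)"
      using subadd[of k "q * k + r"] by (simp add: add.assoc)
    with Suc show ?case by (simp add: algebra_simps)
  qed simp
  have "(\<lambda>n. a n / n) \<longlonglongrightarrow> L"
  proof (rule order_tendstoI)
    fix b assume "b < L"
    have "\<forall>\<^sub>F n in sequentially. (n::nat) \<ge> 1" by (rule eventually_ge_at_top)
    then show "\<forall>\<^sub>F n in sequentially. b < a n / n"
      by (rule eventually_mono) (use \<open>b < L\<close> lower in \<open>force intro: less_le_trans\<close>)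
  next
    fix b assume "L < b"
    then obtain k where k: "k \<ge> 1" "a k / k < b"
      unfolding L_def using cINF_less_iff[OF _ bdd, of b] by auto
    \<comment> \<open>Bounds \<open>a\<close> at every possible remainder modulo \<open>k\<close>,
      independently of n.\<close>
    define c where "c = (\<Sum>r<k. a r)"
    have "(\<lambda>n. a k / k + c / real n) \<longlonglongrightarrow> a k / k + 0"
      by (intro tendsto_intros lim_const_over_n)
    then have "\<forall>\<^sub>F n in sequentially. a k / k + c / real n < b"
      using k by (intro order_tendstoD) auto
    moreover have "\<forall>\<^sub>F n in sequentially. (n::nat) \<ge> 1" by (rule eventually_ge_at_top)
    ultimately show "\<forall>\<^sub>F n in sequentially. a n / n < b"
    proof eventually_elim
      case (elim n)
      have "a n \<le> (n div k) * a k + a (n mod k)"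
        using iter[of "n div k" k "n mod k"] by simp
      also have "a (n mod k) \<le> c"
        unfolding c_def using k by (intro member_le_sum) (auto simp: nonneg)
      also have "real (n div k) * a k \<le> n / k * a k"
        by (intro mult_right_mono of_nat_div_le_of_nat nonneg)
      finally have "a n / n \<le> (n / k * a k + c) / n"
        by (intro divide_right_mono) auto
      also have "\<dots> = a k / k + c / n"
        using elim by (simp add: field_simps)
      finally show ?case using elim by simp
    qed
  qed
  then show ?thesis by (rule convergentI)
qed

section \<open>Iterates of the multivalued map and their preimages\<close>

lemma multi_iter_add: "multi_iter \<phi> (j + k) x = (\<Union>y\<in>multi_iter \<phi> j x. multi_iter \<phi> k y)"
  by (induction k) auto

lemma multimap_on_multi_iter:
  assumes "multimap_on X \<phi>"
  shows "multimap_on X (multi_iter \<phi> k)"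
  unfolding multimap_on_def
proof (induction k)
  case (Suc k)
  show ?case
  proof
    fix x assume "x \<in> X"
    with Suc have "multi_iter \<phi> k x \<noteq> {}" "multi_iter \<phi> k x \<subseteq> X" by auto
    then show "multi_iter \<phi> (Suc k) x \<noteq> {} \<and> multi_iter \<phi> (Suc k) x \<subseteq> X"
      using assms unfolding multimap_on_def multi_iter.simps by blast
  qed
qed simp

lemma iter_preimage_add:
  assumes "multimap_on X \<phi>"
  shows "iter_preimage X \<phi> (j + k) B = iter_preimage X \<phi> j (iter_preimage X \<phi> k B)"
proof -
  have "multi_iter \<phi> (j + k) x \<inter> B \<noteq> {} \<longleftrightarrow> multi_iter \<phi> j x \<inter> {y\<in>X. multi_iter \<phi> k y \<inter> B \<noteq> {}} \<noteq> {}"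
    if "x \<in> X" for x
  proof -
    have "multi_iter \<phi> j x \<subseteq> X"
      using multimap_on_multi_iter[OF assms, of j] that by (simp add: multimap_on_def)
    then show ?thesis unfolding multi_iter_add by blast
  qed
  then show ?thesis
    unfolding iter_preimage_def large_preimage_def by blast
qed

lemma iter_preimage_0 [simp]: "iter_preimage X \<phi> 0 B = X \<inter> B"
  by (auto simp: iter_preimage_def large_preimage_def)

lemma iter_preimage_Suc:
  assumes "multimap_on X \<phi>"
  shows "iter_preimage X \<phi> (Suc k) B = large_preimage X \<phi> (iter_preimage X \<phi> k B)"
proof -
  have "multi_iter \<phi> 1 = \<phi>" by (simp add: fun_eq_iff)
  then show ?thesis
    using iter_preimage_add[OF assms, of 1 k B] by (simp add: iter_preimage_def)
qed

lemma iter_preimage_mono: "A \<subseteq> B \<Longrightarrow> iter_preimage X \<phi> k A \<subseteq> iter_preimage X \<phi> k B"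
  by (auto simp: iter_preimage_def large_preimage_def)

lemma openin_iter_preimage:
  assumes "multimap_on X \<phi>" "lsc_on X \<phi>" "openin (top_of_set X) B"
  shows "openin (top_of_set X) (iter_preimage X \<phi> k B)"
proof (induction k)
  case 0
  show ?case using assms(3) openin_subset[OF assms(3)] by (simp add: Int_absorb1)
next
  case (Suc k)
  then show ?case
    unfolding iter_preimage_Suc[OF assms(1)] using assms(2) by (simp add: lsc_on_def)
qed

lemma funpow_closed: "f ` X \<subseteq> X \<Longrightarrow> x \<in> X \<Longrightarrow> (f ^^ k) x \<in> X"
  by (induction k) auto

lemma funpow_in_multi_iter:
  assumes "f ` X \<subseteq> X" "\<And>x. x \<in> X \<Longrightarrow> f x \<in> \<phi> x" "x \<in> X"
  shows "(f ^^ k) x \<in> multi_iter \<phi> k x"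
proof (induction k)
  case (Suc k)
  then show ?case using assms(2)[OF funpow_closed[OF assms(1,3)]] by auto
qed simp

lemma funpow_vimage_subset_iter_preimage:
  assumes "f ` X \<subseteq> X" "\<And>x. x \<in> X \<Longrightarrow> f x \<in> \<phi> x"
  shows "(f ^^ k) -` B \<inter> X \<subseteq> iter_preimage X \<phi> k B"
  using funpow_in_multi_iter[OF assms] by (fastforce simp: iter_preimage_def large_preimage_def)

lemma cover_iterE:
  assumes "d \<in> cover_iter X \<phi> \<A> n"
  obtains Q where "\<And>j. j < n \<Longrightarrow> Q j \<in> \<A>" "d = X \<inter> (\<Inter>j<n. iter_preimage X \<phi> j (Q j))" "d \<noteq> {}"
proof -
  obtain R where R: "\<forall>k<n. R k \<in> iter_preimage X \<phi> k ` \<A>" "d = X \<inter> (\<Inter>k<n. R k)" "d \<noteq> {}"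
    using assms by (auto simp: cover_iter_def join_upto_def)
  then have "\<forall>k. \<exists>A. k < n \<longrightarrow> A \<in> \<A> \<and> R k = iter_preimage X \<phi> k A" by blast
  then obtain Q where "\<And>k. k < n \<Longrightarrow> Q k \<in> \<A> \<and> R k = iter_preimage X \<phi> k (Q k)" by metis
  with R show ?thesis by (intro that[of Q]) auto
qed

lemma cover_iterI:
  assumes "\<And>j. j < n \<Longrightarrow> Q j \<in> \<A>" "X \<inter> (\<Inter>j<n. iter_preimage X \<phi> j (Q j)) \<noteq> {}"
  shows "X \<inter> (\<Inter>j<n. iter_preimage X \<phi> j (Q j)) \<in> cover_iter X \<phi> \<A> n"
  unfolding cover_iter_def join_upto_def
  by (rule CollectI, rule exI[of _ "\<lambda>j. iter_preimage X \<phi> j (Q j)"]) (use assms in auto)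

lemma openin_INT_lessThan:
  fixes n :: nat
  assumes "\<And>j. j < n \<Longrightarrow> openin (top_of_set X) (R j)"
  shows "openin (top_of_set X) (X \<inter> (\<Inter>j<n. R j))"
  using assms
proof (induction n)
  case (Suc n)
  have "X \<inter> (\<Inter>j<Suc n. R j) = (X \<inter> (\<Inter>j<n. R j)) \<inter> R n"
    by (auto simp: lessThan_Suc)
  with Suc show ?case by auto
qed simp

lemma open_cover_cover_iter:
  assumes "multimap_on X \<phi>" "lsc_on X \<phi>" "open_cover X \<A>"
  shows "open_cover X (cover_iter X \<phi> \<A> n)"
  unfolding open_cover_def
proof (intro conjI ballI)
  fix d assume "d \<in> cover_iter X \<phi> \<A> n"
  then obtain Q where Q: "\<And>j. j < n \<Longrightarrow> Q j \<in> \<A>"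
    "d = X \<inter> (\<Inter>j<n. iter_preimage X \<phi> j (Q j))" "d \<noteq> {}"
    by (rule cover_iterE) (rule that)
  then have "openin (top_of_set X) (iter_preimage X \<phi> j (Q j))" if "j < n" for j
    using assms that by (intro openin_iter_preimage) (auto simp: open_cover_def)
  then show "openin (top_of_set X) d"
    unfolding Q(2) by (rule openin_INT_lessThan)
next
  have "\<exists>d\<in>cover_iter X \<phi> \<A> n. x \<in> d" if x: "x \<in> X" for x
  proof -
    have "\<exists>A\<in>\<A>. multi_iter \<phi> j x \<inter> A \<noteq> {}" for j
    proof -
      obtain y where "y \<in> multi_iter \<phi> j x" "y \<in> X"
        using multimap_on_multi_iter[OF assms(1), of j] x by (fastforce simp: multimap_on_def)
      then show ?thesis using assms(3) by (fastforce simp: open_cover_def)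
    qed
    then obtain Q where Q: "\<And>j. Q j \<in> \<A>" "\<And>j. multi_iter \<phi> j x \<inter> Q j \<noteq> {}" by metis
    then have "x \<in> X \<inter> (\<Inter>j<n. iter_preimage X \<phi> j (Q j))"
      using x by (auto simp: iter_preimage_def large_preimage_def)
    then show ?thesis using Q(1) by (intro bexI[OF _ cover_iterI]) auto
  qed
  moreover have "d \<subseteq> X" if "d \<in> cover_iter X \<phi> \<A> n" for d
    using that by (auto simp: cover_iter_def join_upto_def)
  ultimately show "\<Union>(cover_iter X \<phi> \<A> n) = X" by blast
qed

section \<open>Minimal subcovers and the growth of their cardinality\<close>

lemma min_subcover_card_attained:
  assumes "compact X" "open_cover X \<C>"
  obtains \<D> where "\<D> \<subseteq> \<C>" "finite \<D>" "\<Union>\<D> = X" "card \<D> = min_subcover_card X \<C>"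
proof -
  have "\<forall>A\<in>\<C>. \<exists>T. open T \<and> A = X \<inter> T"
    using assms(2) by (auto simp: open_cover_def openin_open)
  then obtain T where T: "\<And>A. A \<in> \<C> \<Longrightarrow> open (T A)" "\<And>A. A \<in> \<C> \<Longrightarrow> A = X \<inter> T A"
    by metis
  have "X \<subseteq> (\<Union>A\<in>\<C>. T A)"
    using assms(2) T(2) by (fastforce simp: open_cover_def)
  then obtain \<D> where "\<D> \<subseteq> \<C>" "finite \<D>" "X \<subseteq> (\<Union>A\<in>\<D>. T A)"
    using compactE_image[OF assms(1), of \<C> T] T(1) by metis
  then have "\<exists>\<D>\<subseteq>\<C>. finite \<D> \<and> X \<subseteq> \<Union>\<D>"
    using T(2) by (intro exI[of _ \<D>] conjI) blast+
  then obtain \<D> where D: "\<D> \<subseteq> \<C>" "finite \<D>" "X \<subseteq> \<Union>\<D>" by blast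
  moreover have "\<Union>\<D> \<subseteq> X"
    using D(1) assms(2) unfolding open_cover_def by blast
  ultimately have "\<exists>m. \<exists>\<D>\<subseteq>\<C>. finite \<D> \<and> \<Union>\<D> = X \<and> card \<D> = m"
    by blast
  from LeastI_ex[OF this] show ?thesis
    unfolding min_subcover_card_def[symmetric] using that by blast
qed

text \<open>A finite cover that merely refines the given one is enough: enlarge each nonempty
  member. Empty members are dropped, as iterated covers keep only nonempty sets.\<close>

lemma min_subcover_card_le_card:
  assumes "open_cover X \<C>" "finite \<E>" "X \<subseteq> \<Union>\<E>"
    and "\<And>E. E \<in> \<E> \<Longrightarrow> E \<noteq> {} \<Longrightarrow> \<exists>C\<in>\<C>. E \<subseteq> C"
  shows "min_subcover_card X \<C> \<le> card \<E>"
proof -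
  obtain c where c: "\<And>E. E \<in> \<E> - {{}} \<Longrightarrow> c E \<in> \<C> \<and> E \<subseteq> c E"
    using assms(4) by (metis Diff_iff singletonI)
  let ?D = "c ` (\<E> - {{}})"
  have "?D \<subseteq> \<C>" using c by auto
  moreover have "\<Union>?D = X"
  proof
    show "\<Union>?D \<subseteq> X" using c assms(1) by (auto simp: open_cover_def)
    show "X \<subseteq> \<Union>?D"
    proof
      fix x assume "x \<in> X"
      then obtain E where "E \<in> \<E>" "x \<in> E" using assms(3) by auto
      then show "x \<in> \<Union>?D" using c[of E] by auto
    qed
  qed
  ultimately have "min_subcover_card X \<C> \<le> card ?D"
    unfolding min_subcover_card_def using assms(2) by (intro Least_le exI[of _ ?D]) auto
  also have "\<dots> \<le> card (\<E> - {{}})" using assms(2) by (intro card_image_le) auto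
  also have "\<dots> \<le> card \<E>" using assms(2) by (intro card_mono) auto
  finally show ?thesis .
qed

lemma min_subcover_card_pos:
  assumes "compact X" "open_cover X \<C>" "X \<noteq> {}"
  shows "0 < min_subcover_card X \<C>"
proof -
  obtain \<D> where "\<D> \<subseteq> \<C>" "finite \<D>" "\<Union>\<D> = X" "card \<D> = min_subcover_card X \<C>"
    by (rule min_subcover_card_attained[OF assms(1,2)])
  with assms(3) show ?thesis by (metis Union_empty card_gt_0_iff)
qed

text \<open>Intersect a subcover for the first \<open>m\<close> times with the \<open>m\<close>-th
  preimages of one for the next \<open>n\<close>. A preimage under \<open>\<phi>\<close> of an
  intersection may be smaller than the intersection of the preimages, but the inclusion goes the
  right way for refinement.\<close>

lemma min_subcover_card_cover_iter_add:
  assumes "compact X" "multimap_on X \<phi>" "lsc_on X \<phi>" "open_cover X \<A>"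
  shows "min_subcover_card X (cover_iter X \<phi> \<A> (m + n))
    \<le> min_subcover_card X (cover_iter X \<phi> \<A> m) * min_subcover_card X (cover_iter X \<phi> \<A> n)"
proof -
  note oc = open_cover_cover_iter[OF assms(2,3,4)]
  obtain \<D> where D: "\<D> \<subseteq> cover_iter X \<phi> \<A> m" "finite \<D>" "\<Union>\<D> = X"
    "card \<D> = min_subcover_card X (cover_iter X \<phi> \<A> m)"
    by (rule min_subcover_card_attained[OF assms(1) oc])
  obtain \<E> where E: "\<E> \<subseteq> cover_iter X \<phi> \<A> n" "finite \<E>" "\<Union>\<E> = X"
    "card \<E> = min_subcover_card X (cover_iter X \<phi> \<A> n)"
    by (rule min_subcover_card_attained[OF assms(1) oc])
  let ?F = "(\<lambda>(d, e). d \<inter> iter_preimage X \<phi> m e) ` (\<D> \<times> \<E>)"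
  have "min_subcover_card X (cover_iter X \<phi> \<A> (m + n)) \<le> card ?F"
  proof (rule min_subcover_card_le_card[OF oc])
    show "finite ?F" using D E by auto
    show "X \<subseteq> \<Union>?F"
    proof
      fix x assume x: "x \<in> X"
      \<comment> \<open>Any one value of the m-th iterate does: a large preimage contains x as soon
        as a single value lies in the set.\<close>
      obtain y where y: "y \<in> multi_iter \<phi> m x" "y \<in> X"
        using multimap_on_multi_iter[OF assms(2), of m] x by (fastforce simp: multimap_on_def)
      obtain d e where "d \<in> \<D>" "x \<in> d" "e \<in> \<E>" "y \<in> e"
        using x y D(3) E(3) by blast
      moreover from this have "x \<in> iter_preimage X \<phi> m e"
        using x y by (auto simp: iter_preimage_def large_preimage_def)
      ultimately show "x \<in> \<Union>?F" by auto
    qed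
    fix F assume "F \<in> ?F" "F \<noteq> {}"
    then obtain d e where de: "d \<in> \<D>" "e \<in> \<E>" "F = d \<inter> iter_preimage X \<phi> m e" by auto
    obtain P where P: "\<And>j. j < m \<Longrightarrow> P j \<in> \<A>" "d = X \<inter> (\<Inter>j<m. iter_preimage X \<phi> j (P j))"
      using cover_iterE[of d X \<phi> \<A> m] D de by blast
    obtain Q where Q: "\<And>j. j < n \<Longrightarrow> Q j \<in> \<A>" "e = X \<inter> (\<Inter>j<n. iter_preimage X \<phi> j (Q j))"
      using cover_iterE[of e X \<phi> \<A> n] E de by blast
    define R where "R j = (if j < m then P j else Q (j - m))" for j
    have "F \<subseteq> iter_preimage X \<phi> j (R j)" if j: "j < m + n" for j
    proof (cases "j < m")
      case True
      then show ?thesis using de P by (auto simp: R_def)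
    next
      case False
      then have j': "j - m < n" "j = m + (j - m)" using j by auto
      have "F \<subseteq> iter_preimage X \<phi> m e" using de by auto
      also have "\<dots> \<subseteq> iter_preimage X \<phi> m (iter_preimage X \<phi> (j - m) (Q (j - m)))"
        using Q j' by (intro iter_preimage_mono) auto
      also have "\<dots> = iter_preimage X \<phi> j (Q (j - m))"
        using iter_preimage_add[OF assms(2), of m "j - m"] j' by simp
      finally show ?thesis using False by (simp add: R_def)
    qed
    moreover have "F \<subseteq> X" using de P by auto
    ultimately have sub: "F \<subseteq> X \<inter> (\<Inter>j<m + n. iter_preimage X \<phi> j (R j))" by blast
    moreover have "X \<inter> (\<Inter>j<m + n. iter_preimage X \<phi> j (R j)) \<in> cover_iter X \<phi> \<A> (m + n)"
    proof (rule cover_iterI)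
      show "R j \<in> \<A>" if "j < m + n" for j
        using P(1)[of j] Q(1)[of "j - m"] that by (auto simp: R_def)
      show "X \<inter> (\<Inter>j<m + n. iter_preimage X \<phi> j (R j)) \<noteq> {}"
        using sub \<open>F \<noteq> {}\<close> by blast
    qed
    ultimately show "\<exists>C\<in>cover_iter X \<phi> \<A> (m + n). F \<subseteq> C" by blast
  qed
  also have "\<dots> \<le> card (\<D> \<times> \<E>)" using D E by (intro card_image_le) auto
  finally show ?thesis using D E by (simp add: card_cartesian_product)
qed

lemma top_entropy_cover_tendsto:
  assumes "compact X" "X \<noteq> {}" "multimap_on X \<phi>" "lsc_on X \<phi>" "open_cover X \<A>"
  shows "(\<lambda>n. ln (real (min_subcover_card X (cover_iter X \<phi> \<A> n))) / real n)
    \<longlonglongrightarrow> top_entropy_cover X \<phi> \<A>"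
  unfolding top_entropy_cover_def
proof (rule convergent_LIMSEQ_iff[THEN iffD1], rule fekete_convergent)
  note pos = min_subcover_card_pos[OF assms(1) open_cover_cover_iter[OF assms(3,4,5)] assms(2)]
  show "0 \<le> ln (real (min_subcover_card X (cover_iter X \<phi> \<A> n)))" for n
    using pos[of n] by simp
  fix m n
  have "ln (real (min_subcover_card X (cover_iter X \<phi> \<A> (m + n))))
      \<le> ln (real (min_subcover_card X (cover_iter X \<phi> \<A> m) * min_subcover_card X (cover_iter X \<phi> \<A> n)))"
    using pos min_subcover_card_cover_iter_add[OF assms(1,3,4,5), of m n]
    by (subst ln_le_cancel_iff) (auto simp del: of_nat_mult)
  also have "\<dots> = ln (real (min_subcover_card X (cover_iter X \<phi> \<A> m)))
      + ln (real (min_subcover_card X (cover_iter X \<phi> \<A> n)))"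
    using pos[of m] pos[of n] by (simp add: ln_mult)
  finally show "ln (real (min_subcover_card X (cover_iter X \<phi> \<A> (m + n)))) \<le> \<dots>" .
qed

section \<open>Itineraries and the entropy of a preserved selection\<close>

lemma outer_measure_of_cong_null:
  assumes "B \<in> sets M" "N \<in> null_sets M" "A \<subseteq> B \<union> N" "B \<subseteq> A \<union> N"
  shows "outer_measure_of M A = emeasure M B"
proof (rule antisym)
  have "outer_measure_of M A \<le> outer_measure_of M (B \<union> N)"
    using assms by (intro outer_measure_of_mono)
  also have "\<dots> = emeasure M B"
    using assms by (subst outer_measure_of_eq) (auto intro: emeasure_Un_null_set)
  finally show "outer_measure_of M A \<le> emeasure M B" .
  have "emeasure M B = outer_measure_of M (B - N)"
    using assms by (subst outer_measure_of_eq) (auto simp: emeasure_Diff_null_set)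
  also have "\<dots> \<le> outer_measure_of M A"
    using assms by (intro outer_measure_of_mono) auto
  finally show "emeasure M B \<le> outer_measure_of M A" .
qed

text \<open>A measurable hull \<open>E\<close> of \<open>A\<close> with the same outer measure
  exceeds \<open>B\<close> by a null set, by finiteness of the measure.\<close>

lemma outer_measure_of_eq_imp_null_diff:
  assumes "outer_measure_of M A = emeasure M B" "B \<in> sets M" "B \<subseteq> A" "A \<subseteq> space M"
    and "emeasure M B < \<infinity>"
  obtains N where "N \<in> null_sets M" "A \<subseteq> B \<union> N"
proof -
  obtain E where E: "E \<in> sets M" "A \<subseteq> E" "outer_measure_of M A = emeasure M E"
    using outer_measure_of_attain[OF assms(4)] by blast
  have "emeasure M (E - B) = emeasure M E - emeasure M B"
    using assms E by (intro emeasure_Diff) auto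
  also have "\<dots> = 0"
    using E assms by simp
  finally have "E - B \<in> null_sets M"
    using E assms by (intro null_setsI) auto
  with E show ?thesis by (intro that[of "E - B"]) auto
qed

text \<open>Preservation is stated for one measure, so that the locale can be entered from a
  \<open>\<phi>\<close>-invariant measure for one inequality and from an \<open>f\<close>-invariant
  one for the other.\<close>

locale preserved_selection =
  fixes X :: "'a::metric_space set" and \<phi> :: "'a \<Rightarrow> 'a set" and f :: "'a \<Rightarrow> 'a"
    and \<mu> :: "'a measure"
  assumes compact_X: "compact X"
    and multimap: "multimap_on X \<phi>"
    and f_cont: "continuous_on X f"
    and f_sel: "\<And>x. x \<in> X \<Longrightarrow> f x \<in> \<phi> x"
    and \<mu>_prob: "borel_prob_on X \<mu>"
    and preserving: "\<And>A. A \<in> sets \<mu> \<Longrightarrow>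
      outer_measure_of \<mu> (large_preimage X \<phi> A) = emeasure \<mu> A"
begin

sublocale prob_space \<mu>
  using \<mu>_prob by (simp add: borel_prob_on_def)

lemma space_\<mu>: "space \<mu> = X"
  by (rule borel_prob_on_space[OF \<mu>_prob])

lemma f_image: "f ` X \<subseteq> X"
  using f_sel multimap by (auto simp: multimap_on_def)

lemma f_measurable: "f \<in> \<mu> \<rightarrow>\<^sub>M \<mu>"
  by (rule continuous_on_measurable_borel_prob[OF \<mu>_prob f_cont f_image])

lemma funpow_measurable: "f ^^ k \<in> \<mu> \<rightarrow>\<^sub>M \<mu>"
  by (rule measurable_compose_n[OF f_measurable])

lemma vimage_subset_large_preimage: "f -` A \<inter> X \<subseteq> large_preimage X \<phi> A"
  using f_sel by (auto simp: large_preimage_def)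

lemma f_invariant: "\<mu> \<in> map_invariant_measures X f"
proof (rule map_invariant_measuresI[OF \<mu>_prob f_cont f_image])
  have le: "measure \<mu> (f -` A \<inter> X) \<le> measure \<mu> A" if A: "A \<in> sets \<mu>" for A
  proof -
    have "f -` A \<inter> X \<in> sets \<mu>"
      using measurable_sets[OF f_measurable A] by (simp add: space_\<mu>)
    then have "emeasure \<mu> (f -` A \<inter> X) \<le> emeasure \<mu> A"
      using outer_measure_of_mono[OF vimage_subset_large_preimage[of A], of \<mu>] preserving[OF A]
      by simp
    then show ?thesis by (simp add: emeasure_eq_measure)
  qed
  fix A assume A: "A \<in> sets \<mu>"
  have "f -` (X - A) \<inter> X = X - f -` A \<inter> X" using f_image by auto
  then have "measure \<mu> (X - f -` A \<inter> X) \<le> measure \<mu> (X - A)"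
    using le[of "X - A"] A sets.compl_sets[OF A] by (simp add: space_\<mu>)
  then show "measure \<mu> A \<le> measure \<mu> (f -` A \<inter> X)"
    using prob_compl[OF A] prob_compl[OF measurable_sets[OF f_measurable A]] by (simp add: space_\<mu>)
qed

lemma emeasure_vimage:
  assumes "A \<in> sets \<mu>"
  shows "emeasure \<mu> (f -` A \<inter> X) = emeasure \<mu> A"
  using f_invariant assms by (simp add: map_invariant_measures_def)

lemma distr_f: "distr \<mu> \<mu> f = \<mu>"
  by (rule measure_eqI) (auto simp: emeasure_distr[OF f_measurable] space_\<mu> emeasure_vimage)

lemma distr_funpow: "distr \<mu> \<mu> (f ^^ k) = \<mu>"
proof (induction k)
  case 0
  show ?case by (simp add: id_def distr_id)
next
  case (Suc k)
  have "distr \<mu> \<mu> (f ^^ Suc k) = distr (distr \<mu> \<mu> (f ^^ k)) \<mu> f"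
    by (subst distr_distr[OF f_measurable]) (auto simp: funpow_measurable)
  with Suc show ?case by (simp add: distr_f comp_def)
qed

text \<open>The reverse inclusion holds everywhere because \<open>f\<close> is a selection. The
  exceptional set survives iteration: the large preimage of a union is the union of the large
  preimages, and preservation makes that of a null set null.\<close>

lemma iter_preimage_subset_null:
  assumes "A \<in> sets \<mu>"
  shows "\<exists>N\<in>null_sets \<mu>. iter_preimage X \<phi> k A \<subseteq> (f ^^ k) -` A \<inter> X \<union> N"
proof (induction k)
  case 0
  show ?case by (intro bexI[of _ "{}"]) auto
next
  case (Suc k)
  define B where "B = (f ^^ k) -` A \<inter> X"
  obtain N where N: "N \<in> null_sets \<mu>" "iter_preimage X \<phi> k A \<subseteq> B \<union> N"
    using Suc by (auto simp: B_def)
  have B: "B \<in> sets \<mu>"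
    using measurable_sets[OF funpow_measurable assms, of k] by (simp add: B_def space_\<mu>)
  have fB: "f -` B \<inter> X \<in> sets \<mu>"
    using measurable_sets[OF f_measurable B] by (simp add: space_\<mu>)
  have lX: "large_preimage X \<phi> C \<subseteq> space \<mu>" for C
    by (auto simp: large_preimage_def space_\<mu>)
  have "outer_measure_of \<mu> (large_preimage X \<phi> B) = emeasure \<mu> (f -` B \<inter> X)"
    using preserving[OF B] emeasure_vimage[OF B] by simp
  then obtain N1 where N1: "N1 \<in> null_sets \<mu>" "large_preimage X \<phi> B \<subseteq> f -` B \<inter> X \<union> N1"
    by (rule outer_measure_of_eq_imp_null_diff[OF _ fB vimage_subset_large_preimage lX])
      (simp add: emeasure_eq_measure)
  have "outer_measure_of \<mu> (large_preimage X \<phi> N) = emeasure \<mu> {}"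
    using preserving[OF null_setsD2[OF N(1)]] null_setsD1[OF N(1)] by simp
  then obtain N2 where N2: "N2 \<in> null_sets \<mu>" "large_preimage X \<phi> N \<subseteq> {} \<union> N2"
    by (rule outer_measure_of_eq_imp_null_diff[OF _ _ _ lX]) auto
  have "f -` B \<inter> X \<subseteq> (f ^^ Suc k) -` A \<inter> X"
    by (auto simp: B_def funpow_swap1)
  moreover have "iter_preimage X \<phi> (Suc k) A \<subseteq> large_preimage X \<phi> B \<union> large_preimage X \<phi> N"
    using N(2) unfolding iter_preimage_Suc[OF multimap] large_preimage_def by blast
  ultimately have "iter_preimage X \<phi> (Suc k) A \<subseteq> (f ^^ Suc k) -` A \<inter> X \<union> (N1 \<union> N2)"
    using N1(2) N2(2) by blast
  with N1(1) N2(1) show ?case by blast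
qed

text \<open>The extra label \<open>length Ps\<close> is given to the null set that an ordered
  partition may leave uncovered.\<close>

definition part_index :: "'a set list \<Rightarrow> 'a \<Rightarrow> nat" where
  "part_index Ps x = (if x \<in> \<Union>(set Ps) then THE i. i < length Ps \<and> x \<in> Ps ! i else length Ps)"

lemma disjoint_nth:
  assumes "ordered_partition \<mu> Ps" "i < length Ps" "j < length Ps" "x \<in> Ps ! i" "x \<in> Ps ! j"
  shows "i = j"
proof (rule ccontr)
  assume "i \<noteq> j"
  then have "Ps ! i \<noteq> Ps ! j"
    using assms by (auto simp: ordered_partition_def nth_eq_iff_index_eq)
  moreover have "disjoint (set Ps)" using assms(1) by (simp add: ordered_partition_def)
  ultimately have "Ps ! i \<inter> Ps ! j = {}"
    using assms(2,3) by (intro disjointD) auto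
  with assms(4,5) show False by auto
qed

lemma part_index_eq:
  assumes "ordered_partition \<mu> Ps" "i < length Ps"
  shows "part_index Ps x = i \<longleftrightarrow> x \<in> Ps ! i"
proof -
  have *: "part_index Ps x = j" if "x \<in> Ps ! j" "j < length Ps" for j
    unfolding part_index_def using that disjoint_nth[OF assms(1)]
    by (auto intro!: the_equality)
  show ?thesis
  proof
    assume i: "part_index Ps x = i"
    then have "x \<in> \<Union>(set Ps)" using assms(2) by (auto simp: part_index_def split: if_splits)
    then obtain j where "j < length Ps" "x \<in> Ps ! j" by (auto simp: in_set_conv_nth)
    with *[of j] i show "x \<in> Ps ! i" by simp
  qed (use * assms(2) in blast)
qed

lemma part_index_le: "ordered_partition \<mu> Ps \<Longrightarrow> part_index Ps x \<le> length Ps"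
proof (cases "x \<in> \<Union>(set Ps)")
  case True
  assume "ordered_partition \<mu> Ps"
  from True obtain j where j: "j < length Ps" "x \<in> Ps ! j" by (auto simp: in_set_conv_nth)
  then show ?thesis
    using part_index_eq[OF \<open>ordered_partition \<mu> Ps\<close> j(1), of x] by simp
qed (simp add: part_index_def)

lemma part_index_vimage_length:
  assumes "ordered_partition \<mu> Ps"
  shows "part_index Ps -` {length Ps} \<inter> X = X - \<Union>(set Ps)"
proof -
  have "part_index Ps x \<noteq> length Ps" if "x \<in> \<Union>(set Ps)" for x
  proof -
    from that obtain j where j: "j < length Ps" "x \<in> Ps ! j" by (auto simp: in_set_conv_nth)
    then show ?thesis using part_index_eq[OF assms j(1), of x] by simp
  qed
  moreover have "part_index Ps x = length Ps" if "x \<notin> \<Union>(set Ps)" for x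
    using that by (simp only: part_index_def if_False)
  ultimately show ?thesis by blast
qed

lemma Union_parts_sets: "ordered_partition \<mu> Ps \<Longrightarrow> \<Union>(set Ps) \<in> sets \<mu>"
  by (auto simp: ordered_partition_def intro!: sets.finite_Union)

lemma simple_function_part_index:
  assumes "ordered_partition \<mu> Ps"
  shows "simple_function \<mu> (part_index Ps)"
  unfolding simple_function_def space_\<mu>
proof (intro conjI ballI)
  have "part_index Ps ` X \<subseteq> {..length Ps}" using part_index_le[OF assms] by auto
  then show "finite (part_index Ps ` X)" by (rule finite_subset) simp
  fix i assume "i \<in> part_index Ps ` X"
  then have "i \<le> length Ps" using part_index_le[OF assms] by auto
  then consider "i < length Ps" | "i = length Ps" by linarith
  then show "part_index Ps -` {i} \<inter> X \<in> sets \<mu>"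
  proof cases
    case 1
    then have m: "Ps ! i \<in> sets \<mu>" using assms by (auto simp: ordered_partition_def)
    moreover have "part_index Ps -` {i} \<inter> X = Ps ! i"
      using part_index_eq[OF assms 1] sets.sets_into_space[OF m] by (auto simp: space_\<mu>)
    ultimately show ?thesis by simp
  next
    case 2
    then show ?thesis
      using part_index_vimage_length[OF assms] sets.compl_sets[OF Union_parts_sets[OF assms]]
      by (simp add: space_\<mu>)
  qed
qed

definition tilde :: "'a set list \<Rightarrow> nat \<Rightarrow> nat \<Rightarrow> 'a set" where
  "tilde Ps k j = (if k = 0 then Ps ! j
     else iter_preimage X \<phi> k (Ps ! j) - (\<Union>i<j. iter_preimage X \<phi> k (Ps ! i)))"

lemma tilde_partition_eq: "tilde_partition X \<phi> Ps k = tilde Ps k ` {..<length Ps}"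
  by (auto simp: tilde_partition_def tilde_def in_set_conv_nth)

lemma tilde_disjoint:
  assumes "ordered_partition \<mu> Ps" "i < length Ps" "j < length Ps"
    and "x \<in> tilde Ps k i" "x \<in> tilde Ps k j"
  shows "i = j"
proof (cases "k = 0")
  case True
  then show ?thesis using disjoint_nth[OF assms(1-3)] assms(4,5) by (simp add: tilde_def)
next
  case False
  with assms(4,5) show ?thesis by (cases i j rule: linorder_cases) (auto simp: tilde_def)
qed

definition cell :: "'a set list \<Rightarrow> nat list \<Rightarrow> 'a set" where
  "cell Ps as = X \<inter> (\<Inter>k<length as. tilde Ps k (as ! k))"

lemma join_upto_tilde:
  "join_upto X (tilde_partition X \<phi> Ps) n =
    cell Ps ` {as. set as \<subseteq> {..<length Ps} \<and> length as = n \<and> cell Ps as \<noteq> {}}"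
  (is "?J = ?C")
proof
  show "?J \<subseteq> ?C"
  proof
    fix c assume "c \<in> ?J"
    then obtain Q where Q: "\<forall>k<n. Q k \<in> tilde Ps k ` {..<length Ps}"
      "c = X \<inter> (\<Inter>k<n. Q k)" "c \<noteq> {}"
      by (auto simp: join_upto_def tilde_partition_eq)
    then have "\<forall>k. \<exists>j. k < n \<longrightarrow> j < length Ps \<and> Q k = tilde Ps k j" by blast
    then obtain a where a: "\<And>k. k < n \<Longrightarrow> a k < length Ps \<and> Q k = tilde Ps k (a k)" by metis
    have "c = cell Ps (map a [0..<n])"
      using Q(2) a by (auto simp: cell_def)
    with Q(3) a show "c \<in> ?C" by (intro image_eqI[of _ _ "map a [0..<n]"]) auto
  qed
  show "?C \<subseteq> ?J"
  proof
    fix c assume "c \<in> ?C"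
    then obtain as where as: "set as \<subseteq> {..<length Ps}" "length as = n" "c = cell Ps as" "c \<noteq> {}"
      by auto
    have "tilde Ps k (as ! k) \<in> tilde_partition X \<phi> Ps k" if "k < n" for k
      using subsetD[OF as(1) nth_mem[of k as]] as(2) that by (auto simp: tilde_partition_eq)
    with as show "c \<in> ?J"
      unfolding join_upto_def cell_def by blast
  qed
qed

text \<open>Turns the entropy, a sum over sets, into a sum over words. Only nonempty cells are
  injectively indexed; the empty ones all coincide and contribute nothing.\<close>

lemma inj_on_cell:
  assumes "ordered_partition \<mu> Ps"
  shows "inj_on (cell Ps) {as. set as \<subseteq> {..<length Ps} \<and> length as = n \<and> cell Ps as \<noteq> {}}"
proof (rule inj_onI)
  fix as bs
  let ?S = "{as. set as \<subseteq> {..<length Ps} \<and> length as = n \<and> cell Ps as \<noteq> {}}"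
  assume "as \<in> ?S" "bs \<in> ?S" and eq: "cell Ps as = cell Ps bs"
  then obtain x where as: "set as \<subseteq> {..<length Ps}" and bs: "set bs \<subseteq> {..<length Ps}" "length bs = length as"
    and x: "x \<in> cell Ps as"
    by auto
  show "as = bs"
  proof (rule nth_equalityI)
    fix k assume k: "k < length as"
    have "x \<in> tilde Ps k (as ! k)" "x \<in> tilde Ps k (bs ! k)"
      using x eq k bs(2) by (auto simp: cell_def)
    then show "as ! k = bs ! k"
      using subsetD[OF as(1) nth_mem[of k as]] subsetD[OF bs(1) nth_mem[of k bs]] bs(2) k
      by (intro tilde_disjoint[OF assms]) auto
  qed (use bs in simp)
qed

text \<open>Off a null set, preimages under iterates of \<open>\<phi>\<close> and \<open>f\<close>
  agree. There the preimages of distinct members are disjoint, so the subtractions in the ordered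
  families remove nothing and a cell is a fibre of the itinerary.\<close>

lemma outer_measure_cell:
  assumes Ps: "ordered_partition \<mu> Ps" and as: "set as \<subseteq> {..<length Ps}"
  shows "outer_measure_of \<mu> (cell Ps as)
    = emeasure \<mu> (itinerary (part_index Ps) f (length as) -` {as} \<inter> space \<mu>)"
proof -
  have "\<forall>k j. \<exists>N. N \<in> null_sets \<mu> \<and> (j < length Ps \<longrightarrow>
      iter_preimage X \<phi> k (Ps ! j) \<subseteq> (f ^^ k) -` (Ps ! j) \<inter> X \<union> N)"
  proof (intro allI)
    fix k j
    show "\<exists>N. N \<in> null_sets \<mu> \<and> (j < length Ps \<longrightarrow>
      iter_preimage X \<phi> k (Ps ! j) \<subseteq> (f ^^ k) -` (Ps ! j) \<inter> X \<union> N)"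
    proof (cases "j < length Ps")
      case True
      then have "Ps ! j \<in> sets \<mu>" using Ps by (auto simp: ordered_partition_def)
      from iter_preimage_subset_null[OF this] show ?thesis by blast
    qed (use null_sets.empty_sets in blast)
  qed
  then obtain N where N: "\<And>k j. N k j \<in> null_sets \<mu>"
    "\<And>k j. j < length Ps \<Longrightarrow> iter_preimage X \<phi> k (Ps ! j) \<subseteq> (f ^^ k) -` (Ps ! j) \<inter> X \<union> N k j"
    by metis
  \<comment> \<open>All finitely many exceptional sets at once, which makes the comparison pointwise
    off \<open>Z\<close>.\<close>
  define Z where "Z = (\<Union>k<length as. \<Union>j<length Ps. N k j)"
  have Z: "Z \<in> null_sets \<mu>" unfolding Z_def using N(1) by (intro null_sets_UN') auto
  have *: "x \<in> tilde Ps k (as ! k) \<longleftrightarrow> part_index Ps ((f ^^ k) x) = as ! k"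
    if x: "x \<in> X" "x \<notin> Z" and k: "k < length as" for x k
  proof -
    have ak: "as ! k < length Ps" using subsetD[OF as nth_mem[OF k]] by simp
    have ip: "x \<in> iter_preimage X \<phi> k (Ps ! j) \<longleftrightarrow> (f ^^ k) x \<in> Ps ! j" if j: "j < length Ps" for j
    proof
      assume "x \<in> iter_preimage X \<phi> k (Ps ! j)"
      then have "x \<in> (f ^^ k) -` (Ps ! j) \<inter> X \<union> N k j" using N(2)[OF j] by blast
      moreover have "x \<notin> N k j" using x(2) k j by (auto simp: Z_def)
      ultimately show "(f ^^ k) x \<in> Ps ! j" by auto
    next
      assume "(f ^^ k) x \<in> Ps ! j"
      with x(1) show "x \<in> iter_preimage X \<phi> k (Ps ! j)"
        using funpow_vimage_subset_iter_preimage[OF f_image f_sel, of k "Ps ! j"] by blast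
    qed
    have "x \<in> tilde Ps k (as ! k) \<longleftrightarrow> (f ^^ k) x \<in> Ps ! (as ! k)"
    proof (cases "k = 0")
      case True
      then show ?thesis by (simp add: tilde_def)
    next
      case False
      have "(f ^^ k) x \<notin> Ps ! i" if "i < as ! k" "(f ^^ k) x \<in> Ps ! (as ! k)" for i
        using disjoint_nth[OF Ps, of i "as ! k" "(f ^^ k) x"] that ak by auto
      with False ip ak show ?thesis by (auto simp: tilde_def)
    qed
    with part_index_eq[OF Ps ak] show ?thesis by simp
  qed
  have **: "x \<in> cell Ps as \<longleftrightarrow> x \<in> itinerary (part_index Ps) f (length as) -` {as} \<inter> X"
    if "x \<in> X" "x \<notin> Z" for x
    using *[OF that] that by (auto simp: cell_def list_eq_iff_nth_eq)
  show ?thesis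
  proof (rule outer_measure_of_cong_null[OF _ Z])
    show "itinerary (part_index Ps) f (length as) -` {as} \<inter> space \<mu> \<in> sets \<mu>"
      by (rule simple_functionD(2)[OF simple_function_itinerary[OF simple_function_part_index[OF Ps] f_measurable]])
    show "cell Ps as \<subseteq> itinerary (part_index Ps) f (length as) -` {as} \<inter> space \<mu> \<union> Z"
      using ** unfolding space_\<mu> cell_def by blast
    show "itinerary (part_index Ps) f (length as) -` {as} \<inter> space \<mu> \<subseteq> cell Ps as \<union> Z"
      using ** unfolding space_\<mu> by blast
  qed
qed

text \<open>Such an itinerary visits the uncovered null set at time \<open>k\<close>, and by
  invariance the points doing so form a null set.\<close>

lemma measure_itinerary_outside:
  assumes Ps: "ordered_partition \<mu> Ps" and "k < n" "as ! k = length Ps"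
  shows "measure \<mu> (itinerary (part_index Ps) f n -` {as} \<inter> space \<mu>) = 0"
proof -
  let ?U = "X - \<Union>(set Ps)"
  have U: "?U \<in> null_sets \<mu>"
  proof (rule null_setsI)
    have "prob (space \<mu> - \<Union>(set Ps)) = 0"
      using prob_compl[OF Union_parts_sets[OF Ps]] Ps prob_space
      by (simp add: ordered_partition_def emeasure_eq_measure)
    then show "emeasure \<mu> ?U = 0" by (simp add: emeasure_eq_measure space_\<mu>)
    show "?U \<in> sets \<mu>"
      using sets.compl_sets[OF Union_parts_sets[OF Ps]] by (simp add: space_\<mu>)
  qed
  have "emeasure \<mu> ((f ^^ k) -` ?U \<inter> space \<mu>) = emeasure (distr \<mu> \<mu> (f ^^ k)) ?U"
    using U by (intro emeasure_distr[symmetric] funpow_measurable) auto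
  also have "\<dots> = 0" by (simp only: distr_funpow null_setsD1[OF U])
  finally have null: "(f ^^ k) -` ?U \<inter> space \<mu> \<in> null_sets \<mu>"
    using U measurable_sets[OF funpow_measurable] by (intro null_setsI) auto
  have sub: "itinerary (part_index Ps) f n -` {as} \<inter> space \<mu> \<subseteq> (f ^^ k) -` ?U \<inter> space \<mu>"
  proof
    fix x assume x: "x \<in> itinerary (part_index Ps) f n -` {as} \<inter> space \<mu>"
    then have "itinerary (part_index Ps) f n x = as" by simp
    then have "part_index Ps ((f ^^ k) x) = length Ps"
      using assms(3) nth_itinerary[OF assms(2), of "part_index Ps" f x] by simp
    moreover have "(f ^^ k) x \<in> X"
      using x funpow_closed[OF f_image] by (auto simp: space_\<mu>)
    ultimately show "x \<in> (f ^^ k) -` ?U \<inter> space \<mu>"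
      using part_index_vimage_length[OF Ps] x by blast
  qed
  show ?thesis
    using null_setsD1[OF null_sets_subset[OF null _ sub]]
      simple_functionD(2)[OF simple_function_itinerary[OF simple_function_part_index[OF Ps] f_measurable]]
    by (simp add: measure_def)
qed

lemma partition_entropy_join_upto:
  assumes Ps: "ordered_partition \<mu> Ps"
  shows "partition_entropy \<mu> (join_upto X (tilde_partition X \<phi> Ps) n)
    = ent \<mu> (itinerary (part_index Ps) f n)"
proof -
  let ?L = "\<lambda>m::nat. {as. set as \<subseteq> {..<m} \<and> length as = n}"
  let ?l = "length Ps"
  let ?I = "itinerary (part_index Ps) f n"
  have fin: "finite (?L m)" for m by (rule finite_lists_length_eq) simp
  have "partition_entropy \<mu> (join_upto X (tilde_partition X \<phi> Ps) n)
      = (\<Sum>c\<in>cell Ps ` {as. set as \<subseteq> {..<?l} \<and> length as = n \<and> cell Ps as \<noteq> {}}.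
          eta (enn2real (outer_measure_of \<mu> c)))"
    unfolding partition_entropy_def join_upto_tilde by (simp add: eta_def sum_negf)
  also have "\<dots> = (\<Sum>as | set as \<subseteq> {..<?l} \<and> length as = n \<and> cell Ps as \<noteq> {}.
          eta (enn2real (outer_measure_of \<mu> (cell Ps as))))"
    by (rule sum.reindex_cong[OF inj_on_cell[OF Ps] refl refl])
  also have "\<dots> = (\<Sum>as\<in>?L ?l. eta (enn2real (outer_measure_of \<mu> (cell Ps as))))"
    by (intro sum.mono_neutral_left fin) auto
  also have "\<dots> = (\<Sum>as\<in>?L ?l. eta (measure \<mu> (?I -` {as} \<inter> space \<mu>)))"
    using outer_measure_cell[OF Ps] by (intro sum.cong) (auto simp: measure_def)
  \<comment> \<open>Words containing the extra label are added so that the index set contains every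
    itinerary; their terms vanish.\<close>
  also have "\<dots> = (\<Sum>as\<in>?L (Suc ?l). eta (measure \<mu> (?I -` {as} \<inter> space \<mu>)))"
  proof (intro sum.mono_neutral_left fin ballI)
    fix as assume "as \<in> ?L (Suc ?l) - ?L ?l"
    then have as: "set as \<subseteq> {..<Suc ?l}" "length as = n" "\<not> set as \<subseteq> {..<?l}" by auto
    then have "?l \<in> set as" by (auto simp: less_Suc_eq)
    then obtain k where "k < n" "as ! k = ?l"
      using as(2) by (auto simp: in_set_conv_nth)
    then show "eta (measure \<mu> (?I -` {as} \<inter> space \<mu>)) = 0"
      using measure_itinerary_outside[OF Ps] by simp
  qed auto
  also have "\<dots> = ent \<mu> ?I"
  proof (rule ent_eq_sum[OF fin, symmetric])
    show "?I ` space \<mu> \<subseteq> ?L (Suc ?l)"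
      using part_index_le[OF Ps] by (auto simp: itinerary_def less_Suc_eq_le)
  qed
  finally show ?thesis .
qed

lemma metric_entropy_part_eq:
  assumes "ordered_partition \<mu> Ps"
  shows "metric_entropy_part X \<mu> \<phi> Ps
    = limsup (\<lambda>n. ennreal (ent \<mu> (itinerary (part_index Ps) f n) / real n))"
  unfolding metric_entropy_part_def partition_entropy_join_upto[OF assms] ..

end

section \<open>Metric entropy is at most topological entropy\<close>

context preserved_selection
begin

lemma nonempty_X: "X \<noteq> {}"
  using not_empty by (simp add: space_\<mu>)

lemma compact_cores:
  assumes r: "simple_function \<mu> r"
  obtains K where "\<And>l. l \<in> r ` X \<Longrightarrow> compact (K l)" "\<And>l. l \<in> r ` X \<Longrightarrow> K l \<subseteq> r -` {l} \<inter> X"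
    "(\<Sum>l\<in>r ` X. eta (measure \<mu> (r -` {l} \<inter> X - K l))) \<le> 1"
proof -
  let ?L = "r ` X"
  have L: "finite ?L" using simple_functionD(1)[OF r] by (simp add: space_\<mu>)
  define M where "M = real (card ?L)"
  have M: "M > 0" using L nonempty_X by (auto simp: M_def card_gt_0_iff)
  \<comment> \<open>Chosen so that 2 sqrt d = 1 / M; the \<open>M\<close> level sets then contribute
    at most 1 in total.\<close>
  define d where "d = (1 / (2 * M))\<^sup>2"
  have d: "0 < d" "sqrt d = 1 / (2 * M)" using M by (auto simp: d_def)
  have "\<forall>l\<in>?L. \<exists>C. compact C \<and> C \<subseteq> r -` {l} \<inter> X \<and> measure \<mu> (r -` {l} \<inter> X - C) \<le> d"
  proof
    fix l assume "l \<in> ?L"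
    have A: "r -` {l} \<inter> X \<in> sets \<mu>" using simple_functionD(2)[OF r, of "{l}"] by (simp add: space_\<mu>)
    obtain C U where C: "compact C" "openin (top_of_set X) U" "C \<subseteq> r -` {l} \<inter> X"
      "r -` {l} \<inter> X \<subseteq> U" "measure \<mu> (U - C) < d"
      using borel_prob_on_regular[OF \<mu>_prob compact_X A d(1)] by blast
    have "measure \<mu> (r -` {l} \<inter> X - C) \<le> measure \<mu> (U - C)"
      using C by (intro finite_measure_mono sets.Diff borel_prob_on_openin[OF \<mu>_prob]
          borel_prob_on_compact[OF \<mu>_prob]) auto
    with C show "\<exists>C. compact C \<and> C \<subseteq> r -` {l} \<inter> X \<and> measure \<mu> (r -` {l} \<inter> X - C) \<le> d"
      by (intro exI[of _ C]) auto
  qed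
  then obtain K where K: "\<And>l. l \<in> ?L \<Longrightarrow> compact (K l)" "\<And>l. l \<in> ?L \<Longrightarrow> K l \<subseteq> r -` {l} \<inter> X"
    "\<And>l. l \<in> ?L \<Longrightarrow> measure \<mu> (r -` {l} \<inter> X - K l) \<le> d"
    by metis
  have "(\<Sum>l\<in>?L. eta (measure \<mu> (r -` {l} \<inter> X - K l))) \<le> (\<Sum>l\<in>?L. 1 / M)"
  proof (rule sum_mono)
    fix l assume l: "l \<in> ?L"
    have "eta (measure \<mu> (r -` {l} \<inter> X - K l)) \<le> 2 * sqrt (measure \<mu> (r -` {l} \<inter> X - K l))"
      by (rule eta_le_sqrt) simp
    also have "\<dots> \<le> 2 * sqrt d" using K(3)[OF l] by simp
    also have "\<dots> = 1 / M" by (simp add: d(2))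
    finally show "eta (measure \<mu> (r -` {l} \<inter> X - K l)) \<le> 1 / M" .
  qed
  also have "\<dots> = 1" using M by (simp add: M_def)
  finally show thesis using that[OF K(1,2)] by blast
qed

text \<open>The label \<open>k\<close> forgets \<open>r\<close> outside compact cores of its level sets and
  \<open>err\<close> restores it there; the small entropy of \<open>err\<close> takes the place of a conditional
  entropy. The complement \<open>U l\<close> of all cores but one meets only two level sets of \<open>k\<close>,
  which costs a factor \<open>2 ^ n\<close> in the counting.\<close>

lemma approximating_labels:
  assumes r: "simple_function \<mu> (r :: 'a \<Rightarrow> 'b)"
  obtains k err :: "'a \<Rightarrow> 'b option" and U :: "'b \<Rightarrow> 'a set"
  where "simple_function \<mu> k" "simple_function \<mu> err" "ent \<mu> err \<le> 2"
    "\<And>x y. x \<in> X \<Longrightarrow> y \<in> X \<Longrightarrow> k x = k y \<Longrightarrow> err x = err y \<Longrightarrow> r x = r y"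
    "open_cover X (U ` r ` X)"
    "\<And>x l. x \<in> X \<Longrightarrow> l \<in> r ` X \<Longrightarrow> x \<in> U l \<Longrightarrow> k x = None \<or> k x = Some l"
proof -
  let ?L = "r ` X"
  have L: "finite ?L" using simple_functionD(1)[OF r] by (simp add: space_\<mu>)
  obtain K where K: "\<And>l. l \<in> ?L \<Longrightarrow> compact (K l)" "\<And>l. l \<in> ?L \<Longrightarrow> K l \<subseteq> r -` {l} \<inter> X"
    "(\<Sum>l\<in>?L. eta (measure \<mu> (r -` {l} \<inter> X - K l))) \<le> 1"
    using compact_cores[OF r] by blast
  define W where "W = (\<Union>l\<in>?L. K l)"
  have rK: "r x = l" if "x \<in> K l" "l \<in> ?L" for x l using K(2)[OF that(2)] that(1) by auto
  have WK: "x \<in> W \<longleftrightarrow> x \<in> K (r x)" if "x \<in> X" for x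
  proof
    assume "x \<in> W"
    then obtain l where "l \<in> ?L" "x \<in> K l" unfolding W_def by blast
    with rK[of x l] show "x \<in> K (r x)" by simp
  next
    assume "x \<in> K (r x)"
    with that show "x \<in> W" unfolding W_def by blast
  qed
  have W: "W \<in> sets \<mu>"
    unfolding W_def using K(1,2) L
    by (intro sets.finite_UN borel_prob_on_compact[OF \<mu>_prob]) blast+
  define k where "k x = (if x \<in> W then Some (r x) else None)" for x
  define err where "err x = (if x \<in> W then None else Some (r x))" for x
  define U where "U l = X - (\<Union>l'\<in>?L - {l}. K l')" for l
  have pair: "simple_function \<mu> (\<lambda>x. (r x, indicator W x :: real))"
    using r W by (intro simple_function_Pair simple_function_indicator)
  show thesis
  proof
    have "simple_function \<mu> (\<lambda>x. (\<lambda>(v, i). if i = 1 then Some v else None) (r x, indicator W x :: real))"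
      by (rule simple_function_compose1[OF pair])
    then show "simple_function \<mu> k"
      by (rule simple_function_cong[THEN iffD1, rotated]) (auto simp: k_def)
    have "simple_function \<mu> (\<lambda>x. (\<lambda>(v, i). if i = 1 then None else Some v) (r x, indicator W x :: real))"
      by (rule simple_function_compose1[OF pair])
    then show "simple_function \<mu> err"
      by (rule simple_function_cong[THEN iffD1, rotated]) (auto simp: err_def)
    show "r x = r y" if "k x = k y" "err x = err y" for x y
      using that by (auto simp: k_def err_def split: if_splits)
    show "k x = None \<or> k x = Some l" if "x \<in> X" "l \<in> ?L" "x \<in> U l" for x l
      using that WK[of x] by (auto simp: k_def U_def)
    show "open_cover X (U ` ?L)"
      unfolding open_cover_def
    proof (intro conjI ballI)
      fix A assume "A \<in> U ` ?L"
      then obtain l where l: "A = U l" by auto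
      have "compact (\<Union>l'\<in>?L - {l}. K l')"
        using L K(1) by (intro compact_UN) auto
      then show "openin (top_of_set X) A"
        unfolding l U_def Diff_eq by (intro openin_open_Int open_Compl compact_imp_closed)
      next
      have "x \<in> U (r x)" if "x \<in> X" for x
      proof -
        have "x \<notin> K l" if "l \<in> ?L - {r x}" for l
          using rK[of x l] that by auto
        with that show ?thesis by (simp add: U_def)
      qed
      moreover have "U l \<subseteq> X" for l unfolding U_def by blast
      ultimately show "\<Union>(U ` ?L) = X" by blast
    qed
    \<comment> \<open>The label \<open>None\<close> contributes at most 1, and so do all the
      remainders outside the cores together.\<close>
    have "ent \<mu> err = (\<Sum>y\<in>insert None (Some ` ?L). eta (measure \<mu> (err -` {y} \<inter> X)))"
      unfolding space_\<mu>[symmetric]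
      by (rule ent_eq_sum) (use L in \<open>auto simp: space_\<mu> err_def\<close>)
    also have "\<dots> = eta (measure \<mu> (err -` {None} \<inter> X)) + (\<Sum>l\<in>?L. eta (measure \<mu> (err -` {Some l} \<inter> X)))"
      using L by (simp add: sum.reindex image_iff)
    also have "(\<Sum>l\<in>?L. eta (measure \<mu> (err -` {Some l} \<inter> X)))
        = (\<Sum>l\<in>?L. eta (measure \<mu> (r -` {l} \<inter> X - K l)))"
    proof (rule sum.cong[OF refl])
      fix l assume "l \<in> ?L"
      have "err -` {Some l} \<inter> X = r -` {l} \<inter> X - K l"
        using WK by (auto simp: err_def split: if_splits)
      then show "eta (measure \<mu> (err -` {Some l} \<inter> X)) = eta (measure \<mu> (r -` {l} \<inter> X - K l))"
        by simp
    qed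
    also have "eta (measure \<mu> (err -` {None} \<inter> X)) \<le> 1"
      by (intro eta_le_1) auto
    finally show "ent \<mu> err \<le> 2" using K(3) by simp
  qed
qed

lemma ent_compose_invariant:
  assumes "F \<in> \<mu> \<rightarrow>\<^sub>M \<mu>" "distr \<mu> \<mu> F = \<mu>" "simple_function \<mu> g"
  shows "ent \<mu> (\<lambda>x. g (F x)) = ent \<mu> g"
proof -
  have FX: "F x \<in> X" if "x \<in> X" for x
    using measurable_space[OF assms(1)] that by (simp add: space_\<mu>)
  have fin: "finite (g ` space \<mu>)" using simple_functionD(1)[OF assms(3)] .
  have "ent \<mu> (\<lambda>x. g (F x)) = (\<Sum>y\<in>g ` space \<mu>. eta (measure \<mu> ((\<lambda>x. g (F x)) -` {y} \<inter> space \<mu>)))"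
    using FX by (intro ent_eq_sum[OF fin]) (auto simp: space_\<mu>)
  also have "\<dots> = ent \<mu> g"
    unfolding ent_def
  proof (intro sum.cong refl arg_cong[where f = eta])
    fix y
    have "(\<lambda>x. g (F x)) -` {y} \<inter> space \<mu> = F -` (g -` {y} \<inter> space \<mu>) \<inter> space \<mu>"
      using FX by (auto simp: space_\<mu>)
    also have "measure \<mu> \<dots> = measure (distr \<mu> \<mu> F) (g -` {y} \<inter> space \<mu>)"
      by (rule measure_distr[symmetric, OF assms(1) simple_functionD(2)[OF assms(3)]])
    finally show "measure \<mu> ((\<lambda>x. g (F x)) -` {y} \<inter> space \<mu>) = measure \<mu> (g -` {y} \<inter> space \<mu>)"
      by (simp add: assms(2))
  qed
  finally show ?thesis .
qed

text \<open>Subadditivity along the orbit: by invariance each time contributes the same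
  entropy.\<close>

lemma ent_itinerary_le:
  assumes g: "simple_function \<mu> (g :: 'a \<Rightarrow> 'b)"
  shows "ent \<mu> (itinerary g (f ^^ q) n) \<le> n * ent \<mu> g"
proof (induction n)
  case 0
  have "ent \<mu> (itinerary g (f ^^ q) 0) \<le> ln (card {[] :: 'b list})"
    by (rule ent_le_ln_card[OF simple_function_itinerary[OF g funpow_measurable]])
      (auto simp: itinerary_def)
  then show ?case by simp
next
  case (Suc n)
  note I = simple_function_itinerary[OF g funpow_measurable[of q]]
  have m: "(f ^^ q) ^^ n \<in> \<mu> \<rightarrow>\<^sub>M \<mu>" "distr \<mu> \<mu> ((f ^^ q) ^^ n) = \<mu>"
    by (simp_all add: funpow_mult funpow_measurable distr_funpow)
  have gm: "simple_function \<mu> (\<lambda>x. g (((f ^^ q) ^^ n) x))"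
  proof -
    have "(\<lambda>x. g (((f ^^ q) ^^ n) x)) ` space \<mu> \<subseteq> g ` space \<mu>"
      using measurable_space[OF m(1)] by auto
    then show ?thesis
      using g measurable_compose[OF m(1), of g] unfolding simple_function_eq_measurable
      by (simp add: finite_subset)
  qed
  have "ent \<mu> (itinerary g (f ^^ q) (Suc n))
      \<le> ent \<mu> (\<lambda>x. (itinerary g (f ^^ q) n x, g (((f ^^ q) ^^ n) x)))"
    by (rule ent_le_of_determined[OF simple_function_Pair[OF I gm] I])
      (auto simp: itinerary_def)
  also have "\<dots> \<le> ent \<mu> (itinerary g (f ^^ q) n) + ent \<mu> (\<lambda>x. g (((f ^^ q) ^^ n) x))"
    by (rule ent_Pair_le[OF I gm])
  also have "ent \<mu> (\<lambda>x. g (((f ^^ q) ^^ n) x)) = ent \<mu> g"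
    by (rule ent_compose_invariant[OF m g])
  finally show ?case using Suc by (simp add: algebra_simps)
qed

lemma AE_iter_preimage:
  assumes "A \<in> sets \<mu>"
  shows "AE x in \<mu>. x \<in> iter_preimage X \<phi> k A \<longrightarrow> (f ^^ k) x \<in> A"
proof -
  obtain N where "N \<in> null_sets \<mu>" "iter_preimage X \<phi> k A \<subseteq> (f ^^ k) -` A \<inter> X \<union> N"
    using iter_preimage_subset_null[OF assms] by blast
  then show ?thesis
    by (intro AE_I'[of N]) auto
qed

text \<open>A member of an optimal subcover prescribes, for almost all of its points, a set
  \<open>U l\<close> at each time. At the times j q the label \<open>k\<close> is then one of two
  values, so a member and \<open>n\<close> bits determine the itinerary.\<close>

lemma ent_label_itinerary_le_ln_card:
  assumes lsc: "lsc_on X \<phi>" and k: "simple_function \<mu> k" and L: "finite L"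
    and U: "open_cover X (U ` L)"
    and kU: "\<And>x l. x \<in> X \<Longrightarrow> l \<in> L \<Longrightarrow> x \<in> U l \<Longrightarrow> k x = None \<or> k x = Some l"
    and "0 < q"
  shows "ent \<mu> (itinerary k (f ^^ q) n)
    \<le> ln (real (min_subcover_card X (cover_iter X \<phi> (U ` L) (n * q))) * 2 ^ n)"
proof -
  let ?N = "min_subcover_card X (cover_iter X \<phi> (U ` L) (n * q))"
  note oc = open_cover_cover_iter[OF multimap lsc U, of "n * q"]
  obtain D where D: "D \<subseteq> cover_iter X \<phi> (U ` L) (n * q)" "finite D" "\<Union>D = X" "card D = ?N"
    by (rule min_subcover_card_attained[OF compact_X oc])
  have "\<forall>d\<in>D. \<exists>l. (\<forall>j<n * q. l j \<in> L) \<and> d = X \<inter> (\<Inter>j<n * q. iter_preimage X \<phi> j (U (l j)))"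
  proof
    fix d assume "d \<in> D"
    then have "d \<in> cover_iter X \<phi> (U ` L) (n * q)" using D by auto
    then obtain Q where Q: "\<And>j. j < n * q \<Longrightarrow> Q j \<in> U ` L"
      "d = X \<inter> (\<Inter>j<n * q. iter_preimage X \<phi> j (Q j))" "d \<noteq> {}"
      by (rule cover_iterE) (rule that)
    have "\<forall>j. \<exists>l. j < n * q \<longrightarrow> l \<in> L \<and> Q j = U l" using Q(1) by blast
    then obtain l where "\<And>j. j < n * q \<Longrightarrow> l j \<in> L \<and> Q j = U (l j)" by metis
    with Q(2) show "\<exists>l. (\<forall>j<n * q. l j \<in> L) \<and> d = X \<inter> (\<Inter>j<n * q. iter_preimage X \<phi> j (U (l j)))"
      by (intro exI[of _ l]) auto
  qed
  then obtain l where l: "\<And>d j. d \<in> D \<Longrightarrow> j < n * q \<Longrightarrow> l d j \<in> L"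
    "\<And>d. d \<in> D \<Longrightarrow> d = X \<inter> (\<Inter>j<n * q. iter_preimage X \<phi> j (U (l d j)))"
    by metis
  define B where "B = {bs :: bool list. set bs \<subseteq> UNIV \<and> length bs = n}"
  have B: "finite B" "card B = 2 ^ n"
    unfolding B_def using finite_lists_length_eq[of "UNIV :: bool set" n] card_lists_length_eq[of "UNIV :: bool set" n]
    by auto
  define S where "S = (\<lambda>(d, bs). map (\<lambda>j. if bs ! j then None else Some (l d (j * q))) [0..<n]) ` (D \<times> B)"
  have "card S \<le> card (D \<times> B)" unfolding S_def using D B by (intro card_image_le) auto
  then have cardS: "card S \<le> ?N * 2 ^ n" using D B by (simp add: card_cartesian_product)
  have finS: "finite S" using D B by (simp add: S_def)
  have U_sets: "U l' \<in> sets \<mu>" if "l' \<in> L" for l'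
    using U that by (intro borel_prob_on_openin[OF \<mu>_prob]) (auto simp: open_cover_def)
  have "AE x in \<mu>. \<forall>j\<in>{..<n * q}. \<forall>l'\<in>L. x \<in> iter_preimage X \<phi> j (U l') \<longrightarrow> (f ^^ j) x \<in> U l'"
    using L U_sets by (intro AE_finite_allI AE_iter_preimage) auto
  moreover have "itinerary k (f ^^ q) n x \<in> S"
    if x: "x \<in> X" and *: "\<forall>j\<in>{..<n * q}. \<forall>l'\<in>L. x \<in> iter_preimage X \<phi> j (U l') \<longrightarrow> (f ^^ j) x \<in> U l'" for x
  proof -
    obtain d where d: "d \<in> D" "x \<in> d" using x D(3) by auto
    define bs where "bs = map (\<lambda>j. k ((f ^^ (j * q)) x) = None) [0..<n]"
    have "bs \<in> B" by (simp add: B_def bs_def)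
    moreover have "itinerary k (f ^^ q) n x = map (\<lambda>j. if bs ! j then None else Some (l d (j * q))) [0..<n]"
    proof (rule nth_equalityI)
      fix j assume "j < length (itinerary k (f ^^ q) n x)"
      then have j: "j < n" "j * q < n * q" using \<open>0 < q\<close> by auto
      have "x \<in> iter_preimage X \<phi> (j * q) (U (l d (j * q)))"
        using subsetD[OF equalityD1[OF l(2)[OF d(1)]] d(2)] j(2) by blast
      with * j l(1)[OF d(1) j(2)] have "(f ^^ (j * q)) x \<in> U (l d (j * q))" by auto
      then have "k ((f ^^ (j * q)) x) = None \<or> k ((f ^^ (j * q)) x) = Some (l d (j * q))"
        using kU[OF funpow_closed[OF f_image x] l(1)[OF d(1) j(2)]] by blast
      then show "itinerary k (f ^^ q) n x ! j
          = map (\<lambda>j. if bs ! j then None else Some (l d (j * q))) [0..<n] ! j"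
        using j by (auto simp: bs_def funpow_mult mult.commute)
    qed simp
    ultimately show ?thesis using d(1) by (auto simp: S_def)
  qed
  ultimately have "AE x in \<mu>. itinerary k (f ^^ q) n x \<in> S"
    by (auto simp: space_\<mu> elim!: AE_mp)
  from ent_le_ln_card[OF simple_function_itinerary[OF k funpow_measurable] finS this]
  have "ent \<mu> (itinerary k (f ^^ q) n) \<le> ln (card S)" .
  also have "\<dots> \<le> ln (real (?N * 2 ^ n))"
  \<comment> \<open>As \<open>ln 0 = 0\<close>, this case only needs the right side to be
    nonnegative.\<close>
  proof (cases "card S = 0")
    case True
    then show ?thesis using min_subcover_card_pos[OF compact_X oc nonempty_X] by (simp del: of_nat_mult)
  next
    case False
    then have "0 < card S" by simp
    moreover have "real (card S) \<le> real (?N * 2 ^ n)" using cardS by (rule of_nat_mono)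
    ultimately show ?thesis by (intro ln_mono) simp_all
  qed
  finally show ?thesis by simp
qed

text \<open>The labels are built for whole \<open>q\<close>-blocks, so reading them at
  \<open>n\<close> multiples of \<open>q\<close> recovers n q symbols. Per block the bit costs ln 2
  \<le> 1 and the correction \<open>err\<close> at most 2, whence 3 for every \<open>q\<close>. The
  cover depends on \<open>q\<close> but not on \<open>n\<close>.\<close>

lemma ent_itinerary_mult_le:
  assumes lsc: "lsc_on X \<phi>" and p: "simple_function \<mu> p" and "0 < q"
  obtains \<A> where "open_cover X \<A>"
    "\<And>n. ent \<mu> (itinerary p f (n * q)) \<le> ln (real (min_subcover_card X (cover_iter X \<phi> \<A> (n * q)))) + 3 * n"
proof -
  let ?r = "itinerary p f q"
  have r: "simple_function \<mu> ?r" by (rule simple_function_itinerary[OF p f_measurable])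
  obtain k err :: "'a \<Rightarrow> 'b list option" and U where
    k: "simple_function \<mu> k" "simple_function \<mu> err" "ent \<mu> err \<le> 2"
    "\<And>x y. x \<in> X \<Longrightarrow> y \<in> X \<Longrightarrow> k x = k y \<Longrightarrow> err x = err y \<Longrightarrow> ?r x = ?r y"
    "open_cover X (U ` ?r ` X)"
    "\<And>x l. x \<in> X \<Longrightarrow> l \<in> ?r ` X \<Longrightarrow> x \<in> U l \<Longrightarrow> k x = None \<or> k x = Some l"
    by (rule approximating_labels[OF r]) (rule that)
  have fin: "finite (?r ` X)" using simple_functionD(1)[OF r] by (simp add: space_\<mu>)
  show thesis
  proof (rule that[OF k(5)])
    fix n
    let ?N = "min_subcover_card X (cover_iter X \<phi> (U ` ?r ` X) (n * q))"
    have N: "0 < ?N"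
      by (rule min_subcover_card_pos[OF compact_X open_cover_cover_iter[OF multimap lsc k(5)] nonempty_X])
    let ?K = "itinerary k (f ^^ q) n" and ?E = "itinerary err (f ^^ q) n"
    note K = simple_function_itinerary[OF k(1) funpow_measurable[of q], of n]
    note E = simple_function_itinerary[OF k(2) funpow_measurable[of q], of n]
    have "ent \<mu> (itinerary p f (n * q)) \<le> ent \<mu> (\<lambda>x. (?K x, ?E x))"
    proof (rule ent_le_of_determined[OF simple_function_Pair[OF K E] simple_function_itinerary[OF p f_measurable]])
      fix x y assume x: "x \<in> space \<mu>" and y: "y \<in> space \<mu>" and eq: "(?K x, ?E x) = (?K y, ?E y)"
      show "itinerary p f (n * q) x = itinerary p f (n * q) y"
        unfolding itinerary_eq_iff
      proof (intro allI impI)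
        fix i assume i: "i < n * q"
        define j where "j = i div q"
        have j: "j < n" "i = (i mod q) + q * j" "i mod q < q"
          using i \<open>0 < q\<close> by (auto simp: j_def less_mult_imp_div_less)
        have "k (((f ^^ q) ^^ j) x) = k (((f ^^ q) ^^ j) y)" "err (((f ^^ q) ^^ j) x) = err (((f ^^ q) ^^ j) y)"
          using eq j(1) by (auto simp: itinerary_eq_iff)
        then have "?r (((f ^^ q) ^^ j) x) = ?r (((f ^^ q) ^^ j) y)"
          using x y funpow_closed[OF f_image] by (intro k(4)) (auto simp: space_\<mu> funpow_mult)
        then have "p ((f ^^ (i mod q)) (((f ^^ q) ^^ j) x)) = p ((f ^^ (i mod q)) (((f ^^ q) ^^ j) y))"
          using j(3) by (auto simp: itinerary_eq_iff)
        moreover have "(f ^^ (i mod q)) (((f ^^ q) ^^ j) z) = (f ^^ i) z" for z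
          by (subst (2) j(2)) (simp add: funpow_add funpow_mult)
        ultimately show "p ((f ^^ i) x) = p ((f ^^ i) y)" by simp
      qed
    qed
    also have "\<dots> \<le> ent \<mu> ?K + ent \<mu> ?E" by (rule ent_Pair_le[OF K E])
    also have "ent \<mu> ?K \<le> ln (real ?N * 2 ^ n)"
      by (rule ent_label_itinerary_le_ln_card[OF lsc k(1) fin k(5,6) \<open>0 < q\<close>])
    also have "\<dots> = ln (real ?N) + n * ln 2"
      using N by (simp add: ln_mult ln_realpow)
    also have "n * ln 2 \<le> n * (1::real)"
      using ln_le_minus_one[of "2::real"] by (intro mult_left_mono) auto
    also have "ent \<mu> ?E \<le> n * ent \<mu> err" by (rule ent_itinerary_le[OF k(2)])
    also have "n * ent \<mu> err \<le> n * (2::real)" using k(3) by (intro mult_left_mono) auto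
    finally show "ent \<mu> (itinerary p f (n * q)) \<le> ln (real ?N) + 3 * n" by simp
  qed
qed

lemma ent_itinerary_mono:
  assumes "simple_function \<mu> p" "m \<le> n"
  shows "ent \<mu> (itinerary p f m) \<le> ent \<mu> (itinerary p f n)"
  by (rule ent_le_of_determined) (use assms in \<open>auto intro!: simple_function_itinerary f_measurable simp: itinerary_eq_iff\<close>)

lemma limsup_ent_le_top_entropy:
  assumes lsc: "lsc_on X \<phi>" and p: "simple_function \<mu> p"
  shows "limsup (\<lambda>n. ennreal (ent \<mu> (itinerary p f n) / real n)) \<le> top_entropy X \<phi>"
proof (rule ennreal_le_epsilon)
  fix e :: real assume "0 < e"
  \<comment> \<open>With q above 6 / e the block cost 3 / q is below e / 2; the other e / 2 absorbs
    the convergence to \<open>h\<close>.\<close>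
  define q where "q = nat \<lceil>6 / e\<rceil> + 1"
  have "6 / e < q" unfolding q_def by linarith
  moreover have "0 < q" by (simp add: q_def)
  ultimately have q: "0 < q" "3 / q < e / 2"
    using \<open>0 < e\<close> by (simp_all add: field_simps)
  obtain \<A> where A: "open_cover X \<A>"
    "\<And>n. ent \<mu> (itinerary p f (n * q)) \<le> ln (real (min_subcover_card X (cover_iter X \<phi> \<A> (n * q)))) + 3 * n"
    by (rule ent_itinerary_mult_le[OF lsc p q(1)]) blast
  let ?N = "\<lambda>n. real (min_subcover_card X (cover_iter X \<phi> \<A> n))"
  define h where "h = top_entropy_cover X \<phi> \<A>"
  have lim: "(\<lambda>n. ln (?N n) / n) \<longlonglongrightarrow> h"
    unfolding h_def by (rule top_entropy_cover_tendsto[OF compact_X nonempty_X multimap lsc A(1)])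
  have N: "1 \<le> ?N n" for n
    using min_subcover_card_pos[OF compact_X open_cover_cover_iter[OF multimap lsc A(1)] nonempty_X, of n]
    by linarith
  have h0: "0 \<le> h"
    by (rule LIMSEQ_le_const[OF lim]) (use N in auto)
  define c where "c = h + e / 2 + 3 / q"
  have "\<forall>\<^sub>F n in sequentially. ln (?N n) / n < h + e / 2"
    using \<open>0 < e\<close> by (intro order_tendstoD[OF lim]) auto
  then obtain n0 where n0: "\<And>n. n \<ge> n0 \<Longrightarrow> ln (?N n) / n < h + e / 2"
    by (auto simp: eventually_sequentially)
  have bound: "ent \<mu> (itinerary p f n) / n \<le> c * (1 + q / n)" if n: "n \<ge> max n0 1" for n
  proof -
    \<comment> \<open>The block estimate needs multiples of \<open>q\<close>; monotonicity allows
      rounding \<open>n\<close> up to one, at a relative cost of at most q / n.\<close>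
    define i where "i = n div q + 1"
    have "n \<le> n div q * q + q"
      using div_mult_mod_eq[of n q] mod_less_divisor[OF q(1), of n] by linarith
    then have i: "n \<le> i * q" "real i \<le> n / q + 1"
      using of_nat_div_le_of_nat[of n q, where 'a = real]
      by (auto simp: i_def)
    have iq: "i * q \<ge> n0" "0 < i * q" using i(1) n by linarith+
    have "ent \<mu> (itinerary p f n) \<le> ent \<mu> (itinerary p f (i * q))"
      by (rule ent_itinerary_mono[OF p i(1)])
    also have "\<dots> \<le> ln (?N (i * q)) + 3 * i" by (rule A(2))
    also have "ln (?N (i * q)) \<le> (h + e / 2) * real (i * q)"
      using n0[OF iq(1)] iq(2) by (simp add: pos_divide_less_eq del: of_nat_mult)
    also have "(h + e / 2) * real (i * q) + 3 * i = (c * q) * i"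
      using q(1) by (simp add: c_def field_simps)
    also have "\<dots> \<le> (c * q) * (n / q + 1)"
      using i(2) h0 \<open>0 < e\<close> by (intro mult_left_mono) (auto simp: c_def)
    also have "\<dots> = c * (n + q)" using q(1) by (simp add: field_simps)
    finally have "ent \<mu> (itinerary p f n) / n \<le> c * (n + q) / n"
      by (intro divide_right_mono) auto
    also have "\<dots> = c * (1 + q / n)" using n by (simp add: field_simps)
    finally show ?thesis .
  qed
  have "limsup (\<lambda>n. ennreal (ent \<mu> (itinerary p f n) / real n)) \<le> limsup (\<lambda>n. ennreal (c * (1 + q / n)))"
    using bound by (intro Limsup_mono) (auto simp: eventually_sequentially intro!: exI[of _ "max n0 1"] ennreal_leI)
  also have "\<dots> = ennreal c"
  proof (rule lim_imp_Limsup)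
    have "(\<lambda>n. c * (1 + q / real n)) \<longlonglongrightarrow> c * (1 + 0)"
      by (intro tendsto_intros lim_const_over_n)
    then show "(\<lambda>n. ennreal (c * (1 + q / real n))) \<longlonglongrightarrow> ennreal c"
      by (intro tendsto_ennrealI) simp
  qed simp
  also have "ennreal c \<le> ennreal (h + e)"
  proof (rule ennreal_leI)
    show "c \<le> h + e"
      unfolding c_def using q(2) by linarith
  qed
  also have "\<dots> = ennreal h + ennreal e"
    using h0 \<open>0 < e\<close> by (simp add: ennreal_plus)
  also have "ennreal h \<le> top_entropy X \<phi>"
    unfolding top_entropy_def h_def using A(1) by (intro SUP_upper) auto
  finally show "limsup (\<lambda>n. ennreal (ent \<mu> (itinerary p f n) / real n)) \<le> top_entropy X \<phi> + ennreal e"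
    by (simp add: add_right_mono)
qed

theorem metric_entropy_le_top_entropy:
  assumes "lsc_on X \<phi>"
  shows "metric_entropy X \<mu> \<phi> \<le> top_entropy X \<phi>"
  unfolding metric_entropy_def
proof (rule SUP_least, clarify)
  fix Ps assume Ps: "ordered_partition \<mu> Ps"
  show "metric_entropy_part X \<mu> \<phi> Ps \<le> top_entropy X \<phi>"
    unfolding metric_entropy_part_eq[OF Ps]
    by (rule limsup_ent_le_top_entropy[OF assms simple_function_part_index[OF Ps]])
qed

end

section \<open>Empirical measures\<close>

definition freq :: "'a set \<Rightarrow> ('a \<Rightarrow> 'b) \<Rightarrow> 'b set \<Rightarrow> real" where
  "freq E g A = card {x\<in>E. g x \<in> A} / card E"

text \<open>The average over times t < n of the images under \<open>f ^^ t\<close> of the uniform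
  distribution on \<open>E\<close>. It is defined on all sets, so a limit needs no
  measurability.\<close>

definition empirical :: "('a \<Rightarrow> 'a) \<Rightarrow> 'a set \<Rightarrow> nat \<Rightarrow> 'a set \<Rightarrow> real" where
  "empirical f E n A = (\<Sum>t<n. freq E (f ^^ t) A) / n"

lemma freq_nonneg: "0 \<le> freq E g A"
  by (simp add: freq_def)

lemma freq_le_1: "finite E \<Longrightarrow> freq E g A \<le> 1"
  by (auto simp: freq_def divide_le_eq_1 card_gt_0_iff intro!: card_mono)

lemma freq_Un:
  assumes "finite E" "A \<inter> B = {}"
  shows "freq E g (A \<union> B) = freq E g A + freq E g B"
proof -
  have "{x\<in>E. g x \<in> A \<union> B} = {x\<in>E. g x \<in> A} \<union> {x\<in>E. g x \<in> B}" by auto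
  moreover have "card ({x\<in>E. g x \<in> A} \<union> {x\<in>E. g x \<in> B}) = card {x\<in>E. g x \<in> A} + card {x\<in>E. g x \<in> B}"
    using assms by (intro card_Un_disjoint) auto
  ultimately show ?thesis by (simp add: freq_def add_divide_distrib)
qed

lemma freq_total:
  assumes "finite E" "E \<noteq> {}" "\<And>x. x \<in> E \<Longrightarrow> g x \<in> A"
  shows "freq E g A = 1"
proof -
  have "{x\<in>E. g x \<in> A} = E" using assms by auto
  with assms show ?thesis by (simp add: freq_def)
qed

lemma empirical_nonneg: "0 \<le> empirical f E n A"
  unfolding empirical_def by (intro divide_nonneg_nonneg sum_nonneg freq_nonneg) auto

lemma empirical_le_1:
  assumes "finite E"
  shows "empirical f E n A \<le> 1"
proof (cases "n = 0")
  case False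
  have "(\<Sum>t<n. freq E (f ^^ t) A) \<le> (\<Sum>t<n. 1)"
    by (intro sum_mono freq_le_1 assms)
  with False show ?thesis by (simp add: empirical_def divide_le_eq_1)
qed (simp add: empirical_def)

lemma empirical_Un:
  assumes "finite E" "A \<inter> B = {}"
  shows "empirical f E n (A \<union> B) = empirical f E n A + empirical f E n B"
  unfolding empirical_def freq_Un[OF assms] by (simp add: sum.distrib add_divide_distrib)

lemma empirical_total:
  assumes "finite E" "E \<noteq> {}" "E \<subseteq> X" "f ` X \<subseteq> X" "0 < n"
  shows "empirical f E n X = 1"
proof -
  have "freq E (f ^^ t) X = 1" for t
    using assms funpow_closed[OF assms(4)] by (intro freq_total) auto
  with assms(5) show ?thesis by (simp add: empirical_def)
qed

text \<open>Shifting time by one changes the average only in its first and last terms.\<close>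

lemma empirical_vimage:
  assumes "finite E" "E \<subseteq> X" "f ` X \<subseteq> X"
  shows "\<bar>empirical f E n (f -` A \<inter> X) - empirical f E n A\<bar> \<le> 1 / n"
proof -
  have "freq E (f ^^ t) (f -` A \<inter> X) = freq E (f ^^ Suc t) A" for t
  proof -
    have "{x\<in>E. (f ^^ t) x \<in> f -` A \<inter> X} = {x\<in>E. (f ^^ Suc t) x \<in> A}"
      using assms funpow_closed[OF assms(3)] by auto
    then show ?thesis by (simp add: freq_def)
  qed
  then have "empirical f E n (f -` A \<inter> X) - empirical f E n A
      = (\<Sum>t<n. freq E (f ^^ Suc t) A - freq E (f ^^ t) A) / n"
    by (simp add: empirical_def sum_subtractf diff_divide_distrib)
  also have "\<dots> = (freq E (f ^^ n) A - freq E (f ^^ 0) A) / n"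
    by (subst sum_lessThan_telescope) simp
  finally have "\<bar>empirical f E n (f -` A \<inter> X) - empirical f E n A\<bar>
      = \<bar>freq E (f ^^ n) A - freq E (f ^^ 0) A\<bar> / n"
    by simp
  also have "\<dots> \<le> 1 / n"
    using freq_nonneg[of E "f ^^ n" A] freq_nonneg[of E "f ^^ 0" A]
      freq_le_1[OF assms(1), of "f ^^ n" A] freq_le_1[OF assms(1), of "f ^^ 0" A]
    by (intro divide_right_mono) linarith+
  finally show ?thesis .
qed

text \<open>By Tychonoff, the sequence has a cluster point in the compact space of all functions from
  sets to \<open>{0..1}\<close>; restricting the sequential filter to its neighbourhoods gives a filter
  along which all the values converge simultaneously.\<close>

lemma simultaneous_limit:
  fixes g :: "nat \<Rightarrow> 'b \<Rightarrow> real"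
  assumes "\<And>n A. g n A \<in> {0..1}"
  obtains F m where "F \<noteq> bot" "F \<le> sequentially" "\<And>A. ((\<lambda>n. g n A) \<longlongrightarrow> m A) F"
proof -
  let ?C = "PiE UNIV (\<lambda>_::'b. {0..1::real})"
  have "compactin (product_topology (\<lambda>_::'b. euclidean :: real topology) UNIV) ?C"
    unfolding compactin_PiE by simp
  then have "compact ?C"
    by (simp add: euclidean_product_topology)
  moreover have "filtermap g sequentially \<noteq> bot" by (simp add: filtermap_bot_iff)
  moreover have "eventually (\<lambda>h. h \<in> ?C) (filtermap g sequentially)"
    unfolding eventually_filtermap by (intro always_eventually allI PiE_I assms) simp
  ultimately obtain m where m: "inf (nhds m) (filtermap g sequentially) \<noteq> bot"
    unfolding compact_filter by blast
  define F where "F = inf sequentially (filtercomap g (nhds m))"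
  show thesis
  proof
    show "F \<noteq> bot"
    proof
      assume "F = bot"
      then have "eventually (\<lambda>_. False) F" by simp
      then obtain P Q where PQ: "eventually P sequentially" "eventually Q (filtercomap g (nhds m))"
        "\<And>n. P n \<Longrightarrow> Q n \<Longrightarrow> False"
        unfolding F_def eventually_inf by auto
      obtain R where R: "eventually R (nhds m)" "\<And>n. R (g n) \<Longrightarrow> Q n"
        using PQ(2) by (auto simp: eventually_filtercomap)
      have "eventually (\<lambda>h. \<not> R h) (filtermap g sequentially)"
        unfolding eventually_filtermap using PQ(1) by (rule eventually_mono) (use PQ(3) R(2) in blast)
      with R(1) have "eventually (\<lambda>_. False) (inf (nhds m) (filtermap g sequentially))"
        unfolding eventually_inf by blast
      with m show False by (simp add: trivial_limit_def)
    qed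
    show "F \<le> sequentially" by (simp add: F_def)
    fix A
    have g: "filterlim g (nhds m) F"
      unfolding F_def filterlim_iff_le_filtercomap by simp
    show "((\<lambda>n. g n A) \<longlongrightarrow> m A) F"
      by (rule continuous_on_tendsto_compose[OF continuous_on_product_coordinates g]) auto
  qed
qed

text \<open>One filter serves all sets simultaneously, so finite additivity passes to the limit, and
  the error 1 / n in the invariance disappears.\<close>

lemma ex_limit_of_empirical:
  fixes f :: "'a::metric_space \<Rightarrow> 'a"
  assumes X: "compact X" and f: "f ` X \<subseteq> X"
    and E: "\<And>n. finite (E n)" "\<And>n. E n \<noteq> {}" "\<And>n. E n \<subseteq> X"
  obtains F m where "F \<noteq> bot" "F \<le> sequentially"
    "\<And>A. ((\<lambda>n. empirical f (E n) n A) \<longlongrightarrow> m A) F"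
    "finitely_additive_prob X m" "\<And>A. m (f -` A \<inter> X) = m A"
proof -
  obtain F m where F: "F \<noteq> bot" "F \<le> sequentially"
    "\<And>A. ((\<lambda>n. empirical f (E n) n A) \<longlongrightarrow> m A) F"
  proof (rule simultaneous_limit[of "\<lambda>n. empirical f (E n) n"])
    show "empirical f (E n) n A \<in> {0..1}" for n A
      by (simp add: empirical_nonneg empirical_le_1[OF E(1)])
  qed (rule that)
  have "finitely_additive_prob X m"
  proof
    show "compact X" by (rule X)
    show "m (A \<union> B) = m A + m B" if "A \<inter> B = {}" for A B
    proof (rule tendsto_unique[OF F(1) F(3)])
      show "((\<lambda>n. empirical f (E n) n (A \<union> B)) \<longlongrightarrow> m A + m B) F"
        unfolding empirical_Un[OF E(1) that] by (intro tendsto_add F(3))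
    qed
    show "0 \<le> m A" for A
      by (rule tendsto_lowerbound[OF F(3) _ F(1)]) (simp add: empirical_nonneg)
    show "m X = 1"
    proof (rule tendsto_unique[OF F(1) F(3)])
      have "eventually (\<lambda>n. (0::nat) < n) F"
        by (rule filter_leD[OF F(2) eventually_gt_at_top])
      then have "eventually (\<lambda>n. empirical f (E n) n X = 1) F"
        by (rule eventually_mono) (intro empirical_total E f)
      then show "((\<lambda>n. empirical f (E n) n X) \<longlongrightarrow> 1) F"
        by (rule tendsto_eventually)
    qed
  qed
  moreover have "m (f -` A \<inter> X) = m A" for A
  proof -
    have "((\<lambda>n. 1 / real n) \<longlongrightarrow> 0) F"
      by (rule tendsto_mono[OF F(2)]) (rule lim_1_over_n)
    then have "((\<lambda>n. empirical f (E n) n (f -` A \<inter> X) - empirical f (E n) n A) \<longlongrightarrow> 0) F"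
      by (rule Lim_null_comparison[rotated])
        (use empirical_vimage[OF E(1,3) f] in \<open>simp add: always_eventually\<close>)
    moreover have "((\<lambda>n. empirical f (E n) n (f -` A \<inter> X) - empirical f (E n) n A)
        \<longlongrightarrow> m (f -` A \<inter> X) - m A) F"
      by (intro tendsto_diff F(3))
    ultimately have "m (f -` A \<inter> X) - m A = 0"
      using tendsto_unique[OF F(1)] by blast
    then show ?thesis by simp
  qed
  ultimately show thesis using that[OF F] by blast
qed

section \<open>Entropy of itineraries under the uniform distribution on a finite set\<close>

lemma simple_function_uniform_count_measure:
  "finite E \<Longrightarrow> simple_function (uniform_count_measure E) g"
  by (auto simp: simple_function_def space_uniform_count_measure sets_uniform_count_measure)

lemma measure_uniform_count_vimage:
  assumes "finite E"
  shows "measure (uniform_count_measure E) (g -` {y} \<inter> E) = freq E g {y}"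
proof -
  have "g -` {y} \<inter> E = {x\<in>E. g x \<in> {y}}" by auto
  with assms show ?thesis
    by (simp add: freq_def measure_uniform_count_measure)
qed

lemma freq_compose: "freq E (\<lambda>x. h (g x)) {y} = freq E g {z. h z = y}"
  by (simp add: freq_def)

lemma ent_uniform_inj:
  assumes "finite E" "E \<noteq> {}" "inj_on g E"
  shows "ent (uniform_count_measure E) g = ln (card E)"
proof -
  have "freq E g {y} = 1 / card E" if "y \<in> g ` E" for y
  proof -
    from that obtain x where x: "x \<in> E" "g x = y" by auto
    with assms(3) have "{x'\<in>E. g x' \<in> {y}} = {x}" by (auto simp: inj_on_def)
    then show ?thesis by (simp add: freq_def)
  qed
  then have "ent (uniform_count_measure E) g = (\<Sum>y\<in>g ` E. eta (1 / card E))"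
    by (simp add: ent_def measure_uniform_count_vimage[OF assms(1)] space_uniform_count_measure)
  also have "\<dots> = card E * eta (1 / card E)"
    using assms by (simp add: card_image)
  also have "\<dots> = ln (card E)"
    using assms by (simp add: eta_def ln_div)
  finally show ?thesis .
qed

text \<open>Writing \<open>T s\<close> for the entropy of the coordinates in \<open>{s..<n}\<close> and
  \<open>h s\<close> for that of the coordinates in \<open>{s..<s + q}\<close>, one has
  \<open>T s \<le> h s + T (s + q)\<close>; summing over \<open>s < n\<close> telescopes to
  \<open>(\<Sum>s<q. T s) \<le> (\<Sum>s<n. h s)\<close>, while \<open>T 0\<close> exceeds \<open>T s\<close> by at most
  \<open>s ln M\<close>.\<close>

lemma misiurewicz_inequality:
  fixes p :: "'a \<Rightarrow> 'b"
  assumes E: "finite E" "E \<noteq> {}" "E \<subseteq> X" and f: "f ` X \<subseteq> X" and p: "finite (p ` X)"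
    and inj: "inj_on (itinerary p f n) E" and "0 < n"
  shows "q * ln (card E) / n \<le> (real q)\<^sup>2 * ln (card (p ` X)) / n
    + (\<Sum>as | set as \<subseteq> p ` X \<and> length as = q. eta (empirical f E n {x. itinerary p f q x = as}))"
proof -
  let ?M = "uniform_count_measure E"
  interpret M: prob_space ?M by (rule prob_space_uniform_count_measure[OF E(1,2)])
  note simple = simple_function_uniform_count_measure[OF E(1)]
  define L where "L l = {as. set as \<subseteq> p ` X \<and> length as = l}" for l
  have L: "finite (L l)" "card (L l) = card (p ` X) ^ l" for l
    unfolding L_def using p by (simp_all add: finite_lists_length_eq card_lists_length_eq)
  have itin_L: "itinerary p f l ((f ^^ t) x) \<in> L l" if "x \<in> E" for l t x
    using that E(3) funpow_closed[OF f, of x t] funpow_closed[OF f, of "(f ^^ t) x"]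
    by (auto simp: L_def itinerary_def)
  have card_pos: "0 < card (p ` X)" using p E by (auto simp: card_gt_0_iff)
  define T where "T s = ent ?M (\<lambda>x. itinerary p f (n - s) ((f ^^ s) x))" for s
  define h where "h s = ent ?M (\<lambda>x. itinerary p f q ((f ^^ s) x))" for s
  have shift: "p ((f ^^ j) ((f ^^ s) x)) = p ((f ^^ (j + s)) x)" for j s x
    by (simp add: funpow_add)
  have T_step: "T s \<le> h s + T (s + q)" for s
  proof -
    have "T s \<le> ent ?M (\<lambda>x. (itinerary p f q ((f ^^ s) x), itinerary p f (n - (s + q)) ((f ^^ (s + q)) x)))"
      unfolding T_def
    proof (rule M.ent_le_of_determined[OF simple simple])
      fix x y
      assume "(itinerary p f q ((f ^^ s) x), itinerary p f (n - (s + q)) ((f ^^ (s + q)) x)) =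
        (itinerary p f q ((f ^^ s) y), itinerary p f (n - (s + q)) ((f ^^ (s + q)) y))"
      then have 1: "\<And>j. j < q \<Longrightarrow> p ((f ^^ (j + s)) x) = p ((f ^^ (j + s)) y)"
        and 2: "\<And>j. j < n - (s + q) \<Longrightarrow> p ((f ^^ (j + (s + q))) x) = p ((f ^^ (j + (s + q))) y)"
        by (simp_all only: prod.inject itinerary_eq_iff shift)
      show "itinerary p f (n - s) ((f ^^ s) x) = itinerary p f (n - s) ((f ^^ s) y)"
        unfolding itinerary_eq_iff shift
      proof (intro allI impI)
        fix j assume "j < n - s"
        then show "p ((f ^^ (j + s)) x) = p ((f ^^ (j + s)) y)"
          using 1[of j] 2[of "j - q"] by (cases "j < q") auto
      qed
    qed
    also have "\<dots> \<le> h s + T (s + q)"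
      unfolding T_def h_def by (rule M.ent_Pair_le[OF simple simple])
    finally show ?thesis .
  qed
  \<comment> \<open>Truncated subtraction leaves the empty word as the only itinerary once s \<ge>
    n; this permits summing up to n + q below.\<close>
  have T_zero: "T s = 0" if "n \<le> s" for s
  proof -
    have "T s \<le> ln (card {[] :: 'b list})"
      unfolding T_def using that by (intro M.ent_le_ln_card[OF simple]) (auto simp: itinerary_def)
    moreover have "0 \<le> T s" unfolding T_def by (rule M.ent_nonneg)
    ultimately show ?thesis by simp
  qed
  have T0: "T 0 \<le> s * ln (card (p ` X)) + T s" for s
  proof -
    have "T 0 \<le> ent ?M (\<lambda>x. (itinerary p f s x, itinerary p f (n - s) ((f ^^ s) x)))"
      unfolding T_def
    proof (rule M.ent_le_of_determined[OF simple simple])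
      fix x y
      assume "(itinerary p f s x, itinerary p f (n - s) ((f ^^ s) x)) =
        (itinerary p f s y, itinerary p f (n - s) ((f ^^ s) y))"
      then have 1: "\<And>j. j < s \<Longrightarrow> p ((f ^^ j) x) = p ((f ^^ j) y)"
        and 2: "\<And>j. j < n - s \<Longrightarrow> p ((f ^^ (j + s)) x) = p ((f ^^ (j + s)) y)"
        by (simp_all only: prod.inject itinerary_eq_iff shift)
      show "itinerary p f (n - 0) ((f ^^ 0) x) = itinerary p f (n - 0) ((f ^^ 0) y)"
        unfolding itinerary_eq_iff shift
      proof (intro allI impI)
        fix j assume "j < n - 0"
        then show "p ((f ^^ (j + 0)) x) = p ((f ^^ (j + 0)) y)"
          using 1[of j] 2[of "j - s"] by (cases "j < s") auto
      qed
    qed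
    also have "\<dots> \<le> ent ?M (itinerary p f s) + T s"
      unfolding T_def by (rule M.ent_Pair_le[OF simple simple])
    also have "ent ?M (itinerary p f s) \<le> ln (card (L s))"
      using itin_L[of _ s 0]
      by (intro M.ent_le_ln_card[OF simple L(1)] AE_I2) (simp add: space_uniform_count_measure)
    also have "\<dots> = s * ln (card (p ` X))"
      using card_pos by (simp add: L(2) ln_realpow)
    finally show ?thesis by simp
  qed
  have "(\<Sum>s<n. T s) \<le> (\<Sum>s<n. h s) + (\<Sum>s<n. T (s + q))"
    unfolding sum.distrib[symmetric] by (intro sum_mono T_step)
  moreover have "(\<Sum>s<n. T s) = (\<Sum>s<n + q. T s)"
    by (intro sum.mono_neutral_left) (auto intro: T_zero)
  moreover have "(\<Sum>s<n + q. T s) = (\<Sum>s<q. T s) + (\<Sum>s<n. T (s + q))"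
  proof -
    have "(\<Sum>s<n + q. T s) = (\<Sum>s<q. T s) + (\<Sum>s=q..<n + q. T s)"
      by (subst sum.atLeastLessThan_concat[of 0 q "n + q", symmetric, unfolded atLeast0LessThan]) simp_all
    also have "(\<Sum>s=q..<n + q. T s) = (\<Sum>s<n. T (s + q))"
      using sum.shift_bounds_nat_ivl[of T 0 q n] by (simp add: atLeast0LessThan)
    finally show ?thesis .
  qed
  ultimately have "(\<Sum>s<q. T s) \<le> (\<Sum>s<n. h s)" by linarith
  \<comment> \<open>Each of the \<open>q\<close> shifts loses at most q times the logarithm, the
    source of the square.\<close>
  moreover have "q * T 0 \<le> (\<Sum>s<q. q * ln (card (p ` X)) + T s)"
  proof -
    have "q * T 0 = (\<Sum>s<q. T 0)" by simp
    also have "\<dots> \<le> (\<Sum>s<q. q * ln (card (p ` X)) + T s)"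
    proof (rule sum_mono)
      fix s assume "s \<in> {..<q}"
      have "s * ln (card (p ` X)) \<le> q * ln (card (p ` X))"
        using \<open>s \<in> {..<q}\<close> card_pos by (intro mult_right_mono) auto
      with T0[of s] show "T 0 \<le> q * ln (card (p ` X)) + T s" by linarith
    qed
    finally show ?thesis .
  qed
  moreover have "(\<Sum>s<q. q * ln (card (p ` X)) + T s) = (real q)\<^sup>2 * ln (card (p ` X)) + (\<Sum>s<q. T s)"
    by (simp add: sum.distrib power2_eq_square)
  moreover have "T 0 = ln (card E)"
    unfolding T_def using ent_uniform_inj[OF E(1,2) inj] by simp
  ultimately have main: "q * ln (card E) \<le> (real q)\<^sup>2 * ln (card (p ` X)) + (\<Sum>s<n. h s)"
    by simp
  have h_eq: "h s = (\<Sum>as\<in>L q. eta (freq E (f ^^ s) {x. itinerary p f q x = as}))" for s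
  proof -
    have "h s = (\<Sum>as\<in>L q. eta (freq E (\<lambda>x. itinerary p f q ((f ^^ s) x)) {as}))"
      unfolding h_def
      by (subst ent_eq_sum[OF L(1)[of q]])
        (auto simp: itin_L space_uniform_count_measure measure_uniform_count_vimage[OF E(1)])
    then show ?thesis by (simp only: freq_compose)
  qed
  have "(\<Sum>s<n. h s) / n = (\<Sum>as\<in>L q. \<Sum>s<n. (1 / n) * eta (freq E (f ^^ s) {x. itinerary p f q x = as}))"
    unfolding h_eq by (subst sum.swap) (simp add: sum_divide_distrib sum_distrib_left)
  also have "\<dots> \<le> (\<Sum>as\<in>L q. eta (empirical f E n {x. itinerary p f q x = as}))"
  proof (rule sum_mono)
    fix as
    \<comment> \<open>Concavity replaces the mean entropy over the starting times by the entropy of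
      the averaged measure.\<close>
    have "(\<Sum>s<n. (1 / n) * eta (freq E (f ^^ s) {x. itinerary p f q x = as}))
        \<le> eta (\<Sum>s<n. (1 / n) * freq E (f ^^ s) {x. itinerary p f q x = as})"
      using \<open>0 < n\<close> by (intro eta_concave_sum) (auto simp: freq_nonneg)
    then show "(\<Sum>s<n. (1 / n) * eta (freq E (f ^^ s) {x. itinerary p f q x = as}))
        \<le> eta (empirical f E n {x. itinerary p f q x = as})"
      by (simp add: empirical_def sum_divide_distrib)
  qed
  finally have "(\<Sum>s<n. h s) / n \<le> (\<Sum>as\<in>L q. eta (empirical f E n {x. itinerary p f q x = as}))" .
  moreover have "q * ln (card E) / n \<le> ((real q)\<^sup>2 * ln (card (p ` X)) + (\<Sum>s<n. h s)) / n"
    using main by (intro divide_right_mono) auto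
  ultimately show ?thesis by (simp add: add_divide_distrib L_def)
qed

section \<open>Separated sets and the lower bound\<close>

lemma empirical_Int:
  assumes "E \<subseteq> X" "f ` X \<subseteq> X"
  shows "empirical f E n (A \<inter> X) = empirical f E n A"
proof -
  have "{x\<in>E. (f ^^ t) x \<in> A \<inter> X} = {x\<in>E. (f ^^ t) x \<in> A}" for t
    using assms funpow_closed[OF assms(2)] by auto
  then show ?thesis by (simp add: empirical_def freq_def)
qed

lemma (in finitely_additive_prob) sum_UN:
  assumes "finite I" "\<And>i. i \<in> I \<Longrightarrow> A i \<subseteq> X" "disjoint_family_on A I"
  shows "m (\<Union>i\<in>I. A i) = (\<Sum>i\<in>I. m (A i))"
  using assms
proof (induction I rule: finite_induct)
  case (insert i I)
  have "m (A i \<union> (\<Union>i\<in>I. A i)) = m (A i) + m (\<Union>i\<in>I. A i)"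
    using insert.prems insert.hyps by (intro add) (auto simp: disjoint_family_on_def)
  moreover have "m (\<Union>i\<in>I. A i) = (\<Sum>i\<in>I. m (A i))"
    using insert.prems by (intro insert.IH) (auto simp: disjoint_family_on_def)
  ultimately show ?case using insert.hyps by simp
qed (simp add: empty)

text \<open>Spheres of different radii are fibres of the distance function, whose image measure has
  only countably many atoms.\<close>

lemma ex_null_sphere:
  fixes X :: "'a::metric_space set"
  assumes \<mu>: "borel_prob_on X \<mu>" and "a < b"
  obtains r where "a < r" "r < b" "{y\<in>X. dist x y = r} \<in> null_sets \<mu>"
proof -
  interpret prob_space \<mu> using \<mu> by (simp add: borel_prob_on_def)
  have sp: "space \<mu> = X" by (rule borel_prob_on_space[OF \<mu>])
  have "(\<lambda>y. dist x y) \<in> borel_measurable (restrict_space borel X)"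
    by (intro borel_measurable_continuous_on_restrict continuous_intros)
  moreover have "sets \<mu> = sets (restrict_space borel X)"
    using \<mu> by (simp add: borel_prob_on_def)
  ultimately have meas: "(\<lambda>y. dist x y) \<in> borel_measurable \<mu>"
    using measurable_cong_sets by blast
  interpret D: prob_space "distr \<mu> borel (\<lambda>y. dist x y)"
    by (rule prob_space_distr[OF meas])
  have "countable {r. measure (distr \<mu> borel (\<lambda>y. dist x y)) {r} \<noteq> 0}"
    by (rule D.countable_support)
  moreover have "uncountable {a<..<b}"
    using \<open>a < b\<close> by (simp add: uncountable_open_interval)
  ultimately have "\<not> {a<..<b} \<subseteq> {r. measure (distr \<mu> borel (\<lambda>y. dist x y)) {r} \<noteq> 0}"
    using countable_subset by metis
  then obtain r where r: "r \<in> {a<..<b}" "measure (distr \<mu> borel (\<lambda>y. dist x y)) {r} = 0"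
    by (auto simp only: subset_iff mem_Collect_eq)
  have "(\<lambda>y. dist x y) -` {r} \<inter> space \<mu> = {y\<in>X. dist x y = r}"
    by (auto simp: sp)
  then have "measure \<mu> {y\<in>X. dist x y = r} = 0" "{y\<in>X. dist x y = r} \<in> sets \<mu>"
    using r(2) measure_distr[OF meas, of "{r}"] measurable_sets[OF meas, of "{r}"] by simp_all
  then have "{y\<in>X. dist x y = r} \<in> null_sets \<mu>"
    by (intro null_setsI) (simp_all add: emeasure_eq_measure)
  with r(1) show thesis using that[of r] by simp
qed

text \<open>Label a point by the first ball containing it, in a finite cover by balls with null
  spheres. Off these spheres membership in each ball is locally constant; this replaces the usual
  requirement of null boundaries.\<close>

lemma ex_small_partition:
  fixes X :: "'a::metric_space set"
  assumes \<mu>: "borel_prob_on X \<mu>" and X: "compact X" and "0 < \<delta>"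
  obtains p :: "'a \<Rightarrow> nat" and Z where "simple_function \<mu> p" "Z \<in> null_sets \<mu>"
    "\<And>x y. x \<in> X \<Longrightarrow> y \<in> X \<Longrightarrow> p x = p y \<Longrightarrow> dist x y < \<delta>"
    "\<And>x. x \<in> X - Z \<Longrightarrow> \<exists>T. openin (top_of_set X) T \<and> x \<in> T \<and> (\<forall>y\<in>T. p y = p x)"
proof -
  have quarter: "\<delta> / 4 < \<delta> / 2" using \<open>0 < \<delta>\<close> by simp
  \<comment> \<open>The upper bound makes cells smaller than \<delta>; the lower one keeps the radii
    positive.\<close>
  have "\<forall>x. \<exists>r. \<delta> / 4 < r \<and> r < \<delta> / 2 \<and> {y\<in>X. dist x y = r} \<in> null_sets \<mu>"
  proof
    fix x
    show "\<exists>r. \<delta> / 4 < r \<and> r < \<delta> / 2 \<and> {y\<in>X. dist x y = r} \<in> null_sets \<mu>"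
      by (rule ex_null_sphere[OF \<mu> quarter, of x]) blast
  qed
  from choice[OF this] obtain r where r: "\<And>x. \<delta> / 4 < r x" "\<And>x. r x < \<delta> / 2"
    "\<And>x. {y\<in>X. dist x y = r x} \<in> null_sets \<mu>"
    by blast
  have rpos: "0 < r x" for x using r(1)[of x] \<open>0 < \<delta>\<close> by linarith
  have "X \<subseteq> (\<Union>x\<in>X. ball x (r x))" using rpos by auto
  then obtain Y where Y: "finite Y" "X \<subseteq> (\<Union>x\<in>Y. ball x (r x))"
    using compactE_image[OF X, of X "\<lambda>x. ball x (r x)"] by (metis open_ball)
  obtain cs where cs: "set cs = Y" using finite_list[OF Y(1)] by blast
  define B where "B i = ball (cs ! i) (r (cs ! i))" for i
  define p where "p x = (LEAST i. i < length cs \<and> x \<in> B i)" for x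
  have ex: "\<exists>i<length cs. x \<in> B i" if x: "x \<in> X" for x
  proof -
    obtain c where c: "c \<in> Y" "x \<in> ball c (r c)" using Y(2) x by blast
    then obtain i where "i < length cs" "cs ! i = c" using cs by (auto simp: in_set_conv_nth)
    with c show ?thesis by (auto simp: B_def)
  qed
  have p: "p x < length cs" "x \<in> B (p x)" if "x \<in> X" for x
    using LeastI_ex[OF ex[OF that]] by (simp_all add: p_def)
  have p_eq: "p x = i" if "i < length cs" "x \<in> B i" "\<And>j. j < i \<Longrightarrow> x \<notin> B j" for x i
    unfolding p_def using that by (intro Least_equality) (auto simp: not_less[symmetric])
  have p_less: "x \<notin> B j" if "x \<in> X" "j < p x" for x j
    using not_less_Least[of j "\<lambda>i. i < length cs \<and> x \<in> B i"] that p(1)[OF that(1)]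
    unfolding p_def by auto
  define Z where "Z = (\<Union>c\<in>Y. {y\<in>X. dist c y = r c})"
  show thesis
  proof
    show "Z \<in> null_sets \<mu>"
      unfolding Z_def using Y(1) r(3) by (intro null_sets_UN' countable_finite) auto
    show "simple_function \<mu> p"
      unfolding simple_function_def borel_prob_on_space[OF \<mu>]
    proof (intro conjI ballI)
      show "finite (p ` X)"
        by (rule finite_subset[of _ "{..<length cs}"]) (use p in auto)
      fix i assume "i \<in> p ` X"
      then have i: "i < length cs" using p by auto
      have "p -` {i} \<inter> X = X \<inter> (B i - (\<Union>j<i. B j))"
      proof (intro set_eqI iffI)
        fix x assume "x \<in> p -` {i} \<inter> X"
        then have x: "x \<in> X" "p x = i" by auto
        then show "x \<in> X \<inter> (B i - (\<Union>j<i. B j))"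
          using p(2)[OF x(1)] p_less[OF x(1)] by simp
      next
        fix x assume "x \<in> X \<inter> (B i - (\<Union>j<i. B j))"
        then show "x \<in> p -` {i} \<inter> X" using p_eq[OF i, of x] by simp
      qed
      moreover have "B i - (\<Union>j<i. B j) \<in> sets borel"
        by (auto simp: B_def)
      ultimately show "p -` {i} \<inter> X \<in> sets \<mu>"
        unfolding borel_prob_on_sets[OF \<mu>] by blast
    qed
    show "dist x y < \<delta>" if "x \<in> X" "y \<in> X" "p x = p y" for x y
    proof -
      have "dist (cs ! p x) x < r (cs ! p x)" "dist (cs ! p x) y < r (cs ! p x)"
        using p(2)[OF that(1)] p(2)[OF that(2)] that(3) by (simp_all add: B_def)
      then show ?thesis
        using dist_triangle3[of x y "cs ! p x"] r(2)[of "cs ! p x"] by linarith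
    qed
    fix x assume x: "x \<in> X - Z"
    define T where "T = X \<inter> (B (p x) \<inter> (\<Inter>j<p x. - cball (cs ! j) (r (cs ! j))))"
    have "openin (top_of_set X) T"
      unfolding T_def B_def by (intro openin_open_Int open_Int open_INT) auto
    moreover have "x \<in> T"
    proof -
      have "x \<notin> cball (cs ! j) (r (cs ! j))" if j: "j < p x" for j
      proof -
        have "j < length cs" using j p(1)[of x] x by auto
        then have "cs ! j \<in> Y" using cs by auto
        then have "dist (cs ! j) x \<noteq> r (cs ! j)" using x by (auto simp: Z_def)
        moreover have "x \<notin> B j" using p_less[OF _ j] x by auto
        ultimately show ?thesis by (simp add: B_def)
      qed
      then show ?thesis using x p(2)[of x] by (auto simp: T_def)
    qed
    moreover have "p y = p x" if "y \<in> T" for y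
    proof (rule p_eq)
      show "p x < length cs" using p(1)[of x] x by auto
      show "y \<in> B (p x)" using that by (simp add: T_def)
      show "y \<notin> B j" if "j < p x" for j
      proof -
        have "y \<notin> cball (cs ! j) (r (cs ! j))" using \<open>y \<in> T\<close> that by (auto simp: T_def)
        then show ?thesis by (simp add: B_def)
      qed
    qed
    ultimately show "\<exists>T. openin (top_of_set X) T \<and> x \<in> T \<and> (\<forall>y\<in>T. p y = p x)"
      by blast
  qed
qed

section \<open>Separated sets, spanning sets and Lebesgue numbers\<close>

definition separated :: "('a::metric_space \<Rightarrow> 'a) \<Rightarrow> real \<Rightarrow> nat \<Rightarrow> 'a set \<Rightarrow> bool" where
  "separated f \<delta> n E \<longleftrightarrow> (\<forall>x\<in>E. \<forall>y\<in>E. x \<noteq> y \<longrightarrow> (\<exists>j<n. \<delta> \<le> dist ((f ^^ j) x) ((f ^^ j) y)))"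

lemma separated_inj_on_itinerary:
  assumes "separated f \<delta> n E" "E \<subseteq> X" "f ` X \<subseteq> X"
    and "\<And>x y. x \<in> X \<Longrightarrow> y \<in> X \<Longrightarrow> p x = p y \<Longrightarrow> dist x y < \<delta>"
  shows "inj_on (itinerary p f n) E"
proof (rule inj_onI, rule ccontr)
  fix x y assume xy: "x \<in> E" "y \<in> E" "itinerary p f n x = itinerary p f n y" "x \<noteq> y"
  then obtain j where j: "j < n" "\<delta> \<le> dist ((f ^^ j) x) ((f ^^ j) y)"
    using assms(1) by (auto simp: separated_def)
  have "p ((f ^^ j) x) = p ((f ^^ j) y)" using xy(3) j(1) by (simp add: itinerary_eq_iff)
  moreover have "(f ^^ j) x \<in> X" "(f ^^ j) y \<in> X"
    using xy(1,2) assms(2) funpow_closed[OF assms(3)] by auto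
  ultimately show False using assms(4) j(2) by fastforce
qed

text \<open>Itineraries for a fine labelling are injective on separated sets, which bounds their
  cardinality, so a largest one exists. A point far from all its members could be added, hence it
  spans.\<close>

lemma ex_maximal_separated:
  fixes X :: "'a::metric_space set"
  assumes X: "compact X" "X \<noteq> {}" and f: "f ` X \<subseteq> X" and "0 < \<delta>"
  obtains E where "E \<subseteq> X" "finite E" "E \<noteq> {}" "separated f \<delta> n E"
    "\<And>z. z \<in> X \<Longrightarrow> \<exists>x\<in>E. \<forall>j<n. dist ((f ^^ j) x) ((f ^^ j) z) < \<delta>"
proof -
  have "X \<subseteq> (\<Union>x\<in>X. ball x (\<delta> / 2))" using \<open>0 < \<delta>\<close> by auto
  then obtain Y where Y: "finite Y" "X \<subseteq> (\<Union>x\<in>Y. ball x (\<delta> / 2))"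
    using compactE_image[OF X(1), of X "\<lambda>x. ball x (\<delta> / 2)"] by (metis open_ball)
  then have "\<forall>x\<in>X. \<exists>c\<in>Y. dist c x < \<delta> / 2" by fastforce
  then obtain p where p: "\<And>x. x \<in> X \<Longrightarrow> p x \<in> Y" "\<And>x. x \<in> X \<Longrightarrow> dist (p x) x < \<delta> / 2"
    by metis
  have p_dist: "dist x y < \<delta>" if "x \<in> X" "y \<in> X" "p x = p y" for x y
    using p(2)[OF that(1)] p(2)[OF that(2)] that(3) dist_triangle3[of x y "p x"] by simp
  let ?L = "{as. set as \<subseteq> Y \<and> length as = n}"
  have L: "finite ?L" by (rule finite_lists_length_eq[OF Y(1)])
  have bound: "finite E \<and> card E \<le> card ?L" if E: "E \<subseteq> X" "separated f \<delta> n E" for E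
  proof -
    have inj: "inj_on (itinerary p f n) E"
      by (rule separated_inj_on_itinerary[OF E(2,1) f p_dist])
    have "p ((f ^^ j) x) \<in> Y" if "x \<in> E" for x j
      by (rule p(1)[OF funpow_closed[OF f subsetD[OF E(1) that]]])
    then have "itinerary p f n ` E \<subseteq> ?L"
      by (auto simp: itinerary_def)
    then show ?thesis
      using inj_on_finite[OF inj _ L] card_inj_on_le[OF inj _ L] by blast
  qed
  define P where "P E \<longleftrightarrow> E \<subseteq> X \<and> separated f \<delta> n E" for E
  have "P {}" by (simp add: P_def separated_def)
  moreover have "\<forall>E. P E \<longrightarrow> card E < Suc (card ?L)"
    unfolding P_def less_Suc_eq_le using bound by blast
  ultimately have "\<exists>E. P E \<and> (\<forall>E'. P E' \<longrightarrow> card E' \<le> card E)"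
    by (rule ex_has_greatest_nat)
  then obtain E where E: "E \<subseteq> X" "separated f \<delta> n E" "\<And>E'. E' \<subseteq> X \<Longrightarrow> separated f \<delta> n E' \<Longrightarrow> card E' \<le> card E"
    unfolding P_def by blast
  have fin: "finite E" using bound[OF E(1,2)] by simp
  have cover: "\<exists>x\<in>E. \<forall>j<n. dist ((f ^^ j) x) ((f ^^ j) z) < \<delta>" if z: "z \<in> X" for z
  proof (rule ccontr)
    assume "\<not> ?thesis"
    then have far: "\<exists>j<n. \<delta> \<le> dist ((f ^^ j) x) ((f ^^ j) z)" if "x \<in> E" for x
      using that by (meson not_less)
    have "z \<notin> E" using far[of z] \<open>0 < \<delta>\<close> by auto
    moreover have "separated f \<delta> n (insert z E)"
      unfolding separated_def
    proof (intro ballI impI)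
      fix x y assume "x \<in> insert z E" "y \<in> insert z E" "x \<noteq> y"
      then consider "x \<in> E" "y \<in> E" | "x = z" "y \<in> E" | "x \<in> E" "y = z" by blast
      then show "\<exists>j<n. \<delta> \<le> dist ((f ^^ j) x) ((f ^^ j) y)"
      proof cases
        case 1
        with E(2) \<open>x \<noteq> y\<close> show ?thesis unfolding separated_def by blast
      next
        case 2
        with far[of y] show ?thesis by (simp only: dist_commute)
      next
        case 3
        with far[of x] show ?thesis by simp
      qed
    qed
    ultimately show False using E(3)[of "insert z E"] E(1) z fin by simp
  qed
  from X(2) cover have ne: "E \<noteq> {}" by blast
  show thesis by (rule that[OF E(1) fin ne E(2) cover])
qed

text \<open>Bowen balls of \<open>f\<close> refine the cover iterated under \<open>\<phi>\<close>:
  by the Lebesgue number property each time step stays in one member of the cover, and preimages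
  under \<open>f\<close> lie inside those under \<open>\<phi>\<close>.\<close>

lemma min_subcover_card_le_card_spanning:
  assumes "multimap_on X \<phi>" "lsc_on X \<phi>" "open_cover X \<A>"
    and f: "f ` X \<subseteq> X" "\<And>x. x \<in> X \<Longrightarrow> f x \<in> \<phi> x"
    and leb: "\<And>x. x \<in> X \<Longrightarrow> \<exists>A\<in>\<A>. ball x \<delta> \<inter> X \<subseteq> A"
    and E: "finite E" "E \<subseteq> X" "\<And>z. z \<in> X \<Longrightarrow> \<exists>x\<in>E. \<forall>j<n. dist ((f ^^ j) x) ((f ^^ j) z) < \<delta>"
  shows "min_subcover_card X (cover_iter X \<phi> \<A> n) \<le> card E"
proof -
  let ?b = "\<lambda>x. {z\<in>X. \<forall>j<n. dist ((f ^^ j) x) ((f ^^ j) z) < \<delta>}"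
  have "min_subcover_card X (cover_iter X \<phi> \<A> n) \<le> card (?b ` E)"
  proof (rule min_subcover_card_le_card[OF open_cover_cover_iter[OF assms(1-3)]])
    show "finite (?b ` E)" using E(1) by simp
    show "X \<subseteq> \<Union>(?b ` E)" using E(3) by auto
    fix S assume "S \<in> ?b ` E" "S \<noteq> {}"
    then obtain x where x: "x \<in> X" "S = ?b x" using E(2) by auto
    have "\<forall>j. \<exists>A\<in>\<A>. ball ((f ^^ j) x) \<delta> \<inter> X \<subseteq> A"
      using leb funpow_closed[OF f(1) x(1)] by blast
    then obtain Q where Q: "\<And>j. Q j \<in> \<A>" "\<And>j. ball ((f ^^ j) x) \<delta> \<inter> X \<subseteq> Q j" by metis
    have "S \<subseteq> X \<inter> (\<Inter>j<n. iter_preimage X \<phi> j (Q j))"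
    proof
      fix z assume "z \<in> S"
      then have z: "z \<in> X" "\<And>j. j < n \<Longrightarrow> dist ((f ^^ j) x) ((f ^^ j) z) < \<delta>"
        unfolding x(2) by auto
      have "z \<in> iter_preimage X \<phi> j (Q j)" if j: "j < n" for j
      proof -
        have "(f ^^ j) z \<in> ball ((f ^^ j) x) \<delta> \<inter> X"
          using z j funpow_closed[OF f(1) z(1)] by simp
        then have "z \<in> (f ^^ j) -` Q j \<inter> X" using Q(2)[of j] z(1) by blast
        then show ?thesis using funpow_vimage_subset_iter_preimage[OF f] by blast
      qed
      with z(1) show "z \<in> X \<inter> (\<Inter>j<n. iter_preimage X \<phi> j (Q j))" by blast
    qed
    moreover from this have "X \<inter> (\<Inter>j<n. iter_preimage X \<phi> j (Q j)) \<in> cover_iter X \<phi> \<A> n"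
      using \<open>S \<noteq> {}\<close> by (intro cover_iterI Q(1)) blast
    ultimately show "\<exists>C\<in>cover_iter X \<phi> \<A> n. S \<subseteq> C" by blast
  qed
  also have "\<dots> \<le> card E" using E(1) by (rule card_image_le)
  finally show ?thesis .
qed

lemma ex_lebesgue_number:
  assumes "compact X" "open_cover X \<A>"
  obtains \<delta> where "0 < \<delta>" "\<And>x. x \<in> X \<Longrightarrow> \<exists>A\<in>\<A>. ball x \<delta> \<inter> X \<subseteq> A"
proof -
  let ?G = "{T. open T \<and> X \<inter> T \<in> \<A>}"
  have "X \<subseteq> \<Union>?G"
  proof
    fix x assume "x \<in> X"
    then obtain A where "A \<in> \<A>" "x \<in> A" using assms(2) by (auto simp: open_cover_def)
    moreover from this assms(2) obtain T where "open T" "A = X \<inter> T"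
      by (auto simp: open_cover_def openin_open)
    ultimately show "x \<in> \<Union>?G" by auto
  qed
  then obtain \<delta> where \<delta>: "0 < \<delta>" "\<And>x. x \<in> X \<Longrightarrow> \<exists>T\<in>?G. ball x \<delta> \<subseteq> T"
    by (rule Heine_Borel_lemma[OF assms(1)]) auto
  have "\<exists>A\<in>\<A>. ball x \<delta> \<inter> X \<subseteq> A" if x: "x \<in> X" for x
  proof -
    obtain T where "T \<in> ?G" "ball x \<delta> \<subseteq> T" using \<delta>(2)[OF x] by blast
    then show ?thesis by (intro bexI[of _ "X \<inter> T"]) auto
  qed
  with \<delta>(1) show thesis by (rule that)
qed

context preserved_selection
begin

text \<open>The hypothesis compares the measures only on open sets. By local constancy and
  continuity a cell agrees with its interior up to the null set of points that reach
  \<open>Z\<close> within \<open>q\<close> steps.\<close>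

lemma itinerary_cells_le_limit:
  assumes m: "finitely_additive_prob X m"
    and \<mu>_inner: "\<And>U. openin (top_of_set X) U \<Longrightarrow> measure \<mu> U \<le> m U"
    and p: "simple_function \<mu> p" and Z: "Z \<in> null_sets \<mu>"
    and loc: "\<And>x. x \<in> X - Z \<Longrightarrow> \<exists>T. openin (top_of_set X) T \<and> x \<in> T \<and> (\<forall>y\<in>T. p y = p x)"
  shows "measure \<mu> (itinerary p f q -` {as} \<inter> X) \<le> m (itinerary p f q -` {as} \<inter> X)"
proof -
  interpret m: finitely_additive_prob X m by (rule m)
  let ?A = "itinerary p f q -` {as} \<inter> X"
  have A: "?A \<in> sets \<mu>"
    using simple_functionD(2)[OF simple_function_itinerary[OF p f_measurable]]
    by (simp add: space_\<mu>)
  define N where "N = (\<Union>j<q. (f ^^ j) -` Z \<inter> X)"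
  have "(f ^^ j) -` Z \<inter> X \<in> null_sets \<mu>" for j
  proof (rule null_setsI)
    have "emeasure \<mu> ((f ^^ j) -` Z \<inter> space \<mu>) = emeasure (distr \<mu> \<mu> (f ^^ j)) Z"
      using Z by (intro emeasure_distr[symmetric] funpow_measurable) auto
    then show "emeasure \<mu> ((f ^^ j) -` Z \<inter> X) = 0"
      by (simp only: distr_funpow null_setsD1[OF Z] space_\<mu>)
    show "(f ^^ j) -` Z \<inter> X \<in> sets \<mu>"
      using measurable_sets[OF funpow_measurable null_setsD2[OF Z], of j] by (simp add: space_\<mu>)
  qed
  then have N: "N \<in> null_sets \<mu>" unfolding N_def by (intro null_sets_UN') auto
  have cont: "continuous_on X (f ^^ j)" for j
  proof (induction j)
    case (Suc j)
    have "(f ^^ j) ` X \<subseteq> X" using funpow_closed[OF f_image] by auto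
    then show ?case
      using continuous_on_compose[OF Suc continuous_on_subset[OF f_cont]] by simp
  qed (simp add: id_def)
  \<comment> \<open>The interior of the cell relative to \<open>X\<close>.\<close>
  define V where "V = \<Union>{U. openin (top_of_set X) U \<and> U \<subseteq> ?A}"
  have V: "openin (top_of_set X) V" "V \<subseteq> ?A" unfolding V_def by (rule openin_Union) auto
  have "?A - N \<subseteq> V"
  proof
    fix x assume x: "x \<in> ?A - N"
    have "\<forall>j. \<exists>T. j < q \<longrightarrow> openin (top_of_set X) T \<and> (f ^^ j) x \<in> T \<and> (\<forall>y\<in>T. p y = p ((f ^^ j) x))"
    proof
      fix j
      show "\<exists>T. j < q \<longrightarrow> openin (top_of_set X) T \<and> (f ^^ j) x \<in> T \<and> (\<forall>y\<in>T. p y = p ((f ^^ j) x))"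
      proof (cases "j < q")
        case True
        with x have "(f ^^ j) x \<in> X - Z"
          using funpow_closed[OF f_image, of x j] by (auto simp: N_def)
        from loc[OF this] show ?thesis by blast
      qed simp
    qed
    then obtain T where T: "\<And>j. j < q \<Longrightarrow> openin (top_of_set X) (T j)"
      "\<And>j. j < q \<Longrightarrow> (f ^^ j) x \<in> T j" "\<And>j y. j < q \<Longrightarrow> y \<in> T j \<Longrightarrow> p y = p ((f ^^ j) x)"
      by metis
    let ?W = "X \<inter> (\<Inter>j<q. X \<inter> (f ^^ j) -` T j)"
    have "openin (top_of_set X) ?W"
    proof (rule openin_INT_lessThan)
      fix j assume "j < q"
      then show "openin (top_of_set X) (X \<inter> (f ^^ j) -` T j)"
        using funpow_closed[OF f_image] by (intro continuous_openin_preimage[OF cont _ T(1)]) auto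
    qed
    moreover have "?W \<subseteq> ?A"
    proof
      fix y assume y: "y \<in> ?W"
      have "itinerary p f q y = itinerary p f q x"
        unfolding itinerary_eq_iff
      proof (intro allI impI)
        fix j assume j: "j < q"
        then have "(f ^^ j) y \<in> T j" using y by blast
        then show "p ((f ^^ j) y) = p ((f ^^ j) x)" by (rule T(3)[OF j])
      qed
      with x y show "y \<in> ?A" by auto
    qed
    moreover have "x \<in> ?W" using x T(2) by blast
    ultimately show "x \<in> V" unfolding V_def by blast
  qed
  have "measure \<mu> ?A = measure \<mu> (?A - N)"
    using measure_Diff_null_set[OF A N] by simp
  also have "\<dots> \<le> measure \<mu> V"
    using \<open>?A - N \<subseteq> V\<close> borel_prob_on_openin[OF \<mu>_prob V(1)] by (rule finite_measure_mono)
  also have "\<dots> \<le> m V" by (rule \<mu>_inner[OF V(1)])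
  also have "\<dots> \<le> m ?A" using V(2) by (intro m.mono) auto
  finally show ?thesis .
qed

end

text \<open>The fibres of \<open>p\<close>, listed in the order of their labels, form an ordered
  partition whose index determines \<open>p\<close>. The lower bound holds at every length, so it
  passes to the limit superior.\<close>

lemma (in preserved_selection) metric_entropy_ge_of_itineraries:
  fixes p :: "'a \<Rightarrow> nat"
  assumes p: "simple_function \<mu> p" and ge: "\<And>q. q * h \<le> ent \<mu> (itinerary p f q)"
  shows "ennreal h \<le> metric_entropy X \<mu> \<phi>"
proof -
  define ls where "ls = sorted_list_of_set (p ` X)"
  have fin: "finite (p ` X)" using simple_functionD(1)[OF p] by (simp add: space_\<mu>)
  have ls: "set ls = p ` X" "distinct ls" using fin by (simp_all add: ls_def)
  define Ps where "Ps = map (\<lambda>i. p -` {i} \<inter> X) ls"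
  have "inj_on (\<lambda>i. p -` {i} \<inter> X) (p ` X)" by (rule inj_onI) blast
  then have dist: "distinct Ps" using ls by (simp add: Ps_def distinct_map)
  have "disjoint (set Ps)" unfolding Ps_def disjoint_def by auto
  moreover have "set Ps \<subseteq> sets \<mu>"
    using simple_functionD(2)[OF p] by (auto simp: Ps_def space_\<mu>)
  moreover have Un: "\<Union>(set Ps) = X" by (auto simp: Ps_def ls(1))
  ultimately have Ps: "ordered_partition \<mu> Ps"
    using dist by (simp add: ordered_partition_def space_\<mu>)
  let ?i = "part_index Ps"
  note si = simple_function_part_index[OF Ps]
  have determ: "p x = p y" if "x \<in> X" "y \<in> X" "?i x = ?i y" for x y
  proof -
    have "x \<in> \<Union>(set Ps)" using that(1) Un by simp
    then obtain j where j: "j < length Ps" "x \<in> Ps ! j" by (auto simp only: Union_iff in_set_conv_nth)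
    have "y \<in> Ps ! j"
      using part_index_eq[OF Ps j(1), of x] part_index_eq[OF Ps j(1), of y] j(2) that(3) by simp
    with j show ?thesis by (simp add: Ps_def)
  qed
  have "h \<le> ent \<mu> (itinerary ?i f n) / n" if n: "0 < n" for n
  proof -
    have "n * h \<le> ent \<mu> (itinerary p f n)" by (rule ge)
    also have "\<dots> \<le> ent \<mu> (itinerary ?i f n)"
    proof (rule ent_le_of_determined)
      fix x y assume "x \<in> space \<mu>" "y \<in> space \<mu>" "itinerary ?i f n x = itinerary ?i f n y"
      then show "itinerary p f n x = itinerary p f n y"
        unfolding itinerary_eq_iff space_\<mu> using determ funpow_closed[OF f_image] by blast
    qed (rule simple_function_itinerary[OF si f_measurable] simple_function_itinerary[OF p f_measurable])+
    finally show ?thesis using n by (simp add: pos_le_divide_eq mult.commute)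
  qed
  then have "\<forall>\<^sub>F n in sequentially. ennreal h \<le> ennreal (ent \<mu> (itinerary ?i f n) / n)"
    by (intro eventually_mono[OF eventually_gt_at_top[of 0]] ennreal_leI)
  then have "ennreal h \<le> liminf (\<lambda>n. ennreal (ent \<mu> (itinerary ?i f n) / n))"
    by (rule Liminf_bounded)
  also have "\<dots> \<le> limsup (\<lambda>n. ennreal (ent \<mu> (itinerary ?i f n) / n))"
    by (rule Liminf_le_Limsup) simp
  also have "\<dots> = metric_entropy_part X \<mu> \<phi> Ps"
    by (rule metric_entropy_part_eq[OF Ps, symmetric])
  also have "\<dots> \<le> metric_entropy X \<mu> \<phi>"
    unfolding metric_entropy_def using Ps by (intro SUP_upper) simp
  finally show ?thesis .
qed

lemma ex_invariant_limit_of_empirical: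
  fixes f :: "'a::metric_space \<Rightarrow> 'a"
  assumes X: "compact X" and f: "continuous_on X f" "f ` X \<subseteq> X"
    and E: "\<And>n. finite (E n)" "\<And>n. E n \<noteq> {}" "\<And>n. E n \<subseteq> X"
  obtains F m \<mu> where "F \<noteq> bot" "F \<le> sequentially"
    "\<And>A. ((\<lambda>n. empirical f (E n) n A) \<longlongrightarrow> m A) F"
    "finitely_additive_prob X m" "\<mu> \<in> map_invariant_measures X f"
    "\<And>U. openin (top_of_set X) U \<Longrightarrow> measure \<mu> U \<le> m U"
proof -
  obtain F m where F: "F \<noteq> bot" "F \<le> sequentially"
    "\<And>A. ((\<lambda>n. empirical f (E n) n A) \<longlongrightarrow> m A) F"
    "finitely_additive_prob X m" "\<And>A. m (f -` A \<inter> X) = m A"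
    by (rule ex_limit_of_empirical[OF X f(2) E]) (rule that)
  interpret m: finitely_additive_prob X m by (rule F(4))
  obtain \<mu> where \<mu>: "borel_prob_on X \<mu>" "\<And>U. openin (top_of_set X) U \<Longrightarrow> measure \<mu> U = m.inner U"
    by (rule m.ex_inner_measure) (rule that)
  have "\<mu> \<in> map_invariant_measures X f"
  proof (rule map_invariant_measuresI_openin[OF \<mu>(1) X f])
    fix U assume U: "openin (top_of_set X) U"
    have UX: "U \<subseteq> X" by (rule openin_imp_subset[OF U])
    have fU: "openin (top_of_set X) (f -` U \<inter> X)"
      using continuous_openin_preimage[OF f(1) _ U] f(2) by (simp add: Int_commute image_subset_iff_funcset)
    \<comment> \<open>Preimages of compact sets under \<open>f\<close> are compact in
      \<open>X\<close> and have the same \<open>m\<close>, so they compete in the supremum for the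
      preimage of \<open>U\<close>.\<close>
    have "m.inner U \<le> m.inner (f -` U \<inter> X)"
    proof (rule m.inner_least)
      fix C assume C: "compact C" "C \<subseteq> U"
      have "closedin (top_of_set X) (X \<inter> f -` C)"
        by (intro continuous_closedin_preimage[OF f(1)] compact_imp_closed C)
      then have "compact (f -` C \<inter> X)"
        using closedin_compact[OF X] by (simp add: Int_commute)
      then have "m (f -` C \<inter> X) \<le> m.inner (f -` U \<inter> X)"
        using C by (intro m.inner_upper) auto
      then show "m C \<le> m.inner (f -` U \<inter> X)" by (simp add: F(5))
    qed
    then show "measure \<mu> U \<le> measure \<mu> (f -` U \<inter> X)" by (simp add: \<mu>(2) U fU)
  qed
  moreover have "measure \<mu> U \<le> m U" if U: "openin (top_of_set X) U" for U
    using \<mu>(2)[OF U] m.inner_le[OF openin_imp_subset[OF U]] by simp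
  ultimately show thesis by (rule that[OF F(1-4)])
qed

text \<open>The partition is finer than the separation scale, so its itineraries distinguish the
  points of \<open>E n\<close>. Misiurewicz's inequality is then passed to the limit for each fixed
  block length \<open>q\<close>.\<close>

lemma ex_measure_entropy_ge_cover:
  fixes X :: "'a::metric_space set"
  assumes X: "compact X" "X \<noteq> {}" and multimap: "multimap_on X \<phi>" and lsc: "lsc_on X \<phi>"
    and f: "continuous_on X f" "\<And>x. x \<in> X \<Longrightarrow> f x \<in> \<phi> x" and A: "open_cover X \<A>"
    and preserving: "\<And>\<mu> A. \<mu> \<in> map_invariant_measures X f \<Longrightarrow> A \<in> sets \<mu> \<Longrightarrow>
      outer_measure_of \<mu> (large_preimage X \<phi> A) = emeasure \<mu> A"
  obtains \<mu> where "\<mu> \<in> map_invariant_measures X f"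
    "ennreal (top_entropy_cover X \<phi> \<A>) \<le> metric_entropy X \<mu> \<phi>"
proof -
  have fX: "f ` X \<subseteq> X" using f(2) multimap by (auto simp: multimap_on_def)
  obtain \<delta> where \<delta>: "0 < \<delta>" "\<And>x. x \<in> X \<Longrightarrow> \<exists>A\<in>\<A>. ball x \<delta> \<inter> X \<subseteq> A"
    by (rule ex_lebesgue_number[OF X(1) A]) (rule that)
  have "\<exists>E. E \<subseteq> X \<and> finite E \<and> E \<noteq> {} \<and> separated f \<delta> n E \<and>
      (\<forall>z\<in>X. \<exists>x\<in>E. \<forall>j<n. dist ((f ^^ j) x) ((f ^^ j) z) < \<delta>)" for n
    by (rule ex_maximal_separated[OF X fX \<delta>(1), of n]) blast
  from choice[OF allI[OF this]] obtain E where
    "\<forall>n. E n \<subseteq> X \<and> finite (E n) \<and> E n \<noteq> {} \<and> separated f \<delta> n (E n) \<and>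
      (\<forall>z\<in>X. \<exists>x\<in>E n. \<forall>j<n. dist ((f ^^ j) x) ((f ^^ j) z) < \<delta>)"
    by (rule exE)
  then have E: "\<And>n. E n \<subseteq> X" "\<And>n. finite (E n)" "\<And>n. E n \<noteq> {}" "\<And>n. separated f \<delta> n (E n)"
    "\<And>n z. z \<in> X \<Longrightarrow> \<exists>x\<in>E n. \<forall>j<n. dist ((f ^^ j) x) ((f ^^ j) z) < \<delta>"
    by simp_all
  let ?N = "\<lambda>n. min_subcover_card X (cover_iter X \<phi> \<A> n)"
  have N_pos: "0 < ?N n" for n
    by (rule min_subcover_card_pos[OF X(1) open_cover_cover_iter[OF multimap lsc A] X(2)])
  have N_le: "?N n \<le> card (E n)" for n
    by (rule min_subcover_card_le_card_spanning[OF multimap lsc A fX f(2) \<delta>(2) E(2,1) E(5)])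
  define h where "h = top_entropy_cover X \<phi> \<A>"
  have lim_h: "(\<lambda>n. ln (real (?N n)) / n) \<longlonglongrightarrow> h"
    unfolding h_def by (rule top_entropy_cover_tendsto[OF X multimap lsc A])
  obtain F m \<mu> where F: "F \<noteq> bot" "F \<le> sequentially"
    "\<And>A. ((\<lambda>n. empirical f (E n) n A) \<longlongrightarrow> m A) F" and m: "finitely_additive_prob X m"
    and \<mu>: "\<mu> \<in> map_invariant_measures X f"
    and \<mu>_le: "\<And>U. openin (top_of_set X) U \<Longrightarrow> measure \<mu> U \<le> m U"
    by (rule ex_invariant_limit_of_empirical[OF X(1) f(1) fX E(2,3,1)]) (rule that)
  have \<mu>_prob: "borel_prob_on X \<mu>" using \<mu> by (simp add: map_invariant_measures_def)
  interpret preserved_selection X \<phi> f \<mu>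
    by unfold_locales (use X multimap f \<mu>_prob preserving[OF \<mu>] in auto)
  interpret m: finitely_additive_prob X m by (rule m)
  obtain p :: "'a \<Rightarrow> nat" and Z where p: "simple_function \<mu> p" and Z: "Z \<in> null_sets \<mu>"
    and p_dist: "\<And>x y. x \<in> X \<Longrightarrow> y \<in> X \<Longrightarrow> p x = p y \<Longrightarrow> dist x y < \<delta>"
    and p_loc: "\<And>x. x \<in> X - Z \<Longrightarrow> \<exists>T. openin (top_of_set X) T \<and> x \<in> T \<and> (\<forall>y\<in>T. p y = p x)"
    by (rule ex_small_partition[OF \<mu>_prob X(1) \<delta>(1)]) (rule that)
  have fin: "finite (p ` X)" using simple_functionD(1)[OF p] by (simp add: space_\<mu>)
  have "q * h \<le> ent \<mu> (itinerary p f q)" for q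
  proof -
    let ?A = "\<lambda>as. itinerary p f q -` {as} \<inter> X"
    define L where "L = {as. set as \<subseteq> p ` X \<and> length as = q}"
    have L: "finite L" unfolding L_def by (rule finite_lists_length_eq[OF fin])
    have itin_L: "itinerary p f q x \<in> L" if "x \<in> X" for x
      using funpow_closed[OF fX that] by (auto simp: L_def itinerary_def)
    then have UN: "(\<Union>as\<in>L. ?A as) = X" by auto
    have disj: "disjoint_family_on ?A L" by (auto simp: disjoint_family_on_def)
    have sets: "?A as \<in> sets \<mu>" for as
      using simple_functionD(2)[OF simple_function_itinerary[OF p f_measurable]] by (simp add: space_\<mu>)
    have le: "measure \<mu> (?A as) \<le> m (?A as)" for as
      by (rule itinerary_cells_le_limit[OF m \<mu>_le p Z p_loc])
    \<comment> \<open>Both set functions have total mass 1 over the cells and one dominates the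
      other, so equality must hold cell by cell.\<close>
    have "(\<Sum>as\<in>L. m (?A as) - measure \<mu> (?A as)) = 0"
    proof -
      have "(\<Sum>as\<in>L. m (?A as)) = m (\<Union>as\<in>L. ?A as)"
        by (rule m.sum_UN[OF L _ disj, symmetric]) simp
      also have "\<dots> = 1" unfolding UN by (rule m.total)
      finally have "(\<Sum>as\<in>L. m (?A as)) = 1" .
      moreover have "(\<Sum>as\<in>L. measure \<mu> (?A as)) = measure \<mu> (\<Union>as\<in>L. ?A as)"
        by (rule finite_measure_finite_Union[OF L _ disj, symmetric]) (use sets in blast)
      moreover have "measure \<mu> (\<Union>as\<in>L. ?A as) = 1"
        unfolding UN using prob_space by (simp only: space_\<mu>)
      ultimately show ?thesis by (simp add: sum_subtractf)
    qed
    then have eq: "m (?A as) = measure \<mu> (?A as)" if "as \<in> L" for as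
      using that le by (subst (asm) sum_nonneg_eq_0_iff[OF L]) auto
    have lim_A: "((\<lambda>n. empirical f (E n) n {x. itinerary p f q x = as}) \<longlongrightarrow> measure \<mu> (?A as)) F"
      if "as \<in> L" for as
    proof -
      have "empirical f (E n) n {x. itinerary p f q x = as} = empirical f (E n) n (?A as)" for n
        using empirical_Int[OF E(1) fX, of n n "{x. itinerary p f q x = as}"]
        by (simp add: vimage_def Int_commute)
      then show ?thesis using F(3)[of "?A as"] eq[OF that] by simp
    qed
    have "((\<lambda>n. \<Sum>as\<in>L. eta (empirical f (E n) n {x. itinerary p f q x = as}))
        \<longlongrightarrow> (\<Sum>as\<in>L. eta (measure \<mu> (?A as)))) F"
      by (intro tendsto_sum tendsto_eta lim_A) (simp_all add: empirical_nonneg)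
    also have "(\<Sum>as\<in>L. eta (measure \<mu> (?A as))) = ent \<mu> (itinerary p f q)"
      unfolding space_\<mu>[symmetric] by (rule ent_eq_sum[OF L, symmetric]) (auto simp: space_\<mu> itin_L)
    finally have lim_ent: "((\<lambda>n. \<Sum>as\<in>L. eta (empirical f (E n) n {x. itinerary p f q x = as}))
        \<longlongrightarrow> ent \<mu> (itinerary p f q)) F" .
    have "((\<lambda>n. (real q)\<^sup>2 * ln (card (p ` X)) / real n) \<longlongrightarrow> 0) F"
      by (rule tendsto_mono[OF F(2) lim_const_over_n])
    from tendsto_add[OF this lim_ent]
    have right: "((\<lambda>n. (real q)\<^sup>2 * ln (card (p ` X)) / real n
        + (\<Sum>as\<in>L. eta (empirical f (E n) n {x. itinerary p f q x = as}))) \<longlongrightarrow> ent \<mu> (itinerary p f q)) F"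
      by simp
    \<comment> \<open>True convergence along all \<open>n\<close>, supplied by Fekete's lemma, is
      what carries the limit over to the finer filter \<open>F\<close>.\<close>
    have left: "((\<lambda>n. q * (ln (real (?N n)) / n)) \<longlongrightarrow> q * h) F"
      by (intro tendsto_mult_left tendsto_mono[OF F(2) lim_h])
    show ?thesis
    proof (rule tendsto_le[OF F(1) right left])
      have "q * (ln (real (?N n)) / n) \<le> (real q)\<^sup>2 * ln (card (p ` X)) / real n
        + (\<Sum>as\<in>L. eta (empirical f (E n) n {x. itinerary p f q x = as}))" if "0 < n" for n
      proof -
        have "ln (real (?N n)) \<le> ln (card (E n))"
          using N_pos[of n] N_le[of n] by (intro ln_mono) simp_all
        then have "q * (ln (real (?N n)) / n) \<le> q * ln (card (E n)) / n"
          by (simp add: divide_right_mono mult_left_mono)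
        also have "\<dots> \<le> (real q)\<^sup>2 * ln (card (p ` X)) / n
            + (\<Sum>as\<in>L. eta (empirical f (E n) n {x. itinerary p f q x = as}))"
          unfolding L_def
          by (rule misiurewicz_inequality[OF E(2,3,1) fX fin
                separated_inj_on_itinerary[OF E(4,1) fX p_dist] that])
        finally show ?thesis .
      qed
      then show "\<forall>\<^sub>F n in F. q * (ln (real (?N n)) / n) \<le> (real q)\<^sup>2 * ln (card (p ` X)) / real n
        + (\<Sum>as\<in>L. eta (empirical f (E n) n {x. itinerary p f q x = as}))"
        by (intro filter_leD[OF F(2)] eventually_mono[OF eventually_gt_at_top[of 0]])
    qed
  qed
  then have "ennreal h \<le> metric_entropy X \<mu> \<phi>"
    by (rule metric_entropy_ge_of_itineraries[OF p])
  with \<mu> show thesis unfolding h_def by (rule that)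
qed

theorem theorem4:
  fixes X :: "'a::banach set" and \<phi> :: "'a \<Rightarrow> 'a set"
  assumes compact_X: "compact X"
    and multimap: "multimap_on X \<phi>"
    and compact_values: "\<And>x. x \<in> X \<Longrightarrow> compact (\<phi> x)"
    and convex_values: "\<And>x. x \<in> X \<Longrightarrow> convex (\<phi> x)"
    and lsc: "lsc_on X \<phi>"
    and preserving: "\<And>\<mu> A. \<mu> \<in> invariant_measures X \<phi> \<Longrightarrow> A \<in> sets \<mu> \<Longrightarrow>
        outer_measure_of \<mu> (large_preimage X \<phi> A) = emeasure \<mu> A"
    and intersections: "\<And>\<mu> A B. \<mu> \<in> invariant_measures X \<phi> \<Longrightarrow> A \<in> sets \<mu> \<Longrightarrow> B \<in> sets \<mu> \<Longrightarrow>
        outer_measure_of \<mu> (large_preimage X \<phi> A \<inter> large_preimage X \<phi> B)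
          = outer_measure_of \<mu> (large_preimage X \<phi> (A \<inter> B))"
    and selections: "\<And>f \<mu>. continuous_selection X \<phi> f \<Longrightarrow> \<mu> \<in> map_invariant_measures X f \<Longrightarrow>
        metric_entropy X \<mu> \<phi> \<ge> map_entropy X \<mu> f"
  shows "(SUP \<mu>\<in>invariant_measures X \<phi>. metric_entropy X \<mu> \<phi>) = top_entropy X \<phi>"
proof (rule antisym)
  \<comment> \<open>The selection theorem tests with sets open in the whole space,
    \<open>lsc_on\<close> with sets open in \<open>X\<close>; values inside \<open>X\<close>
    reconcile the two.\<close>
  have lsc': "openin (top_of_set X) {x\<in>X. \<phi> x \<inter> B \<noteq> {}}" if "open B" for B
  proof -
    have "{x\<in>X. \<phi> x \<inter> B \<noteq> {}} = large_preimage X \<phi> (X \<inter> B)"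
      using multimap unfolding large_preimage_def multimap_on_def by blast
    with lsc that show ?thesis by (simp add: lsc_on_def openin_open_Int)
  qed
  have nonempty: "\<phi> x \<noteq> {}" if "x \<in> X" for x
    using multimap that by (simp add: multimap_on_def)
  obtain f where f: "continuous_on X f" "\<And>x. x \<in> X \<Longrightarrow> f x \<in> \<phi> x"
    by (rule michael_selection_compact[OF compact_X nonempty convex_values
          compact_imp_closed[OF compact_values] lsc']) (assumption | rule that)+
  have fX: "f ` X \<subseteq> X" using f(2) multimap by (auto simp: multimap_on_def)
  show "(SUP \<mu>\<in>invariant_measures X \<phi>. metric_entropy X \<mu> \<phi>) \<le> top_entropy X \<phi>"
  proof (rule SUP_least)
    fix \<mu> assume \<mu>: "\<mu> \<in> invariant_measures X \<phi>"
    have \<mu>_prob: "borel_prob_on X \<mu>" using \<mu> by (simp add: invariant_measures_def)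
    interpret preserved_selection X \<phi> f \<mu>
      by unfold_locales (use compact_X multimap f \<mu>_prob preserving[OF \<mu>] in auto)
    show "metric_entropy X \<mu> \<phi> \<le> top_entropy X \<phi>"
      by (rule metric_entropy_le_top_entropy[OF lsc])
  qed
  have invariant: "\<mu> \<in> invariant_measures X \<phi>" if \<mu>: "\<mu> \<in> map_invariant_measures X f" for \<mu>
  proof -
    have prob: "borel_prob_on X \<mu>" using \<mu> by (simp add: map_invariant_measures_def)
    have "emeasure \<mu> A \<le> outer_measure_of \<mu> (large_preimage X \<phi> A)" if A: "A \<in> sets \<mu>" for A
    proof -
      have "f -` A \<inter> X \<in> sets \<mu>"
        using measurable_sets[OF continuous_on_measurable_borel_prob[OF prob f(1) fX] A]
        by (simp add: borel_prob_on_space[OF prob])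
      then have "emeasure \<mu> A = outer_measure_of \<mu> (f -` A \<inter> X)"
        using \<mu> A by (simp add: map_invariant_measures_def)
      also have "\<dots> \<le> outer_measure_of \<mu> (large_preimage X \<phi> A)"
        using f(2) by (intro outer_measure_of_mono) (auto simp: large_preimage_def)
      finally show ?thesis .
    qed
    with prob show ?thesis by (simp add: invariant_measures_def)
  qed
  show "top_entropy X \<phi> \<le> (SUP \<mu>\<in>invariant_measures X \<phi>. metric_entropy X \<mu> \<phi>)"
    unfolding top_entropy_def
  proof (rule SUP_least)
    fix \<A> assume "\<A> \<in> {\<A>. open_cover X \<A>}"
    then have A: "open_cover X \<A>" by simp
    show "ennreal (top_entropy_cover X \<phi> \<A>) \<le> (SUP \<mu>\<in>invariant_measures X \<phi>. metric_entropy X \<mu> \<phi>)"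
    \<comment> \<open>On the empty space the empty family is a subcover, and \<open>ln 0 = 0\<close>
      makes the left side 0.\<close>
    proof (cases "X = {}")
      case True
      have "min_subcover_card X (cover_iter X \<phi> \<A> n) = 0" for n
        unfolding min_subcover_card_def using True by (intro Least_equality exI[of _ "{}"]) auto
      then have "top_entropy_cover X \<phi> \<A> = 0" by (simp add: top_entropy_cover_def)
      then show ?thesis by simp
    next
      case False
      obtain \<mu> where "\<mu> \<in> map_invariant_measures X f"
        "ennreal (top_entropy_cover X \<phi> \<A>) \<le> metric_entropy X \<mu> \<phi>"
        by (rule ex_measure_entropy_ge_cover[OF compact_X False multimap lsc f A preserving[OF invariant]])
          (assumption | rule that)+
      then show ?thesis by (meson SUP_upper2 invariant)
    qed
  qed
qed


end
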